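(* Let $N\ge 1$ and let $\mathcal{H}$ be either the Hardy space $H^2(B_N)$ or a weighted Bergman space $A^2_s(B_N)$ with $s>-1$. Suppose that $\varphi$ and $\psi$ are linear fractional self-maps of $B_N$. Then the difference $C_\varphi-C_\psi$ is compact on $\mathcal{H}$ if and only if either both $C_\varphi$ and $C_\psi$ are compact on $\mathcal{H}$, or $\varphi=\psi$.
   Context: $B_N$ is the open unit ball of $\mathbb{C}^N$, $\partial B_N$ the unit sphere, $\langle\cdot,\cdot\rangle$ the standard Hermitian inner product, $\sigma$ normalized Lebesgue measure on $\partial B_N$, $\nu$ normalized Lebesgue volume measure on $B_N$. $H^2(B_N)$ is the Hilbert space of holomorphic $f$ on $B_N$ with $\|f\|_2^2=\sup_{0<r<1}\int_{\partial B_N}|f(r\zeta)|^2\,d\sigma(\zeta)<\infty$. For $s>-1$, $A^2_s(B_N)$ is the Hilbert space of holomorphic $f$ on $B_N$ with $\|f\|_{2,s}^2=\int_{B_N}|f(z)|^2 w_s(z)\,d\nu(z)<\infty$, where $w_s(z)=\frac{\Gamma(N+s+1)}{\Gamma(N+1)\Gamma(s+1)}(1-|z|^2)^s$. For an analytic map $\varphi:B_N\to B_N$, $C_\varphi f=f\circ\varphi$. A linear fractional map of $\mathbb{C}^N$ is a map of the form $\varphi(z)=\frac{Az+B}{\langle z,C\rangle+d}$, where $A$ is an $N\times N$ complex matrix, $B,C$ are column vectors in $\mathbb{C}^N$ and $d\in\mathbb{C}$. It is a linear fractional self-map of $B_N$ if it maps $B_N$ into $B_N$ (with the denominator nonvanishing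 on $\overline{B_N}$, so that $\varphi$ is holomorphic in a neighborhood of $\overline{B_N}$). For every linear fractional self-map $\varphi$ of $B_N$, $C_\varphi$ is bounded on $H^2(B_N)$ and on $A^2_s(B_N)$, $s>-1$ (Cowen–MacCluer). *)

theory Defs
  imports "HOL-Analysis.Analysis"
begin

definition hermitian_inner :: "complex ^ 'n \<Rightarrow> complex ^ 'n \<Rightarrow> complex"
  where "hermitian_inner z w = (\<Sum>i\<in>UNIV. z $ i * cnj (w $ i))"

lemma hermitian_inner_self: "hermitian_inner z z = of_real ((norm z)\<^sup>2)"
  by (simp add: hermitian_inner_def norm_vec_def L2_set_def sum_nonneg complex_norm_square
      del: of_real_power)

text \<open>
  Holomorphy in several variables is Frechet differentiability with a complex-linear derivative;
  a derivative in the sense of \<^const>\<open>has_derivative\<close> is only real-linear, so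
  complex homogeneity is required separately.
\<close>

definition holomorphic_sv_on :: "(complex ^ 'n \<Rightarrow> complex) \<Rightarrow> (complex ^ 'n) set \<Rightarrow> bool"
  where "holomorphic_sv_on f S \<longleftrightarrow>
    (\<forall>z\<in>S. \<exists>D. (f has_derivative D) (at z within S) \<and> (\<forall>c v. D (c *s v) = c * D v))"

definition ball_measure :: "(complex ^ 'n) measure"
  where "ball_measure = uniform_measure lborel (ball 0 1)"

text \<open>
  The normalized surface measure of the unit sphere: the measure of \<open>E\<close> is the
  normalized volume of the part of the unit ball lying on the rays from the origin through
  \<open>E\<close> (integration in polar coordinates). It is carried by the sphere, but is formally a
  Borel measure on the whole space.
\<close>

definition sphere_measure :: "(complex ^ 'n) measure"
  where "sphere_measure = distr ball_measure borel sgn"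

lemma emeasure_ball_measure_UNIV: "emeasure (ball_measure :: (complex ^ 'n) measure) UNIV = 1"
proof -
  have "emeasure lborel (ball 0 1 :: (complex ^ 'n) set) \<noteq> 0"
    by (simp add: emeasure_lborel_ball_finite emeasure_ball unit_ball_vol_def ennreal_eq_0_iff)
      (simp add: not_le Gamma_real_pos)
  moreover have "emeasure lborel (ball 0 1 :: (complex ^ 'n) set) \<noteq> \<infinity>"
    using emeasure_lborel_ball_finite[of "0 :: complex ^ 'n" 1] by simp
  ultimately show ?thesis
    by (simp add: ball_measure_def ennreal_divide_self less_top)
qed

lemma emeasure_sphere_measure:
  assumes "E \<in> sets borel"
  shows "emeasure (sphere_measure :: (complex ^ 'n) measure) E =
    emeasure ball_measure {z. sgn z \<in> E}"
proof -
  have "sgn \<in> measurable (ball_measure :: (complex ^ 'n) measure) borel"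
    by (simp add: ball_measure_def)
  then show ?thesis
    using assms by (simp add: sphere_measure_def emeasure_distr vimage_def ball_measure_def)
qed

lemma emeasure_sphere_measure_sphere:
  "emeasure (sphere_measure :: (complex ^ 'n) measure) (sphere 0 1) = 1"
proof -
  have eq: "{z :: complex ^ 'n. sgn z \<in> sphere 0 1} = UNIV - {0}"
    by (auto simp: norm_sgn)
  have null: "emeasure (ball_measure :: (complex ^ 'n) measure) {0} = 0"
  proof -
    have "emeasure lborel (ball 0 1 \<inter> {0 :: complex ^ 'n}) = 0"
      by (simp add: Int_insert_right)
    then show ?thesis
      by (simp add: ball_measure_def)
  qed
  have "emeasure (ball_measure :: (complex ^ 'n) measure) (UNIV - {0}) = 1"
    using null emeasure_ball_measure_UNIV
    by (subst emeasure_Diff) (simp_all add: ball_measure_def)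
  then show ?thesis
    by (subst emeasure_sphere_measure) (simp_all only: eq borel_closed closed_sphere)
qed

text \<open>
  Functions on the unit ball are represented by total functions of which only the
  values on the ball matter; the norms below do not see the values elsewhere.
\<close>

definition hardy_sqnorm :: "(complex ^ 'n \<Rightarrow> complex) \<Rightarrow> ennreal"
  where "hardy_sqnorm f =
    (SUP r\<in>{0<..<1::real}. \<integral>\<^sup>+\<zeta>\<in>sphere 0 1. ennreal ((norm (f (r *\<^sub>R \<zeta>)))\<^sup>2) \<partial>sphere_measure)"

definition hardy_space :: "(complex ^ 'n \<Rightarrow> complex) set"
  where "hardy_space = {f. holomorphic_sv_on f (ball 0 1) \<and> hardy_sqnorm f < \<infinity>}"

definition hardy_norm :: "(complex ^ 'n \<Rightarrow> complex) \<Rightarrow> real"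
  where "hardy_norm f = sqrt (enn2real (hardy_sqnorm f))"

definition bergman_weight :: "real \<Rightarrow> complex ^ 'n \<Rightarrow> real"
  where "bergman_weight s z =
    Gamma (real CARD('n) + s + 1) / (Gamma (real CARD('n) + 1) * Gamma (s + 1)) *
      (1 - (norm z)\<^sup>2) powr s"

definition bergman_sqnorm :: "real \<Rightarrow> (complex ^ 'n \<Rightarrow> complex) \<Rightarrow> ennreal"
  where "bergman_sqnorm s f =
    (\<integral>\<^sup>+z\<in>ball 0 1. ennreal ((norm (f z))\<^sup>2 * bergman_weight s z) \<partial>ball_measure)"

definition bergman_space :: "real \<Rightarrow> (complex ^ 'n \<Rightarrow> complex) set"
  where "bergman_space s = {f. holomorphic_sv_on f (ball 0 1) \<and> bergman_sqnorm s f < \<infinity>}"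

definition bergman_norm :: "real \<Rightarrow> (complex ^ 'n \<Rightarrow> complex) \<Rightarrow> real"
  where "bergman_norm s f = sqrt (enn2real (bergman_sqnorm s f))"

text \<open>
  Compactness of a linear operator \<open>T\<close> on the function space \<open>H\<close> with norm \<open>nrm\<close>:
  \<open>T\<close> maps \<open>H\<close> into \<open>H\<close>, and the image of every norm-bounded sequence of \<open>H\<close>
  has a subsequence that converges in norm to an element of \<open>H\<close>.
\<close>

definition compact_operator_on ::
    "('a \<Rightarrow> complex) set \<Rightarrow> (('a \<Rightarrow> complex) \<Rightarrow> real) \<Rightarrow> (('a \<Rightarrow> complex) \<Rightarrow> ('a \<Rightarrow> complex)) \<Rightarrow> bool"
  where "compact_operator_on H nrm T \<longleftrightarrow>
    T ` H \<subseteq> H \<and>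
    (\<forall>f\<in>H. \<forall>g\<in>H. \<forall>a b. T (\<lambda>z. a * f z + b * g z) = (\<lambda>z. a * T f z + b * T g z)) \<and>
    (\<forall>F :: nat \<Rightarrow> 'a \<Rightarrow> complex. (\<forall>n. F n \<in> H) \<and> (\<exists>M. \<forall>n. nrm (F n) \<le> M) \<longrightarrow>
      (\<exists>r :: nat \<Rightarrow> nat. \<exists>g\<in>H. strict_mono r \<and> (\<lambda>n. nrm (\<lambda>z. T (F (r n)) z - g z)) \<longlonglongrightarrow> 0))"

definition composition_operator :: "('a \<Rightarrow> 'a) \<Rightarrow> ('a \<Rightarrow> complex) \<Rightarrow> ('a \<Rightarrow> complex)"
  where "composition_operator \<phi> f = f \<circ> \<phi>"

text \<open>
  Only the values of a self-map on the unit ball are constrained, so two self-maps are the same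
  map of the ball precisely if they agree on the ball.
\<close>

definition linear_fractional_self_map :: "(complex ^ 'n \<Rightarrow> complex ^ 'n) \<Rightarrow> bool"
  where "linear_fractional_self_map \<phi> \<longleftrightarrow>
    (\<exists>(A :: complex ^ 'n ^ 'n) (B :: complex ^ 'n) (C :: complex ^ 'n) (d :: complex).
      (\<forall>z\<in>cball 0 1. hermitian_inner z C + d \<noteq> 0) \<and>
      (\<forall>z\<in>ball 0 1. \<phi> z = inverse (hermitian_inner z C + d) *s (A *v z + B))) \<and>
    \<phi> ` ball 0 1 \<subseteq> ball 0 1"

end

theory Submission
  imports Defs "HOL-Complex_Analysis.Complex_Analysis"
begin

text \<open>
  If the difference is compact, testing it on normalized powers of the kernel at \<open>\<phi> z\<close> and
  evaluating the image at \<open>z\<close> shows that \<open>\<langle>\<phi> z - \<psi> z, \<phi> z\<rangle> = o(1 - |\<phi> z|\<^sup>2)\<close> wherever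
  \<open>(1 - |\<phi> z|\<^sup>2) / (1 - |z|\<^sup>2)\<close> stays bounded, and the same with \<open>\<phi>\<close> and \<open>\<psi>\<close> exchanged. If \<open>\<phi>\<close>
  maps a boundary point \<open>\<zeta>\<close> to the sphere, then \<open>\<phi> (\<zeta> + w) = \<phi> \<zeta> + L w / (1 + m w)\<close> with \<open>L\<close>, \<open>m\<close>
  linear, and the quotient is bounded along curves touching the sphere at \<open>\<zeta>\<close> to second order.
  Adding the two estimates gives \<open>|\<phi> - \<psi>| = o(t)\<close> along such curves, which identifies \<open>L\<close>; the
  estimate \<open>\<langle>\<phi> - \<psi>, \<phi> \<zeta>\<rangle> = o(t\<^sup>2)\<close> then identifies \<open>m\<close>, so \<open>\<phi> = \<psi>\<close>. If no boundary point is
  mapped to the sphere, the image of the ball is relatively compact and Montel's theorem gives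
  compactness.
\<close>

section \<open>Hermitian inner product\<close>

text \<open>Radial approach to \<zeta> would not suffice: there the defect 1 - |\<phi> z|^2 has the
  order of the displacement itself, and an error o(defect) concerns only the component of the
  derivative along \<phi> \<zeta>. On a curve touching the sphere the defect is O(t^2) while the
  displacement is of order t, so the sum of the two estimates, which is |\<phi> z - \<psi> z|^2,
  controls every component. Such curves run in real-tangent directions only, but these span the
  whole space over the complex numbers.

  The first estimate supplies this, through the equality case of Cauchy-Schwarz.

  On the analytic side, point evaluations and norms of kernel powers must scale with the same power
  of 1 - |z|^2. Averages over Euclidean balls would lose powers; hence caps and regions of size
  \<delta> in the complex direction of z and sqrt \<delta> across it. Crude constants are harmless,
  wrong exponents are not.\<close>

lemma hermitian_inner_add_left: "hermitian_inner (x + y) z = hermitian_inner x z + hermitian_inner y z"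
  by (simp add: hermitian_inner_def algebra_simps sum.distrib)

lemma hermitian_inner_diff_left: "hermitian_inner (x - y) z = hermitian_inner x z - hermitian_inner y z"
  by (simp add: hermitian_inner_def algebra_simps sum_subtractf)

lemma hermitian_inner_diff_right: "hermitian_inner z (x - y) = hermitian_inner z x - hermitian_inner z y"
  by (simp add: hermitian_inner_def algebra_simps sum_subtractf)

lemma hermitian_inner_smult_left: "hermitian_inner (c *s x) z = c * hermitian_inner x z"
  by (simp add: hermitian_inner_def algebra_simps sum_distrib_left)

lemma hermitian_inner_smult_right: "hermitian_inner z (c *s x) = cnj c * hermitian_inner z x"
  by (simp add: hermitian_inner_def algebra_simps sum_distrib_left)

lemma scaleR_eq_smult: "r *\<^sub>R (x :: complex ^ 'n) = of_real r *s x"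
  by (simp add: vec_eq_iff scaleR_conv_of_real[symmetric])

lemma hermitian_inner_scaleR_left: "hermitian_inner (r *\<^sub>R x) z = of_real r * hermitian_inner x z"
  by (simp add: scaleR_eq_smult hermitian_inner_smult_left)

lemma hermitian_inner_scaleR_right: "hermitian_inner z (r *\<^sub>R x) = of_real r * hermitian_inner z x"
  by (simp add: scaleR_eq_smult hermitian_inner_smult_right)

lemma hermitian_inner_minus_left: "hermitian_inner (- x) z = - hermitian_inner x z"
  by (simp add: hermitian_inner_def sum_negf)

lemma hermitian_inner_zero [simp]: "hermitian_inner 0 z = 0" "hermitian_inner z 0 = 0"
  by (simp_all add: hermitian_inner_def)

lemma hermitian_inner_commute: "hermitian_inner y x = cnj (hermitian_inner x y)"
  by (simp add: hermitian_inner_def algebra_simps)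

lemma inner_eq_Re_hermitian_inner: "x \<bullet> y = Re (hermitian_inner x y)"
  by (simp add: inner_vec_def hermitian_inner_def inner_complex_def)

lemma norm_smult: "norm (c *s (x :: complex ^ 'n)) = cmod c * norm x"
  by (simp add: norm_vec_def norm_mult L2_set_right_distrib)

lemma smult_add_right: "c *s (x + y :: complex ^ 'n) = c *s x + c *s y"
  by (simp add: vec_eq_iff algebra_simps)

lemma smult_diff_right: "c *s (x - y :: complex ^ 'n) = c *s x - c *s y"
  by (simp add: vec_eq_iff algebra_simps)

lemma linear_smult: "linear ((*s) c :: complex ^ 'n \<Rightarrow> complex ^ 'n)"
  by (rule linearI) (simp_all add: smult_add_right vec_eq_iff)

lemma norm_hermitian_inner_le: "cmod (hermitian_inner x y) \<le> norm x * norm y"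
proof (cases "hermitian_inner x y = 0")
  case False
  \<comment> \<open>A unimodular factor makes the inner product real and nonnegative, so the real
    Cauchy-Schwarz inequality applies.\<close>
  define c where "c = cnj (sgn (hermitian_inner x y))"
  have c: "cmod c = 1"
    using False by (simp add: c_def norm_sgn)
  have "c * hermitian_inner x y = of_real (cmod (hermitian_inner x y))"
    using False
    by (simp add: c_def sgn_div_norm divide_simps complex_norm_square[symmetric] power2_eq_square
        mult.commute scaleR_conv_of_real)
  then have "cmod (hermitian_inner x y) = (c *s x) \<bullet> y"
    by (simp add: inner_eq_Re_hermitian_inner hermitian_inner_smult_left)
  also have "\<dots> \<le> norm (c *s x) * norm y"
    by (rule norm_cauchy_schwarz)
  finally show ?thesis
    using c by (simp add: norm_smult)
qed simp

lemma bounded_linear_hermitian_inner_left: "bounded_linear (\<lambda>x. hermitian_inner x z)"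
  by (rule bounded_linear_intro[of _ "norm z"])
    (simp_all add: hermitian_inner_add_left hermitian_inner_scaleR_left norm_hermitian_inner_le
      scaleR_conv_of_real[where x = "hermitian_inner _ _"])

lemma borel_measurable_hermitian_inner [measurable]:
  assumes [measurable]: "f \<in> borel_measurable M" "g \<in> borel_measurable M"
  shows "(\<lambda>x. hermitian_inner (f x) (g x)) \<in> borel_measurable M"
proof -
  have [measurable]: "(\<lambda>x. f x $ i) \<in> borel_measurable M" "(\<lambda>x. g x $ i) \<in> borel_measurable M" for i
    by (rule borel_measurable_continuous_on[OF _ assms(1)] borel_measurable_continuous_on[OF _ assms(2)],
        intro continuous_intros)+
  have [measurable]: "(\<lambda>x. cnj (g x $ i)) \<in> borel_measurable M" for i
    by (rule borel_measurable_continuous_on[of cnj]) (auto intro: continuous_intros)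
  show ?thesis
    unfolding hermitian_inner_def by measurable
qed

lemma norm_add_square:
  "(norm (x + y :: complex ^ 'n))\<^sup>2 = (norm x)\<^sup>2 + 2 * Re (hermitian_inner y x) + (norm y)\<^sup>2"
  by (simp add: dot_square_norm[symmetric] inner_add_left inner_add_right inner_commute
      flip: inner_eq_Re_hermitian_inner)

lemma bounded_bilinear_smult: "bounded_bilinear (\<lambda>c (v :: complex ^ 'n). c *s v)"
  by (rule bounded_bilinear.intro)
     (auto simp: vec_eq_iff algebra_simps norm_smult intro!: exI[of _ 1])

lemmas tendsto_smult [tendsto_intros] = bounded_bilinear.tendsto[OF bounded_bilinear_smult]
lemmas continuous_on_smult = bounded_bilinear.continuous_on[OF bounded_bilinear_smult]

lemma tendsto_hermitian_inner [tendsto_intros]: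
  assumes "(f \<longlongrightarrow> a) F" "(g \<longlongrightarrow> b) F"
  shows "((\<lambda>x. hermitian_inner (f x) (g x)) \<longlongrightarrow> hermitian_inner a b) F"
  unfolding hermitian_inner_def using assms by (intro tendsto_intros)

section \<open>Lebesgue measure on the ball and polar coordinates\<close>

text \<open>
  Uniqueness of Haar measure: Fubini compares two translation-invariant measures through their
  common value on the unit ball.
\<close>

lemma lborel_distr_isometry:
  fixes f :: "'a::euclidean_space \<Rightarrow> 'a"
  assumes "linear f" and iso: "\<And>x. norm (f x) = norm x"
  shows "distr lborel borel f = lborel"
proof -
  have cont: "continuous_on UNIV f"
    using \<open>linear f\<close> by (simp add: linear_continuous_on linear_conv_bounded_linear)
  then have [measurable]: "f \<in> borel_measurable borel"
    by (rule borel_measurable_continuous_onI)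
  define \<mu> where "\<mu> = distr lborel borel f"
  have [simp, measurable_cong]: "sets \<mu> = sets borel"
    by (simp add: \<mu>_def)
  have [simp]: "space \<mu> = UNIV"
    by (simp add: \<mu>_def)
  have "inj f"
    using assms by (metis linear_injective_0 norm_eq_zero)
  then have "surj f"
    using \<open>linear f\<close> linear_injective_imp_surjective by blast
  have shift: "(\<integral>\<^sup>+x. g (x + c) \<partial>\<mu>) = (\<integral>\<^sup>+x. g x \<partial>\<mu>)"
    if [measurable]: "g \<in> borel_measurable borel" for g :: "'a \<Rightarrow> ennreal" and c
  proof -
    obtain c' where c': "c = f c'"
      using \<open>surj f\<close> by (metis surjD)
    have "(\<integral>\<^sup>+x. g (x + c) \<partial>\<mu>) = (\<integral>\<^sup>+x. g (f (c' + x)) \<partial>lborel)"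
      using \<open>linear f\<close> by (simp add: \<mu>_def nn_integral_distr c' linear_add add.commute)
    also have "\<dots> = (\<integral>\<^sup>+x. g (f x) \<partial>distr lborel borel ((+) c'))"
      by (subst nn_integral_distr) simp_all
    also have "\<dots> = (\<integral>\<^sup>+x. g x \<partial>\<mu>)"
      by (simp add: lborel_distr_plus \<mu>_def nn_integral_distr)
    finally show ?thesis .
  qed
  have shiftl: "(\<integral>\<^sup>+x. g (c + x) \<partial>lborel) = (\<integral>\<^sup>+x. g x \<partial>lborel)"
    if [measurable]: "g \<in> borel_measurable borel" for g :: "'a \<Rightarrow> ennreal" and c
    by (subst lborel_distr_plus[symmetric, of c]) (simp add: nn_integral_distr)
  have reflect: "(\<integral>\<^sup>+x. g (c - x) \<partial>lborel) = (\<integral>\<^sup>+x. g x \<partial>lborel)"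
    if [measurable]: "g \<in> borel_measurable borel" for g :: "'a \<Rightarrow> ennreal" and c
    by (subst lborel_affine[of "-1" c]) (simp_all add: nn_integral_density nn_integral_distr)
  have ball: "emeasure \<mu> (ball 0 r) = emeasure lborel (ball (0::'a) r)" for r
  proof -
    have "f -` ball 0 r = ball 0 r"
      by (auto simp: iso)
    then show ?thesis
      by (simp add: \<mu>_def emeasure_distr)
  qed
  interpret \<mu>: sigma_finite_measure \<mu>
  proof
    have "\<Union>(range (\<lambda>n::nat. ball (0::'a) (real n))) = UNIV"
      by (auto simp: reals_Archimedean2)
    then show "\<exists>A. countable A \<and> A \<subseteq> sets \<mu> \<and> \<Union>A = space \<mu> \<and> (\<forall>a\<in>A. emeasure \<mu> a \<noteq> \<infinity>)"
      by (intro exI[of _ "range (\<lambda>n::nat. ball (0::'a) (real n))"])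
         (use emeasure_lborel_ball_finite[of "0::'a"] in \<open>auto simp: ball less_top[symmetric]\<close>)
  qed
  interpret pair_sigma_finite \<mu> lborel ..
  have "emeasure \<mu> A = emeasure lborel A" if [measurable]: "A \<in> sets borel" for A
  proof -
    define B where "B = ball (0::'a) 1"
    have [measurable]: "B \<in> sets borel"
      by (simp add: B_def)
    have "emeasure lborel B * emeasure \<mu> A = (\<integral>\<^sup>+x. indicator A x * emeasure lborel B \<partial>\<mu>)"
      by (simp add: nn_integral_multc mult.commute)
    \<comment> \<open>The volume of B is written as the y-integral of a translated indicator. After
      the exchange, invariance of \<mu> moves the translate from B to A, and reflection invariance
      of Lebesgue measure then frees A from x.\<close>
    also have "\<dots> = (\<integral>\<^sup>+x. \<integral>\<^sup>+y. indicator A x * indicator B (x + y) \<partial>lborel \<partial>\<mu>)"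
      by (simp add: nn_integral_cmult shiftl[of "indicator B"])
    also have "\<dots> = (\<integral>\<^sup>+y. \<integral>\<^sup>+x. indicator A x * indicator B (x + y) \<partial>\<mu> \<partial>lborel)"
      by (rule Fubini'[symmetric]) measurable
    also have "\<dots> = (\<integral>\<^sup>+y. \<integral>\<^sup>+x. indicator A (x - y) * indicator B x \<partial>\<mu> \<partial>lborel)"
    proof (rule nn_integral_cong)
      fix y
      show "(\<integral>\<^sup>+x. indicator A x * indicator B (x + y) \<partial>\<mu>)
          = (\<integral>\<^sup>+x. indicator A (x - y) * indicator B x \<partial>\<mu>)"
        using shift[of "\<lambda>x. indicator A (x - y) * indicator B x" y] by simp
    qed
    also have "\<dots> = (\<integral>\<^sup>+x. \<integral>\<^sup>+y. indicator A (x - y) * indicator B x \<partial>lborel \<partial>\<mu>)"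
      by (rule Fubini') measurable
    also have "\<dots> = (\<integral>\<^sup>+x. emeasure lborel A * indicator B x \<partial>\<mu>)"
      by (simp add: nn_integral_multc reflect[of "indicator A"])
    also have "\<dots> = emeasure lborel A * emeasure lborel B"
      by (subst nn_integral_cmult_indicator) (simp_all add: ball B_def)
    finally have "emeasure lborel B * emeasure \<mu> A = emeasure lborel B * emeasure lborel A"
      by (simp add: mult.commute)
    moreover have "emeasure lborel B \<noteq> 0" "emeasure lborel B \<noteq> top"
      using emeasure_lborel_ball_finite[of "0::'a" 1]
      by (simp_all add: B_def emeasure_ball unit_ball_vol_def ennreal_eq_0_iff not_le Gamma_real_pos)
    ultimately show ?thesis
      by (simp add: ennreal_mult_cancel_left)
  qed
  then show ?thesis
    by (intro measure_eqI) (auto simp flip: \<mu>_def)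
qed

text \<open>Half-lines unbounded below are where the cone volumes are known. They are stable under
  intersection, generate the Borel sets and exhaust the line, so finiteness on each of them is
  enough for uniqueness.\<close>

lemma measure_eqI_lessThan_finite:
  fixes M N :: "real measure"
  assumes [simp]: "sets M = sets borel" "sets N = sets borel"
    and "\<And>x. emeasure M {..<x} = emeasure N {..<x}" "\<And>x. emeasure M {..<x} \<noteq> \<infinity>"
  shows "M = N"
proof (rule measure_eqI_generator_eq)
  show "Int_stable (range (lessThan :: real \<Rightarrow> real set))"
    unfolding Int_stable_def by (auto simp: image_iff set_eq_iff intro: exI[where x = "min _ _"])
  show "range (lessThan :: real \<Rightarrow> real set) \<subseteq> Pow UNIV"
    by simp
  show "sets M = sigma_sets UNIV (range lessThan)" "sets N = sigma_sets UNIV (range lessThan)"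
    by (simp_all add: borel_Iio)
  show "range (\<lambda>n::nat. {..<real n}) \<subseteq> range lessThan"
    by auto
  show "(\<Union>n::nat. {..<real n}) = UNIV"
    by (auto simp: reals_Archimedean2)
qed (use assms in auto)

section \<open>Polar coordinates for the normalized measures\<close>

lemma finite_measure_ball_measure: "finite_measure (ball_measure :: (complex ^ 'n) measure)"
  using emeasure_ball_measure_UNIV[where ?'n = 'n]
  by (intro finite_measureI) (simp only: ball_measure_def space_uniform_measure space_lborel space_borel,
    simp)

lemma sets_ball_measure [simp, measurable_cong]: "sets ball_measure = sets borel"
  by (simp add: ball_measure_def)

lemma space_ball_measure [simp]: "space ball_measure = UNIV"
  by (simp add: ball_measure_def)

lemma sets_sphere_measure [simp, measurable_cong]: "sets sphere_measure = sets borel"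
  by (simp add: sphere_measure_def)

lemma space_sphere_measure [simp]: "space sphere_measure = UNIV"
  by (simp add: sphere_measure_def)

lemma finite_measure_sphere_measure: "finite_measure (sphere_measure :: (complex ^ 'n) measure)"
  unfolding sphere_measure_def
  by (rule finite_measure.finite_measure_distr[OF finite_measure_ball_measure]) simp

lemma AE_sphere_measure: "AE \<zeta> in (sphere_measure :: (complex ^ 'n) measure). \<zeta> \<in> sphere 0 1"
proof (rule AE_I')
  have "emeasure sphere_measure (UNIV - sphere 0 1 :: (complex ^ 'n) set) = emeasure sphere_measure (UNIV :: (complex ^ 'n) set) - 1"
    by (subst emeasure_Diff) (simp_all add: emeasure_sphere_measure_sphere)
  then show "UNIV - sphere 0 1 \<in> null_sets (sphere_measure :: (complex ^ 'n) measure)"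
    by (simp add: null_sets_def emeasure_sphere_measure emeasure_ball_measure_UNIV)
qed auto

lemma nn_integral_sphere_measure_sphere:
  "(\<integral>\<^sup>+\<zeta>\<in>sphere 0 1. f \<zeta> \<partial>sphere_measure) = (\<integral>\<^sup>+\<zeta>. f \<zeta> \<partial>sphere_measure)"
  by (rule nn_integral_cong_AE) (use AE_sphere_measure in eventually_elim, simp)

lemma emeasure_ball_measure:
  assumes "A \<in> sets borel"
  shows "emeasure (ball_measure :: (complex ^ 'n) measure) A
    = emeasure lborel (ball 0 1 \<inter> A) / emeasure lborel (ball (0 :: complex ^ 'n) 1)"
  using assms by (simp add: ball_measure_def)

lemma emeasure_lborel_unit_ball:
  "emeasure lborel (ball (0 :: 'a::euclidean_space) 1) \<noteq> 0"
  "emeasure lborel (ball (0 :: 'a::euclidean_space) 1) \<noteq> top"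
  using emeasure_lborel_ball_finite[of "0::'a" 1]
  by (simp_all add: emeasure_ball unit_ball_vol_def ennreal_eq_0_iff not_le Gamma_real_pos)

lemma emeasure_lborel_scale:
  fixes A :: "'a::euclidean_space set"
  assumes "A \<in> sets borel" "0 < r"
  shows "emeasure lborel {x. inverse r *\<^sub>R x \<in> A} = ennreal (r ^ DIM('a)) * emeasure lborel A"
  using assms
proof -
  have "{x. inverse r *\<^sub>R x \<in> A} \<in> sets borel"
    using assms(1) by measurable
  moreover have "((*\<^sub>R) r) -` {x. inverse r *\<^sub>R x \<in> A} = A"
    using assms(2) by auto
  ultimately show ?thesis
    using assms
    by (subst lborel_affine[of r 0]) (simp_all add: emeasure_density nn_integral_cmult emeasure_distr)
qed

text \<open>Dilation by r carries the unit cone over \<open>E\<close> to this one, and the real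
  dimension of the space is 2 N. The unit cone has mass \<open>sphere_measure E\<close> by the very
  definition of the surface measure.\<close>

lemma emeasure_ball_measure_cone:
  fixes E :: "(complex ^ 'n) set"
  assumes [measurable]: "E \<in> sets borel" and r: "0 \<le> r" "r \<le> 1"
  shows "emeasure ball_measure {z. norm z < r \<and> sgn z \<in> E}
    = ennreal (r ^ (2 * CARD('n))) * emeasure sphere_measure E"
proof (cases "r = 0")
  case False
  with r have r: "0 < r" "r \<le> 1"
    by auto
  define A where "A = {z. norm z < 1 \<and> sgn z \<in> E}"
  have [measurable]: "A \<in> sets borel"
    unfolding A_def by measurable
  have "{z. norm z < r \<and> sgn z \<in> E} = {z. inverse r *\<^sub>R z \<in> A}"
    using r by (auto simp: A_def sgn_scaleR field_simps)
  moreover have "ball 0 1 \<inter> {z. norm z < r \<and> sgn z \<in> E} = {z. norm z < r \<and> sgn z \<in> E}"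
    using r by auto
  moreover have "ball 0 1 \<inter> {z. sgn z \<in> E} = A"
    by (auto simp: A_def)
  ultimately show ?thesis
    using r emeasure_lborel_scale[of A r]
    by (simp add: emeasure_ball_measure emeasure_sphere_measure ennreal_times_divide mult.commute[of 2])
qed simp

lemma nn_integral_radial_density:
  assumes "0 \<le> x" "n > 0"
  shows "(\<integral>\<^sup>+r. ennreal (real n * r ^ (n - 1)) * indicator {0<..<x} r \<partial>lborel) = ennreal (x ^ n)"
proof -
  have "(\<integral>\<^sup>+r. ennreal (real n * r ^ (n - 1)) * indicator {0<..<x} r \<partial>lborel)
      = (\<integral>\<^sup>+r. ennreal (real n * r ^ (n - 1)) * indicator {0..x} r \<partial>lborel)"
    by (rule nn_integral_cong_AE, use AE_lborel_singleton[of 0] AE_lborel_singleton[of x] in eventually_elim)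
       (auto simp: indicator_def)
  also have "\<dots> = ennreal (x ^ n - 0 ^ n)"
    by (rule nn_integral_FTC_Icc) (use assms in \<open>auto intro!: derivative_eq_intros\<close>)
  finally show ?thesis
    using assms by simp
qed

text \<open>The pair (norm z, sgn z) is distributed as a product: the radial law with distribution
  function x^(2 N) times the surface measure. Agreement on rectangles suffices, and for fixed
  \<open>E\<close> both sides are finite measures of the radial set, so the cone formula on
  half-lines decides. The origin is harmless because sgn 0 = 0.\<close>

lemma nn_integral_ball_measure_polar:
  fixes F :: "complex ^ 'n \<Rightarrow> ennreal"
  assumes [measurable]: "F \<in> borel_measurable borel"
  shows "(\<integral>\<^sup>+z. F z \<partial>ball_measure) = (\<integral>\<^sup>+r\<in>{0<..<1}.
    ennreal (2 * real CARD('n) * r ^ (2 * CARD('n) - 1)) * (\<integral>\<^sup>+\<zeta>\<in>sphere 0 1. F (r *\<^sub>R \<zeta>) \<partial>sphere_measure) \<partial>lborel)"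
proof -
  define n where "n = 2 * CARD('n)"
  have n: "n > 0"
    by (simp add: n_def)
  define \<rho> where "\<rho> = density lborel (\<lambda>r. ennreal (real n * r ^ (n - 1)) * indicator {0<..<1::real} r)"
  have [simp, measurable_cong]: "sets \<rho> = sets borel"
    by (simp add: \<rho>_def)
  interpret B: finite_measure "ball_measure :: (complex ^ 'n) measure"
    by (rule finite_measure_ball_measure)
  interpret S: finite_measure "sphere_measure :: (complex ^ 'n) measure"
    by (rule finite_measure_sphere_measure)
  have \<rho>_less: "emeasure \<rho> {..<x} = ennreal ((max 0 (min x 1)) ^ n)" for x
  proof -
    have "{0<..<1} \<inter> {..<x} = {0<..<max 0 (min x 1)}"
      by (auto simp: max_def min_def)
    then show ?thesis
      using nn_integral_radial_density[of "max 0 (min x 1)" n] n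
      by (simp add: \<rho>_def emeasure_density mult.assoc flip: indicator_inter_arith)
  qed
  interpret R: finite_measure \<rho>
  proof
    have "emeasure \<rho> (space \<rho>) = emeasure \<rho> {..<1}"
      by (simp add: \<rho>_def emeasure_density mult.assoc flip: indicator_inter_arith)
         (rule arg_cong2[where f = nn_integral], auto simp: indicator_def)
    then show "emeasure \<rho> (space \<rho>) \<noteq> \<infinity>"
      by (simp add: \<rho>_less)
  qed
  define D where "D = distr (ball_measure :: (complex ^ 'n) measure) (borel \<Otimes>\<^sub>M borel) (\<lambda>z. (norm z, sgn z))"
  have "\<rho> \<Otimes>\<^sub>M sphere_measure = D"
  proof (rule pair_measure_eqI)
    show "sigma_finite_measure \<rho>" ..
    show "sigma_finite_measure (sphere_measure :: (complex ^ 'n) measure)" ..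
    show "sets (\<rho> \<Otimes>\<^sub>M (sphere_measure :: (complex ^ 'n) measure)) = sets D"
      unfolding D_def sets_distr by (intro sets_pair_measure_cong) simp_all
    fix A and E :: "(complex ^ 'n) set"
    assume "A \<in> sets \<rho>" "E \<in> sets sphere_measure"
    then have [measurable]: "A \<in> sets borel" "E \<in> sets borel"
      by simp_all
    define \<mu>1 where "\<mu>1 = distr (restrict_space (ball_measure :: (complex ^ 'n) measure) {z. sgn z \<in> E}) borel norm"
    define \<mu>2 where "\<mu>2 = scale_measure (emeasure sphere_measure E) \<rho>"
    have [measurable]: "norm \<in> measurable (restrict_space (ball_measure :: (complex ^ 'n) measure) {z. sgn z \<in> E}) borel"
      by (rule measurable_restrict_space1) simp
    have \<mu>1: "emeasure \<mu>1 X = emeasure ball_measure {z. norm z \<in> X \<and> sgn z \<in> E}" if [measurable]: "X \<in> sets borel" for X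
      unfolding \<mu>1_def
      by (subst emeasure_distr) (auto simp: emeasure_restrict_space space_restrict_space intro!: arg_cong[where f = "emeasure _"])
    have "\<mu>1 = \<mu>2"
    proof (rule measure_eqI_lessThan_finite)
      fix x :: real
      consider "x \<le> 0" | "0 < x" "x \<le> 1" | "1 < x"
        by linarith
      then show "emeasure \<mu>1 {..<x} = emeasure \<mu>2 {..<x}"
      proof cases
        case 1
        then have "{z. norm z \<in> {..<x} \<and> sgn z \<in> E} = {}"
          using norm_ge_zero order.strict_trans2 by fastforce
        then show ?thesis
          using n 1 by (simp only: \<mu>1[OF borel_open[OF open_lessThan]]) (simp add: \<mu>2_def \<rho>_less zero_power)
      next
        case 2
        then show ?thesis
          using emeasure_ball_measure_cone[of E x] by (simp add: \<mu>1 \<mu>2_def \<rho>_less n_def mult.commute)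
      next
        case 3
        have "emeasure ball_measure {z. norm z < x \<and> sgn z \<in> E} = emeasure ball_measure {z. sgn z \<in> E}"
          using 3 by (subst (1 2) emeasure_ball_measure) (auto intro!: arg_cong[where f = "\<lambda>A. emeasure _ A / _"])
        then show ?thesis
          using 3 by (simp add: \<mu>1 \<mu>2_def \<rho>_less emeasure_sphere_measure mult.commute)
      qed
      show "emeasure \<mu>1 {..<x} \<noteq> \<infinity>"
        by (simp add: \<mu>1 B.emeasure_eq_measure)
    qed (simp_all add: \<mu>1_def \<mu>2_def)
    then have "emeasure \<mu>1 A = emeasure \<mu>2 A"
      by simp
    then have "emeasure \<rho> A * emeasure sphere_measure E = emeasure ball_measure {z. norm z \<in> A \<and> sgn z \<in> E}"
      by (simp add: \<mu>1 \<mu>2_def mult.commute)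
    also have "\<dots> = emeasure D (A \<times> E)"
      unfolding D_def by (subst emeasure_distr) (auto simp: vimage_def)
    finally show "emeasure \<rho> A * emeasure sphere_measure E = emeasure D (A \<times> E)" .
  qed
  interpret pair_sigma_finite \<rho> "sphere_measure :: (complex ^ 'n) measure" ..
  have "norm z *\<^sub>R sgn z = z" for z :: "complex ^ 'n"
    by (cases "z = 0") (simp_all add: sgn_div_norm)
  then have "(\<integral>\<^sup>+z. F z \<partial>ball_measure) = (\<integral>\<^sup>+z. F (norm z *\<^sub>R sgn z) \<partial>ball_measure)"
    by simp
  also have "\<dots> = (\<integral>\<^sup>+p. F (fst p *\<^sub>R snd p) \<partial>D)"
    unfolding D_def by (subst nn_integral_distr) simp_all
  also have "\<dots> = (\<integral>\<^sup>+p. F (fst p *\<^sub>R snd p) \<partial>(\<rho> \<Otimes>\<^sub>M sphere_measure))"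
    using \<open>\<rho> \<Otimes>\<^sub>M sphere_measure = D\<close> by simp
  also have "\<dots> = (\<integral>\<^sup>+r. \<integral>\<^sup>+\<zeta>. F (r *\<^sub>R \<zeta>) \<partial>sphere_measure \<partial>\<rho>)"
    by (subst S.nn_integral_fst[symmetric]) simp_all
  also have "\<dots> = (\<integral>\<^sup>+r. ennreal (real n * r ^ (n - 1)) * indicator {0<..<1::real} r * (\<integral>\<^sup>+\<zeta>. F (r *\<^sub>R \<zeta>) \<partial>sphere_measure) \<partial>lborel)"
    unfolding \<rho>_def
  proof (rule nn_integral_density)
    show "(\<lambda>r. \<integral>\<^sup>+\<zeta>. F (r *\<^sub>R \<zeta>) \<partial>sphere_measure) \<in> borel_measurable lborel"
      by (rule S.borel_measurable_nn_integral) simp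
  qed simp
  finally show ?thesis
    by (simp add: nn_integral_sphere_measure_sphere n_def mult_ac)
qed

section \<open>Nonisotropic caps and regions\<close>

lemma emeasure_lborel_translate:
  fixes c :: "'a::euclidean_space"
  assumes "A \<in> sets borel"
  shows "emeasure lborel {x. x - c \<in> A} = emeasure lborel A"
  using assms
  by (subst (2) lborel_distr_plus[symmetric, of "- c"]) (simp add: emeasure_distr vimage_def)

lemma emeasure_ball_measure_le_1: "emeasure (ball_measure :: (complex ^ 'n) measure) A \<le> 1"
proof -
  have "emeasure (ball_measure :: (complex ^ 'n) measure) A \<le> emeasure (ball_measure :: (complex ^ 'n) measure) (space ball_measure)"
    by (rule emeasure_space)
  then show ?thesis
    by (simp add: emeasure_ball_measure_UNIV)
qed

lemma emeasure_sphere_measure_UNIV: "emeasure (sphere_measure :: (complex ^ 'n) measure) UNIV = 1"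
  by (simp add: emeasure_sphere_measure emeasure_ball_measure_UNIV)

lemma emeasure_sphere_measure_le_1: "emeasure (sphere_measure :: (complex ^ 'n) measure) A \<le> 1"
proof -
  have "emeasure (sphere_measure :: (complex ^ 'n) measure) A \<le> emeasure (sphere_measure :: (complex ^ 'n) measure) (space sphere_measure)"
    by (rule emeasure_space)
  then show ?thesis
    by (simp add: emeasure_sphere_measure_UNIV)
qed

text \<open>
  About \<open>1 / \<epsilon>\<close> disjoint translates of the cap \<open>{z. \<bar>1 - \<langle>z, b\<rangle>\<bar> < \<epsilon>}\<close>
  along the complex line through \<open>b\<close> fit into a ball of radius comparable to \<open>sqrt \<epsilon>\<close>.
\<close>

lemma emeasure_ball_cap_le:
  fixes b :: "complex ^ 'n"
  assumes b: "norm b \<le> 1" and "0 < \<epsilon>"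
  shows "emeasure ball_measure {z. cmod (1 - hermitian_inner z b) < \<epsilon>}
    \<le> ennreal (4 * 169 ^ CARD('n) * \<epsilon> ^ (CARD('n) + 1))"
proof (cases "\<epsilon> \<le> 1 / 4")
  case False
  \<comment> \<open>For \<epsilon> > 1/4 the claimed bound is at least 1, the total mass.\<close>
  have "1 = 4 * 4 ^ CARD('n) * (1 / 4 :: real) ^ (CARD('n) + 1)"
    by (simp add: power_divide)
  also have "\<dots> \<le> 4 * 169 ^ CARD('n) * \<epsilon> ^ (CARD('n) + 1)"
    using False by (intro mult_mono power_mono) auto
  finally have "ennreal 1 \<le> ennreal (4 * 169 ^ CARD('n) * \<epsilon> ^ (CARD('n) + 1))"
    by (rule ennreal_leI)
  then show ?thesis
    unfolding ennreal_1 by (rule order_trans[OF emeasure_ball_measure_le_1])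
next
  case True
  define E where "E = {z \<in> ball 0 1. cmod (1 - hermitian_inner z b) < \<epsilon>}"
  have [measurable]: "E \<in> sets borel"
    unfolding E_def by measurable
  have eq: "ball 0 1 \<inter> {z. cmod (1 - hermitian_inner z b) < \<epsilon>} = E"
    by (auto simp: E_def)
  have [measurable]: "{z. cmod (1 - hermitian_inner z b) < \<epsilon>} \<in> sets borel"
    by measurable
  show ?thesis
  proof (cases "E = {}")
    case True
    then show ?thesis
      using eq by (simp add: emeasure_ball_measure)
  next
    case False
    then obtain z0 where z0: "norm z0 < 1" "cmod (1 - hermitian_inner z0 b) < \<epsilon>"
      by (auto simp: E_def)
    have "1 - \<epsilon> < cmod (hermitian_inner z0 b)"
      using z0(2) norm_triangle_ineq2[of 1 "hermitian_inner z0 b"] by simp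
    also have "\<dots> \<le> norm z0 * norm b"
      by (rule norm_hermitian_inner_le)
    also have "\<dots> \<le> 1 * norm b"
      using z0(1) by (intro mult_right_mono) auto
    finally have nb: "3 / 4 < norm b"
      using \<open>\<epsilon> \<le> 1 / 4\<close> by simp
    \<comment> \<open>A vector dual to b: translation by \<open>c *s b'\<close> shifts the inner
      product with b by exactly c. Nonemptiness of the cap has forced |b| > 3/4, which keeps this
      vector short.\<close>
    define b' where "b' = (1 / (norm b)\<^sup>2) *\<^sub>R b"
    have b'b: "hermitian_inner b' b = 1"
      using nb by (auto simp: b'_def hermitian_inner_scaleR_left hermitian_inner_self)
    have nb': "norm b' \<le> 4 / 3"
      using nb by (simp add: b'_def power2_eq_square divide_simps)
    define q where "q = sqrt \<epsilon>"
    have q: "0 < q" "q \<le> 1 / 2" and \<epsilon>: "\<epsilon> = q\<^sup>2"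
      using \<open>0 < \<epsilon>\<close> True real_sqrt_le_mono[of \<epsilon> "1 / 4"] by (auto simp: q_def real_sqrt_divide)
    \<comment> \<open>Since 1/q \<ge> 2, rounding down loses at most half, so K^2 \<ge> 1/(4
      \<epsilon>). This is the factor 4 in the bound.\<close>
    define K where "K = nat \<lfloor>1 / q\<rfloor>"
    have "2 \<le> 1 / q"
      using q by (simp add: field_simps)
    then have "real K = \<lfloor>1 / q\<rfloor>"
      using q by (simp add: K_def)
    moreover have "1 / (2 * q) = (1 / q) / 2"
      by simp
    ultimately have K: "real K \<le> 1 / q" "1 / (2 * q) \<le> real K"
      using \<open>2 \<le> 1 / q\<close> by linarith+
    \<comment> \<open>Inner products with b of two points of the cap differ by less than 2
      \<epsilon>, so the spacing 4 \<epsilon> makes the K^2 translates disjoint.\<close>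
    define \<tau> where "\<tau> = (\<lambda>(i, j). (of_real (4 * \<epsilon>) * Complex (real i) (real j)) *s b')"
    define T where "T = (\<lambda>p. {x. x - \<tau> p \<in> E})"
    have hip_\<tau>: "hermitian_inner (\<tau> (i, j)) b = of_real (4 * \<epsilon>) * Complex (real i) (real j)" for i j
      by (simp add: \<tau>_def hermitian_inner_smult_left b'b)
    have disj: "disjoint_family_on T ({..<K} \<times> {..<K})"
    proof (clarsimp simp: disjoint_family_on_def set_eq_iff)
      fix i j i' j' x
      assume x: "x \<in> T (i, j)" "x \<in> T (i', j')" and ne: "i = i' \<longrightarrow> j \<noteq> j'"
      define u where "u = Complex (real i - real i') (real j - real j')"
      have "of_real (4 * \<epsilon>) * u = (1 - hermitian_inner (x - \<tau> (i, j)) b) - (1 - hermitian_inner (x - \<tau> (i', j')) b)"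
        by (simp add: hermitian_inner_diff_left hip_\<tau> u_def complex_eq_iff algebra_simps)
      also have "cmod \<dots> < \<epsilon> + \<epsilon>"
        using x norm_triangle_ineq4[of "1 - hermitian_inner (x - \<tau> (i, j)) b" "1 - hermitian_inner (x - \<tau> (i', j')) b"]
        by (simp add: T_def E_def)
      finally have "cmod u < 1 / 2"
        using \<open>0 < \<epsilon>\<close> by (simp add: norm_mult)
      then have "\<bar>real i - real i'\<bar> < 1 / 2" "\<bar>real j - real j'\<bar> < 1 / 2"
        using abs_Re_le_cmod[of u] abs_Im_le_cmod[of u] by (auto simp: u_def)
      then show False
        using ne by linarith
    qed
    \<comment> \<open>13 rounds up 2 + 32/3: the cap lies within 2 q of b because |y - b|^2 \<le> 2
      - 2 Re <y,b> < 2 \<epsilon>, and the translations have length at most (32/3) q.\<close>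
    have sub: "(\<Union>p\<in>{..<K} \<times> {..<K}. T p) \<subseteq> ball b (13 * q)"
    proof clarsimp
      fix i j x
      assume ij: "i < K" "j < K" and "x \<in> T (i, j)"
      then have x: "norm (x - \<tau> (i, j)) < 1" "cmod (1 - hermitian_inner (x - \<tau> (i, j)) b) < \<epsilon>"
        by (auto simp: T_def E_def)
      define y where "y = x - \<tau> (i, j)"
      have "Re (1 - hermitian_inner y b) < \<epsilon>"
        using x(2) complex_Re_le_cmod order.strict_trans1 unfolding y_def by blast
      moreover have "Re (hermitian_inner b y) = Re (hermitian_inner y b)"
        by (subst hermitian_inner_commute) simp
      ultimately have "(norm (y + (- b)))\<^sup>2 \<le> 1 + 1 - 2 * (1 - \<epsilon>)"
        unfolding norm_add_square hermitian_inner_minus_left using x(1) b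
        by (simp add: y_def[symmetric]) (smt (verit) power_le_one norm_ge_zero)
      also have "\<dots> \<le> (2 * q)\<^sup>2"
        by (simp add: \<epsilon> power_mult_distrib)
      finally have "(norm (y - b))\<^sup>2 \<le> (2 * q)\<^sup>2"
        by simp
      then have "norm (y - b) \<le> 2 * q"
        by (rule power2_le_imp_le) (use q in simp)
      moreover have "norm (\<tau> (i, j)) \<le> 32 / 3 * q"
      proof -
        have "cmod (Complex (real i) (real j)) \<le> real i + real j"
          using cmod_le[of "Complex (real i) (real j)"] by simp
        also have "\<dots> \<le> 2 / q"
          using ij K(1) by simp
        finally have "4 * \<epsilon> * cmod (Complex (real i) (real j)) * norm b' \<le> 4 * \<epsilon> * (2 / q) * (4 / 3)"
          using \<open>0 < \<epsilon>\<close> nb' q by (intro mult_mono) auto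
        moreover have "norm (\<tau> (i, j)) = 4 * \<epsilon> * cmod (Complex (real i) (real j)) * norm b'"
          using \<open>0 < \<epsilon>\<close> by (simp add: \<tau>_def norm_smult norm_mult)
        ultimately have "norm (\<tau> (i, j)) \<le> 4 * \<epsilon> * (2 / q) * (4 / 3)"
          by simp
        then show ?thesis
          using q by (simp add: \<epsilon> power2_eq_square)
      qed
      moreover have "norm (x - b) \<le> norm (y - b) + norm (\<tau> (i, j))"
        using norm_triangle_ineq[of "y - b" "\<tau> (i, j)"] by (simp add: y_def)
      ultimately have "norm (x - b) < 13 * q"
        using q by simp
      then show "dist b x < 13 * q"
        by (simp add: dist_norm norm_minus_commute)
    qed
    define V where "V = unit_ball_vol (real (2 * CARD('n)))"
    have V: "V > 0"
      by (simp add: V_def)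
    have "emeasure lborel E \<le> emeasure lborel (ball (0 :: complex ^ 'n) 1)"
      by (rule emeasure_mono) (auto simp: E_def)
    also have "\<dots> < \<infinity>"
      by (rule emeasure_lborel_ball_finite)
    finally have fin: "emeasure lborel E < \<infinity>" .
    define e where "e = measure lborel E"
    have e: "emeasure lborel E = ennreal e"
      using fin by (simp add: e_def emeasure_eq_ennreal_measure less_top)
    have "ennreal (real (K * K) * e) = (\<Sum>p\<in>{..<K} \<times> {..<K}. emeasure lborel (T p))"
      by (simp add: T_def emeasure_lborel_translate e ennreal_mult card_cartesian_product e_def flip: ennreal_of_nat_eq_real_of_nat)
    also have "\<dots> = emeasure lborel (\<Union>p\<in>{..<K} \<times> {..<K}. T p)"
      by (rule sum_emeasure) (auto simp: T_def disj[unfolded T_def])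
    also have "\<dots> \<le> emeasure lborel (ball b (13 * q))"
      by (rule emeasure_mono[OF sub]) simp
    also have "\<dots> = ennreal (V * (13 * q) ^ (2 * CARD('n)))"
      using q by (simp add: emeasure_ball V_def mult.commute)
    finally have "real (K * K) * e \<le> V * (13 * q) ^ (2 * CARD('n))"
      using V q by (simp add: ennreal_le_iff)
    also have "(13 * q) ^ (2 * CARD('n)) = 169 ^ CARD('n) * \<epsilon> ^ CARD('n)"
      by (simp add: power_mult power_mult_distrib \<epsilon> power2_eq_square)
    finally have Ke: "real (K * K) * e \<le> V * (169 ^ CARD('n) * \<epsilon> ^ CARD('n))" .
    have "1 / (4 * \<epsilon>) = (1 / (2 * q)) * (1 / (2 * q))"
      by (simp add: \<epsilon> power2_eq_square)
    also have "\<dots> \<le> real K * real K"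
      using K q by (intro mult_mono) auto
    finally have "1 / (4 * \<epsilon>) * e \<le> V * (169 ^ CARD('n) * \<epsilon> ^ CARD('n))"
      using Ke by (smt (verit) e_def measure_nonneg mult_right_mono of_nat_mult)
    then have "e \<le> 4 * 169 ^ CARD('n) * \<epsilon> ^ (CARD('n) + 1) * V"
      using \<open>0 < \<epsilon>\<close> by (simp add: field_simps)
    then have "e / V \<le> 4 * 169 ^ CARD('n) * \<epsilon> ^ (CARD('n) + 1)"
      using V by (simp add: pos_divide_le_eq)
    moreover have "emeasure ball_measure {z. cmod (1 - hermitian_inner z b) < \<epsilon>} = ennreal (e / V)"
      using V by (simp add: emeasure_ball_measure eq e emeasure_ball V_def mult.commute divide_ennreal e_def)
    ultimately show ?thesis
      by (simp add: ennreal_leI)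
  qed
qed

text \<open>The part of the cone over the cap with 1 - \<epsilon> \<le> |z| < 1 lies in a ball cap
  of twice the aperture and carries at least the fraction \<epsilon> of the cone. Dividing by this
  fraction removes one power of \<epsilon> from the volume bound; doubling the aperture turns 4 and
  169 into 8 and 338.\<close>

lemma emeasure_sphere_cap_le:
  fixes b :: "complex ^ 'n"
  assumes b: "norm b \<le> 1" and "0 < \<epsilon>"
  shows "emeasure sphere_measure {\<zeta>. cmod (1 - hermitian_inner \<zeta> b) < \<epsilon>}
    \<le> ennreal (8 * 338 ^ CARD('n) * \<epsilon> ^ CARD('n))"
proof (cases "\<epsilon> \<le> 1")
  case False
  have "1 = 1 * 1 ^ CARD('n) * (1 :: real) ^ CARD('n)"
    by simp
  also have "\<dots> \<le> 8 * 338 ^ CARD('n) * \<epsilon> ^ CARD('n)"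
    using False by (intro mult_mono power_mono) auto
  finally have "ennreal 1 \<le> ennreal (8 * 338 ^ CARD('n) * \<epsilon> ^ CARD('n))"
    by (rule ennreal_leI)
  then show ?thesis
    unfolding ennreal_1 by (rule order_trans[OF emeasure_sphere_measure_le_1])
next
  case True
  interpret B: finite_measure "ball_measure :: (complex ^ 'n) measure"
    by (rule finite_measure_ball_measure)
  interpret S: finite_measure "sphere_measure :: (complex ^ 'n) measure"
    by (rule finite_measure_sphere_measure)
  define Q where "Q = {\<zeta>. cmod (1 - hermitian_inner \<zeta> b) < \<epsilon>}"
  have [measurable]: "Q \<in> sets borel"
    unfolding Q_def by measurable
  define s where "s = measure sphere_measure Q"
  have cone: "measure ball_measure {z. norm z < r \<and> sgn z \<in> Q} = r ^ (2 * CARD('n)) * s" if "0 \<le> r" "r \<le> 1" for r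
    using emeasure_ball_measure_cone[of Q r] that
    by (simp add: B.emeasure_eq_measure S.emeasure_eq_measure s_def flip: ennreal_mult)
  have "(1 - (1 - \<epsilon>) ^ (2 * CARD('n))) * s
      = measure ball_measure {z. norm z < 1 \<and> sgn z \<in> Q} - measure ball_measure {z. norm z < 1 - \<epsilon> \<and> sgn z \<in> Q}"
    using cone[of 1] cone[of "1 - \<epsilon>"] True \<open>0 < \<epsilon>\<close> by (simp add: algebra_simps)
  also have "\<dots> = measure ball_measure ({z. norm z < 1 \<and> sgn z \<in> Q} - {z. norm z < 1 - \<epsilon> \<and> sgn z \<in> Q})"
    using \<open>0 < \<epsilon>\<close> by (intro B.finite_measure_Diff[symmetric]) auto
  also have "\<dots> \<le> measure ball_measure {z. cmod (1 - hermitian_inner z b) < 2 * \<epsilon>}"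
  proof (rule B.finite_measure_mono)
    show "{z. norm z < 1 \<and> sgn z \<in> Q} - {z. norm z < 1 - \<epsilon> \<and> sgn z \<in> Q} \<subseteq> {z. cmod (1 - hermitian_inner z b) < 2 * \<epsilon>}"
    proof
      fix z
      assume "z \<in> {z. norm z < 1 \<and> sgn z \<in> Q} - {z. norm z < 1 - \<epsilon> \<and> sgn z \<in> Q}"
      then have z: "norm z < 1" "sgn z \<in> Q" "1 - norm z \<le> \<epsilon>"
        by auto
      have zs: "z = norm z *\<^sub>R sgn z"
        by (cases "z = 0") (simp_all add: sgn_div_norm)
      have "1 - hermitian_inner z b = (1 - hermitian_inner (sgn z) b) + of_real (1 - norm z) * hermitian_inner (sgn z) b"
        by (subst (1) zs) (simp add: hermitian_inner_scaleR_left algebra_simps)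
      also have "cmod \<dots> \<le> cmod (1 - hermitian_inner (sgn z) b) + (1 - norm z) * cmod (hermitian_inner (sgn z) b)"
        using z by (intro order_trans[OF norm_triangle_ineq]) (simp add: norm_mult del: of_real_diff)
      also have "\<dots> < \<epsilon> + \<epsilon> * 1"
      proof (intro add_less_le_mono mult_mono)
        show "cmod (hermitian_inner (sgn z) b) \<le> 1"
          using norm_hermitian_inner_le[of "sgn z" b] b by (simp add: norm_sgn split: if_splits)
      qed (use z \<open>0 < \<epsilon>\<close> in \<open>auto simp: Q_def\<close>)
      finally show "z \<in> {z. cmod (1 - hermitian_inner z b) < 2 * \<epsilon>}"
        by simp
    qed
  qed simp
  also have "\<dots> \<le> 4 * 169 ^ CARD('n) * (2 * \<epsilon>) ^ (CARD('n) + 1)"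
    using emeasure_ball_cap_le[OF b, of "2 * \<epsilon>"] \<open>0 < \<epsilon>\<close>
    by (simp add: B.emeasure_eq_measure ennreal_le_iff)
  also have "\<dots> = 8 * 338 ^ CARD('n) * \<epsilon> ^ CARD('n) * \<epsilon>"
    by (simp add: power_mult_distrib) (simp flip: power_mult_distrib)
  finally have "(1 - (1 - \<epsilon>) ^ (2 * CARD('n))) * s \<le> 8 * 338 ^ CARD('n) * \<epsilon> ^ CARD('n) * \<epsilon>" .
  moreover have "(1 - \<epsilon>) ^ (2 * CARD('n)) \<le> (1 - \<epsilon>) ^ 1"
    using True \<open>0 < \<epsilon>\<close> by (intro power_decreasing) auto
  then have "\<epsilon> * s \<le> (1 - (1 - \<epsilon>) ^ (2 * CARD('n))) * s"
    by (intro mult_right_mono) (auto simp: s_def)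
  ultimately have "\<epsilon> * s \<le> 8 * 338 ^ CARD('n) * \<epsilon> ^ CARD('n) * \<epsilon>"
    by (rule order_trans[rotated])
  then have "s * \<epsilon> \<le> (8 * 338 ^ CARD('n) * \<epsilon> ^ CARD('n)) * \<epsilon>"
    by (simp only: mult.commute[of s])
  then have "s \<le> 8 * 338 ^ CARD('n) * \<epsilon> ^ CARD('n)"
    using \<open>0 < \<epsilon>\<close> by (rule mult_right_le_imp_le)
  then show ?thesis
    by (simp add: s_def Q_def S.emeasure_eq_measure ennreal_leI)
qed

lemma dyadic_interval:
  fixes u \<delta> :: real
  assumes "0 < \<delta>" "\<delta> \<le> u"
  obtains k where "2 ^ k * \<delta> \<le> u" "u < 2 ^ (k + 1) * \<delta>"
proof -
  define P where "P = (\<lambda>k. u / \<delta> < 2 ^ (k + 1))"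
  obtain j where "u / \<delta> < 2 ^ j"
    using real_arch_pow[of 2 "u / \<delta>"] by auto
  also have "\<dots> \<le> 2 ^ (j + 1)"
    by simp
  finally have "P j"
    by (simp add: P_def)
  define k where "k = (LEAST k. P k)"
  have "P k"
    unfolding k_def using \<open>P j\<close> by (rule LeastI)
  have "2 ^ k \<le> u / \<delta>"
  proof (cases k)
    case 0
    then show ?thesis
      using assms by simp
  next
    case (Suc i)
    then have "\<not> P i"
      using not_less_Least[of i P] by (simp add: k_def)
    then show ?thesis
      by (simp add: Suc P_def)
  qed
  with \<open>P k\<close> assms show thesis
    by (intro that[of k]) (simp_all add: P_def field_simps)
qed

text \<open>Dyadic layers: with \<delta> = 1 - |b| the integrand never exceeds \<delta>^(-m), the
  k-th layer lies in a cap of aperture 2^(k+1) \<delta> and contributes O((2^k \<delta>)^(N-m)), and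
  m > N makes the sum geometric.\<close>

lemma nn_integral_sphere_kernel_le:
  fixes b :: "complex ^ 'n"
  assumes b: "norm b < 1" and m: "CARD('n) < m"
  shows "(\<integral>\<^sup>+\<zeta>\<in>sphere 0 1. ennreal (1 / cmod (1 - hermitian_inner \<zeta> b) ^ m) \<partial>sphere_measure)
    \<le> ennreal (16 * 676 ^ CARD('n) / (1 - norm b) ^ (m - CARD('n)))"
proof -
  define N where "N = CARD('n)"
  define \<delta> where "\<delta> = 1 - norm b"
  have \<delta>: "0 < \<delta>"
    using b by (simp add: \<delta>_def)
  define u where "u = (\<lambda>\<zeta>. cmod (1 - hermitian_inner \<zeta> b))"
  have [measurable]: "u \<in> borel_measurable borel"
    unfolding u_def by measurable
  have "u \<zeta> \<ge> \<delta>" if "\<zeta> \<in> sphere 0 1" for \<zeta>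
    using norm_triangle_ineq2[of 1 "hermitian_inner \<zeta> b"] norm_hermitian_inner_le[of \<zeta> b] that
    by (simp add: u_def \<delta>_def)
  then have "ennreal (1 / u \<zeta> ^ m) * indicator (sphere 0 1) \<zeta>
      \<le> (\<Sum>k. ennreal (1 / (2 ^ k * \<delta>) ^ m) * indicator {\<zeta>. u \<zeta> < 2 ^ (k + 1) * \<delta>} \<zeta>)" for \<zeta>
  proof (cases "\<zeta> \<in> sphere 0 1")
    case True
    obtain k where k: "2 ^ k * \<delta> \<le> u \<zeta>" "u \<zeta> < 2 ^ (k + 1) * \<delta>"
      using dyadic_interval[OF \<delta>, of "u \<zeta>"] \<open>\<zeta> \<in> sphere 0 1 \<Longrightarrow> \<delta> \<le> u \<zeta>\<close> True by metis
    have "ennreal (1 / u \<zeta> ^ m) \<le> ennreal (1 / (2 ^ k * \<delta>) ^ m)"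
      using k(1) \<delta> by (intro ennreal_leI divide_left_mono power_mono mult_pos_pos zero_less_power)
        (auto intro: less_le_trans[of 0 "2 ^ k * \<delta>"])
    also have "\<dots> = (\<Sum>k\<in>{k}. ennreal (1 / (2 ^ k * \<delta>) ^ m) * indicator {\<zeta>. u \<zeta> < 2 ^ (k + 1) * \<delta>} \<zeta>)"
      using k(2) by simp
    also have "\<dots> \<le> (\<Sum>k. ennreal (1 / (2 ^ k * \<delta>) ^ m) * indicator {\<zeta>. u \<zeta> < 2 ^ (k + 1) * \<delta>} \<zeta>)"
      by (rule sum_le_suminf) auto
    finally show ?thesis
      using True by simp
  qed simp
  then have "(\<integral>\<^sup>+\<zeta>\<in>sphere 0 1. ennreal (1 / u \<zeta> ^ m) \<partial>sphere_measure)
      \<le> (\<integral>\<^sup>+\<zeta>. (\<Sum>k. ennreal (1 / (2 ^ k * \<delta>) ^ m) * indicator {\<zeta>. u \<zeta> < 2 ^ (k + 1) * \<delta>} \<zeta>) \<partial>sphere_measure)"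
    by (intro nn_integral_mono)
  also have "\<dots> = (\<Sum>k. ennreal (1 / (2 ^ k * \<delta>) ^ m) * emeasure sphere_measure {\<zeta>. u \<zeta> < 2 ^ (k + 1) * \<delta>})"
    by (subst nn_integral_suminf) (simp_all add: nn_integral_cmult_indicator)
  also have "\<dots> \<le> (\<Sum>k. ennreal (8 * 676 ^ N / \<delta> ^ (m - N) * (1 / 2) ^ k))"
  proof (rule suminf_le)
    fix k
    have "ennreal (1 / (2 ^ k * \<delta>) ^ m) * emeasure sphere_measure {\<zeta>. u \<zeta> < 2 ^ (k + 1) * \<delta>}
        \<le> ennreal (1 / (2 ^ k * \<delta>) ^ m) * ennreal (8 * 338 ^ N * (2 ^ (k + 1) * \<delta>) ^ N)"
      unfolding u_def N_def using \<delta> b by (intro mult_left_mono emeasure_sphere_cap_le) auto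
    also have "\<dots> = ennreal (1 / (2 ^ k * \<delta>) ^ m * (8 * 338 ^ N * (2 ^ (k + 1) * \<delta>) ^ N))"
      using \<delta> by (simp flip: ennreal_mult)
    also have "1 / (2 ^ k * \<delta>) ^ m * (8 * 338 ^ N * (2 ^ (k + 1) * \<delta>) ^ N) = 8 * 676 ^ N / (2 ^ k * \<delta>) ^ (m - N)"
    proof -
      have "(2 ^ k * \<delta>) ^ m = (2 ^ k * \<delta>) ^ (m - N) * (2 ^ k * \<delta>) ^ N"
        using m by (simp add: N_def flip: power_add)
      moreover have "338 * (2 ^ (k + 1) * \<delta>) = 676 * (2 ^ k * \<delta>)"
        by simp
      then have "338 ^ N * (2 ^ (k + 1) * \<delta>) ^ N = 676 ^ N * (2 ^ k * \<delta>) ^ N"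
        by (simp only: power_mult_distrib[symmetric])
      moreover have "1 / (2 ^ k * \<delta>) ^ m * (8 * 338 ^ N * (2 ^ (k + 1) * \<delta>) ^ N)
          = 8 * (338 ^ N * (2 ^ (k + 1) * \<delta>) ^ N) / (2 ^ k * \<delta>) ^ m"
        by (simp only: times_divide_eq_left mult_1 mult.assoc)
      ultimately have "1 / (2 ^ k * \<delta>) ^ m * (8 * 338 ^ N * (2 ^ (k + 1) * \<delta>) ^ N)
          = 8 * (676 ^ N * (2 ^ k * \<delta>) ^ N) / ((2 ^ k * \<delta>) ^ (m - N) * (2 ^ k * \<delta>) ^ N)"
        by (simp only:)
      also have "\<dots> = 8 * 676 ^ N / (2 ^ k * \<delta>) ^ (m - N)"
        using \<delta> by simp
      finally show ?thesis .
    qed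
    \<comment> \<open>As m - N \<ge> 1, keeping a single factor 2^k already gives ratio 1/2. That
      series has sum 2, which turns 8 into 16.\<close>
    also have "\<dots> \<le> 8 * 676 ^ N / (2 ^ k * \<delta> ^ (m - N))"
    proof -
      have "(2 :: real) ^ k = (2 ^ k) ^ 1"
        by simp
      also have "\<dots> \<le> (2 ^ k) ^ (m - N)"
        using m by (intro power_increasing) (auto simp: N_def)
      finally show ?thesis
        using \<delta> by (intro divide_left_mono) (auto simp: power_mult_distrib)
    qed
    also have "\<dots> = 8 * 676 ^ N / \<delta> ^ (m - N) * (1 / 2) ^ k"
      by (simp add: power_divide)
    finally show "ennreal (1 / (2 ^ k * \<delta>) ^ m) * emeasure sphere_measure {\<zeta>. u \<zeta> < 2 ^ (k + 1) * \<delta>}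
        \<le> ennreal (8 * 676 ^ N / \<delta> ^ (m - N) * (1 / 2) ^ k)"
      by (simp add: ennreal_leI)
  qed auto
  also have "\<dots> = ennreal (8 * 676 ^ N / \<delta> ^ (m - N) * 2)"
  proof (rule suminf_ennreal_eq)
    have "(\<lambda>k. (1 / 2 :: real) ^ k) sums 2"
      using geometric_sums[of "1 / 2 :: real"] by simp
    then show "(\<lambda>k. 8 * 676 ^ N / \<delta> ^ (m - N) * (1 / 2) ^ k) sums (8 * 676 ^ N / \<delta> ^ (m - N) * 2)"
      by (rule sums_mult)
  qed (use \<delta> in auto)
  finally show ?thesis
    by (simp add: u_def N_def \<delta>_def)
qed

text \<open>The circular part of a nonisotropic ball: \<open>z + koranyi_region z\<close> is the set on which
  \<open>|f|\<^sup>2\<close> is averaged in the sharp point evaluation estimate.\<close>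

definition koranyi_region :: "complex ^ 'n \<Rightarrow> (complex ^ 'n) set"
  where "koranyi_region z = {w. cmod (hermitian_inner w z) < (1 - (norm z)\<^sup>2) / 8 \<and> (norm w)\<^sup>2 < (1 - (norm z)\<^sup>2) / 4}"

lemma borel_koranyi_region [measurable]: "koranyi_region z \<in> sets borel"
  unfolding koranyi_region_def by measurable

text \<open>In |z + w|^2 = |z|^2 + 2 Re <w,z> + |w|^2 the thresholds 1/8 and 1/4 let each
  perturbation use at most a quarter of the defect of z. The lower bound keeps z + w in the ball,
  the upper one confines it to a thin shell, and together they keep the Bergman weight comparable to
  its value at z.\<close>

lemma koranyi_region_defect:
  assumes "w \<in> koranyi_region z" "norm z < 1"
  shows "(1 - (norm z)\<^sup>2) / 2 \<le> 1 - (norm (z + w))\<^sup>2" "1 - (norm (z + w))\<^sup>2 \<le> 5 / 4 * (1 - (norm z)\<^sup>2)"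
proof -
  have "\<bar>Re (hermitian_inner w z)\<bar> < (1 - (norm z)\<^sup>2) / 8"
    using assms(1) abs_Re_le_cmod order.strict_trans1 unfolding koranyi_region_def by blast
  moreover have "0 \<le> (norm w)\<^sup>2" "(norm w)\<^sup>2 < (1 - (norm z)\<^sup>2) / 4"
    using assms(1) by (auto simp: koranyi_region_def)
  moreover define d r where "d = 1 - (norm z)\<^sup>2" and "r = Re (hermitian_inner w z)"
  ultimately have "r < d / 8" "- r < d / 8" "0 \<le> (norm w)\<^sup>2" "(norm w)\<^sup>2 < d / 4"
    by auto
  then have "d / 2 \<le> d - 2 * r - (norm w)\<^sup>2" "d - 2 * r - (norm w)\<^sup>2 \<le> 5 / 4 * d"
    by (linarith, linarith)
  then show "(1 - (norm z)\<^sup>2) / 2 \<le> 1 - (norm (z + w))\<^sup>2"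
    "1 - (norm (z + w))\<^sup>2 \<le> 5 / 4 * (1 - (norm z)\<^sup>2)"
    unfolding norm_add_square d_def r_def by (simp_all add: algebra_simps)
qed

text \<open>A ball of radius comparable to \<open>sqrt (1 - |z|\<^sup>2)\<close> is covered by about \<open>1 / (1 - |z|\<^sup>2)\<close>
  translates of the region.\<close>

lemma koranyi_region_volume:
  fixes z :: "complex ^ 'n"
  assumes z: "norm z < 1"
  shows "emeasure lborel (ball (0 :: complex ^ 'n) 1)
    \<le> ennreal (121 * 16 ^ CARD('n) / (1 - (norm z)\<^sup>2) ^ (CARD('n) + 1)) * emeasure lborel (koranyi_region z)"
proof -
  define N where "N = CARD('n)"
  define \<delta> where "\<delta> = 1 - (norm z)\<^sup>2"
  have \<delta>: "0 < \<delta>" "\<delta> \<le> 1"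
    using z by (auto simp: \<delta>_def power_less_one_iff)
  define q where "q = sqrt \<delta>"
  have q: "0 < q" "q \<le> 1" and \<delta>q: "\<delta> = q\<^sup>2"
    using \<delta> by (auto simp: q_def)
  \<comment> \<open>Two points of a cell differ by less than s in the real and in the imaginary part
    of <x,z>, hence by less than 2 s = \<delta>/8 in modulus. The radius q/4 likewise bounds the
    squared distance by q^2/4 = \<delta>/4.\<close>
  define s where "s = \<delta> / 16"
  have s: "0 < s"
    using \<delta> by (simp add: s_def)
  \<comment> \<open>On the ball of radius q/4 the index |<x,z>|/s is at most (q/4)/(q^2/16) = 4/q.
    There are 2 J + 1 \<le> 8/q + 3 \<le> 11/q cells in each direction, which gives
    121/\<delta>.\<close>
  define J where "J = \<lceil>4 / q\<rceil>"
  have "0 < 4 / q"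
    using q by simp
  then have J0: "0 \<le> J"
    unfolding J_def by linarith
  have J: "4 / q \<le> J" "J \<le> 4 / q + 1"
    unfolding J_def by linarith+
  define cell where "cell = (\<lambda>(i, j). {x \<in> ball 0 (q / 4). \<lfloor>Re (hermitian_inner x z) / s\<rfloor> = i \<and> \<lfloor>Im (hermitian_inner x z) / s\<rfloor> = (j::int)})"
  have [measurable]: "cell p \<in> sets borel" for p
    unfolding cell_def by (cases p) (simp, measurable)
  have cover: "ball 0 (q / 4) \<subseteq> (\<Union>p\<in>{-J..J} \<times> {-J..J}. cell p)"
  proof
    fix x :: "complex ^ 'n"
    assume x: "x \<in> ball 0 (q / 4)"
    have *: "\<lfloor>t / s\<rfloor> \<in> {-J..J}" if t: "\<bar>t\<bar> \<le> cmod (hermitian_inner x z)" for t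
    proof -
      note t
      also have "cmod (hermitian_inner x z) \<le> norm x * norm z"
        by (rule norm_hermitian_inner_le)
      also have "\<dots> \<le> q / 4 * 1"
        using x z q by (intro mult_mono) auto
      finally have "\<bar>t / s\<bar> \<le> 4 / q"
        using q by (simp add: s_def \<delta>q power2_eq_square divide_simps)
      with J have "- real_of_int J \<le> t / s" "t / s \<le> J"
        by linarith+
      then show ?thesis
        by (auto simp: le_floor_iff floor_le_iff)
    qed
    have "x \<in> cell (\<lfloor>Re (hermitian_inner x z) / s\<rfloor>, \<lfloor>Im (hermitian_inner x z) / s\<rfloor>)"
      using x by (simp add: cell_def)
    then show "x \<in> (\<Union>p\<in>{-J..J} \<times> {-J..J}. cell p)"
      using *[OF abs_Re_le_cmod] *[OF abs_Im_le_cmod] by blast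
  qed
  have cell_le: "emeasure lborel (cell p) \<le> emeasure lborel (koranyi_region z)" for p
  proof (cases "cell p = {}")
    case False
    then obtain x0 where x0: "x0 \<in> cell p"
      by blast
    have "cell p \<subseteq> {x. x - x0 \<in> koranyi_region z}"
    proof safe
      fix x
      assume x: "x \<in> cell p"
      obtain i j where p: "p = (i, j)"
        by (cases p)
      have fl: "\<bar>a - b\<bar> < s" if "\<lfloor>a / s\<rfloor> = \<lfloor>b / s\<rfloor>" for a b
      proof -
        have "\<bar>a / s - b / s\<bar> < 1"
          using that by linarith
        then show ?thesis
          using s by (simp add: divide_less_eq flip: diff_divide_distrib)
      qed
      have "cmod (hermitian_inner (x - x0) z) \<le> \<bar>Re (hermitian_inner (x - x0) z)\<bar> + \<bar>Im (hermitian_inner (x - x0) z)\<bar>"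
        by (rule cmod_le)
      also have "\<dots> < s + s"
        using x x0 by (intro add_strict_mono) (auto simp: cell_def p hermitian_inner_diff_left intro!: fl)
      finally have 1: "cmod (hermitian_inner (x - x0) z) < \<delta> / 8"
        by (simp add: s_def)
      have "norm (x - x0) < q / 4 + q / 4"
        using x x0 by (intro order.strict_trans1[OF norm_triangle_ineq4] add_strict_mono) (auto simp: cell_def p)
      then have "(norm (x - x0))\<^sup>2 < (q / 2)\<^sup>2"
        by (intro power_strict_mono) auto
      then have 2: "(norm (x - x0))\<^sup>2 < \<delta> / 4"
        by (simp add: \<delta>q power_divide)
      show "x - x0 \<in> koranyi_region z"
        using 1 2 by (simp add: koranyi_region_def \<delta>_def)
    qed
    then have "emeasure lborel (cell p) \<le> emeasure lborel {x. x - x0 \<in> koranyi_region z}"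
      by (intro emeasure_mono) auto
    then show ?thesis
      by (simp add: emeasure_lborel_translate)
  qed simp
  define V where "V = unit_ball_vol (real (2 * CARD('n)))"
  have V: "V > 0"
    by (simp add: V_def)
  have "ennreal (V * (q / 4) ^ (2 * N)) = emeasure lborel (ball (0 :: complex ^ 'n) (q / 4))"
    using q by (simp add: emeasure_ball V_def N_def mult.commute)
  also have "\<dots> \<le> emeasure lborel (\<Union>p\<in>{-J..J} \<times> {-J..J}. cell p)"
    by (intro emeasure_mono cover) auto
  also have "\<dots> \<le> (\<Sum>p\<in>{-J..J} \<times> {-J..J}. emeasure lborel (cell p))"
    by (intro emeasure_subadditive_finite) auto
  also have "\<dots> \<le> (\<Sum>p\<in>{-J..J} \<times> {-J..J}. emeasure lborel (koranyi_region z))"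
    by (intro sum_mono cell_le)
  also have "\<dots> = ennreal ((2 * real_of_int J + 1) * (2 * real_of_int J + 1)) * emeasure lborel (koranyi_region z)"
    using J0 by (simp add: card_cartesian_product ennreal_of_nat_eq_real_of_nat add.commute)
  also have "\<dots> \<le> ennreal (121 / \<delta>) * emeasure lborel (koranyi_region z)"
  proof (intro mult_right_mono ennreal_leI)
    have "1 \<le> 1 / q"
      using q by simp
    then have "real_of_int (2 * J + 1) \<le> 11 / q"
      using J(2) by (simp add: field_simps)
    then have "real_of_int (2 * J + 1) * real_of_int (2 * J + 1) \<le> (11 / q) * (11 / q)"
      using J0 q by (intro mult_mono) auto
    then show "(2 * real_of_int J + 1) * (2 * real_of_int J + 1) \<le> 121 / \<delta>"
      by (simp add: \<delta>q power2_eq_square)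
  qed auto
  finally have le: "ennreal (V * (q / 4) ^ (2 * N)) \<le> ennreal (121 / \<delta>) * emeasure lborel (koranyi_region z)" .
  have "emeasure lborel (ball (0 :: complex ^ 'n) 1) = ennreal V"
    by (simp add: emeasure_ball V_def mult.commute)
  also have "\<dots> = ennreal (16 ^ N / \<delta> ^ N) * ennreal (V * (q / 4) ^ (2 * N))"
    using V \<delta> q by (simp add: power_mult power_divide \<delta>q flip: ennreal_mult)
  also have "\<dots> \<le> ennreal (16 ^ N / \<delta> ^ N) * (ennreal (121 / \<delta>) * emeasure lborel (koranyi_region z))"
    by (intro mult_left_mono le) auto
  also have "\<dots> = ennreal (16 ^ N / \<delta> ^ N * (121 / \<delta>)) * emeasure lborel (koranyi_region z)"
    using \<delta> by (subst ennreal_mult) (simp_all add: mult.assoc)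
  also have "16 ^ N / \<delta> ^ N * (121 / \<delta>) = 121 * 16 ^ N / \<delta> ^ (N + 1)"
    by (simp add: mult.commute)
  finally show ?thesis
    by (simp add: N_def \<delta>_def)
qed

section \<open>Holomorphic functions of several variables\<close>

lemma holomorphic_sv_on_subset: "holomorphic_sv_on f S \<Longrightarrow> T \<subseteq> S \<Longrightarrow> holomorphic_sv_on f T"
  unfolding holomorphic_sv_on_def by (meson has_derivative_subset subsetD)

lemma holomorphic_sv_on_cong:
  assumes "holomorphic_sv_on f S" "\<And>z. z \<in> S \<Longrightarrow> f z = g z"
  shows "holomorphic_sv_on g S"
  unfolding holomorphic_sv_on_def
proof
  fix z
  assume z: "z \<in> S"
  then obtain D where D: "(f has_derivative D) (at z within S)" "\<forall>c v. D (c *s v) = c * D v"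
    using assms(1) unfolding holomorphic_sv_on_def by blast
  have "(g has_derivative D) (at z within S)"
    by (rule has_derivative_transform[OF z _ D(1)]) (simp add: assms(2))
  with D(2) show "\<exists>D. (g has_derivative D) (at z within S) \<and> (\<forall>c v. D (c *s v) = c * D v)"
    by blast
qed

lemma holomorphic_sv_on_const: "holomorphic_sv_on (\<lambda>z. c) S"
  unfolding holomorphic_sv_on_def by (auto intro!: exI[of _ "\<lambda>_. 0"])

lemma holomorphic_sv_on_diff:
  assumes "holomorphic_sv_on f S" "holomorphic_sv_on g S"
  shows "holomorphic_sv_on (\<lambda>z. f z - g z) S"
  unfolding holomorphic_sv_on_def
proof
  fix z
  assume z: "z \<in> S"
  then obtain D E where "(f has_derivative D) (at z within S)" "\<forall>c v. D (c *s v) = c * D v"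
    "(g has_derivative E) (at z within S)" "\<forall>c v. E (c *s v) = c * E v"
    using assms unfolding holomorphic_sv_on_def by meson
  then show "\<exists>D. ((\<lambda>z. f z - g z) has_derivative D) (at z within S) \<and> (\<forall>c v. D (c *s v) = c * D v)"
    by (intro exI[of _ "\<lambda>v. D v - E v"] conjI has_derivative_diff) (auto simp: algebra_simps)
qed

lemma holomorphic_sv_on_field_compose:
  assumes "holomorphic_sv_on f S" "\<And>z. z \<in> S \<Longrightarrow> (h has_field_derivative h' (f z)) (at (f z))"
  shows "holomorphic_sv_on (\<lambda>z. h (f z)) S"
  unfolding holomorphic_sv_on_def
proof
  fix z
  assume z: "z \<in> S"
  then obtain D where D: "(f has_derivative D) (at z within S)" "\<forall>c v. D (c *s v) = c * D v"
    using assms(1) unfolding holomorphic_sv_on_def by blast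
  have "(h has_derivative (*) (h' (f z))) (at (f z))"
    using assms(2)[OF z] by (simp add: has_field_derivative_def)
  from has_derivative_compose[OF D(1) this]
  show "\<exists>D. ((\<lambda>z. h (f z)) has_derivative D) (at z within S) \<and> (\<forall>c v. D (c *s v) = c * D v)"
    using D(2) by (intro exI[of _ "\<lambda>v. h' (f z) * D v"]) auto
qed

lemma holomorphic_sv_on_continuous: "holomorphic_sv_on f S \<Longrightarrow> continuous_on S f"
  unfolding holomorphic_sv_on_def continuous_on_eq_continuous_within
  by (meson has_derivative_continuous)

lemma has_derivative_complex_line:
  fixes v :: "complex ^ 'n"
  shows "((\<lambda>\<mu>. z + \<mu> *s v) has_derivative (\<lambda>h. h *s v)) (at \<mu> within T)"
proof -
  have "linear (\<lambda>h. h *s v)"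
    by (rule linearI) (simp_all add: vec_eq_iff algebra_simps)
  then have "bounded_linear (\<lambda>h. h *s v)"
    by (simp add: linear_conv_bounded_linear)
  from has_derivative_add[OF has_derivative_const bounded_linear.has_derivative[OF this has_derivative_ident]]
  show ?thesis
    by simp
qed

lemma holomorphic_sv_on_slice:
  assumes f: "holomorphic_sv_on f (ball 0 R)" and T: "\<And>\<mu>. \<mu> \<in> T \<Longrightarrow> z + \<mu> *s v \<in> ball 0 R"
  shows "(\<lambda>\<mu>. f (z + \<mu> *s v)) holomorphic_on T"
  unfolding holomorphic_on_def field_differentiable_def
proof
  fix \<mu>
  assume "\<mu> \<in> T"
  then have "z + \<mu> *s v \<in> ball 0 R"
    by (rule T)
  then obtain D where D: "(f has_derivative D) (at (z + \<mu> *s v))" "\<And>c v. D (c *s v) = c * D v"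
    using f unfolding holomorphic_sv_on_def by (metis at_within_open open_ball)
  from has_derivative_compose[OF has_derivative_complex_line D(1)]
  have "((\<lambda>\<mu>. f (z + \<mu> *s v)) has_derivative (\<lambda>h. h * D v)) (at \<mu> within T)"
    by (simp add: D(2))
  then show "\<exists>f'. ((\<lambda>\<mu>. f (z + \<mu> *s v)) has_field_derivative f') (at \<mu> within T)"
    unfolding has_field_derivative_def mult.commute[of _ "D v"] by blast
qed

section \<open>Cauchy estimates and normal families\<close>

lemma holomorphic_sv_deriv_bound:
  assumes f: "holomorphic_sv_on f (ball 0 R)" and B: "\<And>z. z \<in> ball 0 R \<Longrightarrow> cmod (f z) \<le> B"
    and z: "norm z < R" and D: "(f has_derivative D) (at z)" "\<And>c v. D (c *s v) = c * D v"
    and \<delta>: "0 < \<delta>" "\<delta> < R - norm z"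
  shows "cmod (D v) \<le> B / \<delta> * norm v"
proof (cases "v = 0")
  case True
  then show ?thesis
    using D(2)[of 0 0] by simp
next
  case False
  \<comment> \<open>On the complex line through z in direction v, the closed disc of this radius
    stays in the ball; the one-variable Cauchy inequality there is the claim.\<close>
  define r where "r = \<delta> / norm v"
  have r: "0 < r"
    using \<delta> False by (simp add: r_def)
  have in_ball: "z + \<mu> *s v \<in> ball 0 R" if "cmod \<mu> \<le> r" for \<mu>
  proof -
    have "norm (z + \<mu> *s v) \<le> norm z + r * norm v"
      using that by (intro order_trans[OF norm_triangle_ineq]) (simp add: norm_smult mult_right_mono)
    also have "\<dots> < R"
      using \<delta> False by (simp add: r_def)
    finally show ?thesis
      by simp
  qed
  define h where "h = (\<lambda>\<mu>. f (z + \<mu> *s v))"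
  have hol: "h holomorphic_on cball 0 r"
    unfolding h_def by (rule holomorphic_sv_on_slice[OF f]) (use in_ball in auto)
  have "(h has_field_derivative D v) (at 0)"
  proof -
    from has_derivative_compose[OF has_derivative_complex_line[of z v 0 UNIV], of f D] D(1)
    show ?thesis
      unfolding has_field_derivative_def h_def mult.commute[of "D v"] by (simp add: D(2))
  qed
  then have "deriv h 0 = D v"
    by (rule DERIV_imp_deriv)
  moreover have "cmod ((deriv ^^ 1) h 0) \<le> fact 1 * B / r ^ 1"
  proof (rule Cauchy_inequality)
    show "h holomorphic_on ball 0 r" "continuous_on (cball 0 r) h"
      using hol by (auto intro: holomorphic_on_subset holomorphic_on_imp_continuous_on)
    show "cmod (h \<mu>) \<le> B" if "cmod (0 - \<mu>) = r" for \<mu>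
      using that in_ball[of \<mu>] by (simp add: h_def B)
  qed (rule r)
  ultimately show ?thesis
    using False by (simp add: r_def field_simps)
qed

lemma holomorphic_sv_lipschitz:
  assumes f: "holomorphic_sv_on f (ball 0 R)" and B: "\<And>z. z \<in> ball 0 R \<Longrightarrow> cmod (f z) \<le> B"
    and "0 < \<delta>" "S < R - \<delta>" and xy: "norm x \<le> S" "norm y \<le> S"
  shows "cmod (f x - f y) \<le> B / \<delta> * norm (x - y)"
proof -
  have "\<exists>D. (f has_derivative D) (at z) \<and> (\<forall>c v. D (c *s v) = c * D v)" if "z \<in> cball 0 S" for z
    using f that \<open>0 < \<delta>\<close> \<open>S < R - \<delta>\<close> unfolding holomorphic_sv_on_def
    by (subst at_within_open[of z "ball 0 R", symmetric]) auto
  then obtain D where D: "\<And>z. z \<in> cball 0 S \<Longrightarrow> (f has_derivative D z) (at z)"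
    "\<And>z c v. z \<in> cball 0 S \<Longrightarrow> D z (c *s v) = c * D z v"
    by metis
  show ?thesis
  proof (rule differentiable_bound[where S = "cball 0 S" and f' = D])
    show "(f has_derivative D z) (at z within cball 0 S)" if "z \<in> cball 0 S" for z
      using D(1)[OF that] by (rule has_derivative_at_withinI)
    show "onorm (D z) \<le> B / \<delta>" if z: "z \<in> cball 0 S" for z
    proof (rule onorm_le)
      show "cmod (D z v) \<le> B / \<delta> * norm v" for v
        using assms z by (intro holomorphic_sv_deriv_bound[OF f B _ D(1)[OF z] D(2)[OF z]]) auto
    qed
  qed (use xy in auto)
qed

text \<open>Shrinking the ball leaves room for the Cauchy estimate, which turns uniform closeness of
  the functions into uniform closeness of the derivatives. The theorem on limits of derivatives then
  applies, and complex homogeneity survives the pointwise limit.\<close>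

lemma holomorphic_sv_uniform_limit:
  assumes f: "\<And>n :: nat. holomorphic_sv_on (f n) (ball 0 R)" and "r < R" "0 < r"
    and lim: "\<And>e. 0 < e \<Longrightarrow> \<exists>N. \<forall>n\<ge>N. \<forall>z\<in>ball 0 R. cmod (f n z - g z) < e"
  shows "holomorphic_sv_on g (ball 0 r)"
proof -
  define \<delta> where "\<delta> = (R - r) / 2"
  have \<delta>: "0 < \<delta>"
    using \<open>r < R\<close> by (simp add: \<delta>_def)
  have ex: "\<exists>D. (f n has_derivative D) (at z) \<and> (\<forall>c v. D (c *s v) = c * D v)" if "z \<in> ball 0 r" for n z
    using f[of n] that \<open>r < R\<close> unfolding holomorphic_sv_on_def
    by (subst at_within_open[of z "ball 0 R", symmetric]) auto
  define D where "D = (\<lambda>n z. SOME D. (f n has_derivative D) (at z) \<and> (\<forall>c v. D (c *s v) = c * D v))"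
  have "(f n has_derivative D n z) (at z) \<and> (\<forall>c v. D n z (c *s v) = c * D n z v)" if "z \<in> ball 0 r" for n z
    unfolding D_def by (rule someI_ex[OF ex[OF that]])
  then have D: "\<And>n z. z \<in> ball 0 r \<Longrightarrow> (f n has_derivative D n z) (at z)"
    "\<And>n z c v. z \<in> ball 0 r \<Longrightarrow> D n z (c *s v) = c * D n z v"
    by auto
  have bnd: "cmod (D n z v - D k z v) \<le> e / \<delta> * norm v"
    if z: "z \<in> ball 0 r" and e: "\<And>z. z \<in> ball 0 R \<Longrightarrow> cmod (f n z - f k z) \<le> e" for n k z v e
  proof (rule holomorphic_sv_deriv_bound[where f = "\<lambda>z. f n z - f k z" and D = "\<lambda>v. D n z v - D k z v"])
    show "holomorphic_sv_on (\<lambda>z. f n z - f k z) (ball 0 R)"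
      by (intro holomorphic_sv_on_diff f)
    show "((\<lambda>z. f n z - f k z) has_derivative (\<lambda>v. D n z v - D k z v)) (at z)"
      by (intro has_derivative_diff D z)
    show "D n z (c *s v) - D k z (c *s v) = c * (D n z v - D k z v)" for c v
      by (simp add: D(2)[OF z] algebra_simps)
  qed (use z e \<delta> in \<open>auto simp: \<delta>_def\<close>)
  have cauchy: "\<exists>N. \<forall>n\<ge>N. \<forall>k\<ge>N. \<forall>z\<in>ball 0 r. \<forall>v. cmod (D n z v - D k z v) \<le> e * norm v" if "0 < e" for e
  proof -
    have "0 < e * \<delta> / 2"
      using \<open>0 < e\<close> \<delta> by simp
    from lim[OF this] obtain N
      where N: "\<And>n z. n \<ge> N \<Longrightarrow> z \<in> ball 0 R \<Longrightarrow> cmod (f n z - g z) < e * \<delta> / 2"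
      by blast
    have "cmod (f n z - f k z) \<le> e * \<delta>" if "n \<ge> N" "k \<ge> N" "z \<in> ball 0 R" for n k z
      using N[OF that(1,3)] N[OF that(2,3)] norm_triangle_ineq4[of "f n z - g z" "f k z - g z"] by simp
    then have "\<forall>n\<ge>N. \<forall>k\<ge>N. \<forall>z\<in>ball 0 r. \<forall>v. cmod (D n z v - D k z v) \<le> e * \<delta> / \<delta> * norm v"
      using bnd by blast
    then show ?thesis
      using \<delta> by auto
  qed
  have "\<exists>l. (\<lambda>n. D n z v) \<longlonglongrightarrow> l" if z: "z \<in> ball 0 r" for z v
  proof -
    have "Cauchy (\<lambda>n. D n z v)"
    proof (rule metric_CauchyI)
      fix e :: real
      assume "0 < e"
      define e' where "e' = e / (norm v + 1)"
      have "0 < e'"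
        using \<open>0 < e\<close> by (simp add: e'_def add_nonneg_pos)
      then obtain N where "\<And>n k. n \<ge> N \<Longrightarrow> k \<ge> N \<Longrightarrow> cmod (D n z v - D k z v) \<le> e' * norm v"
        using cauchy z by meson
      moreover have "e' * norm v < e"
        using \<open>0 < e\<close> by (simp add: e'_def divide_less_eq add_nonneg_pos mult_strict_left_mono)
      ultimately show "\<exists>N. \<forall>n\<ge>N. \<forall>k\<ge>N. dist (D n z v) (D k z v) < e"
        unfolding dist_norm by (meson order.strict_trans1)
    qed
    then show ?thesis
      using Cauchy_convergent_iff convergent_def by blast
  qed
  then obtain E where E: "\<And>z v. z \<in> ball 0 r \<Longrightarrow> (\<lambda>n. D n z v) \<longlonglongrightarrow> E z v"
    by metis
  have "\<exists>h. \<forall>z\<in>ball 0 r. (\<lambda>n. f n z) \<longlonglongrightarrow> h z \<and> (h has_derivative E z) (at z within ball 0 r)"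
  proof (rule has_derivative_sequence)
    show "(f n has_derivative D n z) (at z within ball 0 r)" if "z \<in> ball 0 r" for n z
      using D(1)[OF that] by (rule has_derivative_at_withinI)
    show "\<forall>\<^sub>F n in sequentially. \<forall>z\<in>ball 0 r. \<forall>v. cmod (D n z v - E z v) \<le> e * norm v" if "0 < e" for e
    proof -
      obtain N where N: "\<And>n k z v. n \<ge> N \<Longrightarrow> k \<ge> N \<Longrightarrow> z \<in> ball 0 r \<Longrightarrow> cmod (D n z v - D k z v) \<le> e * norm v"
        using cauchy[OF \<open>0 < e\<close>] by meson
      have "cmod (D n z v - E z v) \<le> e * norm v" if n: "n \<ge> N" and z: "z \<in> ball 0 r" for n z v
      proof (rule tendsto_upperbound)
        show "(\<lambda>k. cmod (D n z v - D k z v)) \<longlonglongrightarrow> cmod (D n z v - E z v)"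
          by (intro tendsto_intros E z)
        show "\<forall>\<^sub>F k in sequentially. cmod (D n z v - D k z v) \<le> e * norm v"
          using N[OF n _ z] by (auto simp: eventually_sequentially)
      qed simp
      then show ?thesis
        unfolding eventually_sequentially by blast
    qed
    show "0 \<in> ball (0 :: complex ^ 'a) r"
      using \<open>0 < r\<close> by simp
    show "(\<lambda>n. f n 0) \<longlonglongrightarrow> g 0"
    proof (rule LIMSEQ_I)
      show "\<exists>N. \<forall>n\<ge>N. cmod (f n 0 - g 0) < e" if "0 < e" for e
        using lim[OF that] \<open>0 < r\<close> \<open>r < R\<close> by (meson centre_in_ball less_trans)
    qed
  qed simp
  then obtain h where h: "\<And>z. z \<in> ball 0 r \<Longrightarrow> (\<lambda>n. f n z) \<longlonglongrightarrow> h z"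
    "\<And>z. z \<in> ball 0 r \<Longrightarrow> (h has_derivative E z) (at z within ball 0 r)"
    by blast
  have "E z (c *s v) = c * E z v" if z: "z \<in> ball 0 r" for z c v
  proof (rule LIMSEQ_unique)
    show "(\<lambda>n. D n z (c *s v)) \<longlonglongrightarrow> E z (c *s v)"
      by (rule E[OF z])
    show "(\<lambda>n. D n z (c *s v)) \<longlonglongrightarrow> c * E z v"
      unfolding D(2)[OF z] by (intro tendsto_intros E z)
  qed
  with h(2) have "holomorphic_sv_on h (ball 0 r)"
    unfolding holomorphic_sv_on_def by blast
  moreover have "h z = g z" if z: "z \<in> ball 0 r" for z
  proof (rule LIMSEQ_unique[OF h(1)[OF z]])
    have "z \<in> ball 0 R"
      using z \<open>r < R\<close> by simp
    show "(\<lambda>n. f n z) \<longlonglongrightarrow> g z"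
    proof (rule LIMSEQ_I)
      show "\<exists>N. \<forall>n\<ge>N. cmod (f n z - g z) < e" if "0 < e" for e
        using lim[OF that] \<open>z \<in> ball 0 R\<close> by blast
    qed
  qed
  ultimately show ?thesis
    by (rule holomorphic_sv_on_cong)
qed

text \<open>The Cauchy estimate makes the family uniformly Lipschitz on an intermediate ball, so
  Arzela-Ascoli gives a uniform limit there. The gap between \<open>r\<close> and \<open>r'\<close>
  is what holomorphy of a uniform limit consumes.\<close>

lemma montel_sv:
  fixes f :: "nat \<Rightarrow> complex ^ 'n \<Rightarrow> complex"
  assumes f: "\<And>n. holomorphic_sv_on (f n) (ball 0 R)"
    and B: "\<And>n z. z \<in> ball 0 R \<Longrightarrow> cmod (f n z) \<le> B" and r: "0 < r" "r < R"
  obtains g k where "strict_mono (k :: nat \<Rightarrow> nat)" "holomorphic_sv_on g (ball 0 r)"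
    "\<And>e. 0 < e \<Longrightarrow> \<exists>N. \<forall>n\<ge>N. \<forall>z\<in>ball 0 r. cmod (f (k n) z - g z) < e"
proof -
  define r' where "r' = (r + R) / 2"
  define \<delta> where "\<delta> = (R - r') / 2"
  have r': "r < r'" "r' < R" and \<delta>: "0 < \<delta>" "r' < R - \<delta>"
    using r by (auto simp: r'_def \<delta>_def field_simps)
  have "0 \<le> B"
    using B[of 0 0] r norm_ge_zero order_trans by (metis centre_in_ball less_trans)
  have lip: "cmod (f n x - f n y) \<le> B / \<delta> * norm (x - y)" if "x \<in> cball 0 r'" "y \<in> cball 0 r'" for n x y
    using that by (intro holomorphic_sv_lipschitz[OF f B \<delta>]) auto
  obtain g k where k: "strict_mono (k :: nat \<Rightarrow> nat)"
    and g: "\<And>e. 0 < e \<Longrightarrow> \<exists>N. \<forall>n x. n \<ge> N \<and> x \<in> cball 0 r' \<longrightarrow> norm (f (k n) x - g x) < e"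
  proof (rule Arzela_Ascoli[of "cball 0 r'" f B])
    show "compact (cball (0 :: complex ^ 'n) r')"
      by simp
    show "norm (f n x) \<le> B" if "x \<in> cball 0 r'" for n x
      using that r' by (intro B) simp
    show "\<exists>d>0. \<forall>n y. y \<in> cball 0 r' \<and> norm (x - y) < d \<longrightarrow> norm (f n x - f n y) < e"
      if x: "x \<in> cball 0 r'" and "0 < e" for x e
    proof (intro exI[of _ "e * \<delta> / (B + 1)"] conjI allI impI)
      show "0 < e * \<delta> / (B + 1)"
        using \<open>0 < e\<close> \<delta> \<open>0 \<le> B\<close> by simp
      fix n y
      assume y: "y \<in> cball 0 r' \<and> norm (x - y) < e * \<delta> / (B + 1)"
      have "cmod (f n x - f n y) \<le> B / \<delta> * norm (x - y)"
        using lip x y by simp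
      also have "\<dots> \<le> B / \<delta> * (e * \<delta> / (B + 1))"
        using y \<delta> \<open>0 \<le> B\<close> by (intro mult_left_mono) auto
      also have "\<dots> < e"
        using \<delta> \<open>0 \<le> B\<close> \<open>0 < e\<close> by (simp add: divide_simps)
      finally show "norm (f n x - f n y) < e" .
    qed
  qed blast
  have lim: "\<exists>N. \<forall>n\<ge>N. \<forall>z\<in>ball 0 r'. cmod (f (k n) z - g z) < e" if e: "0 < e" for e
  proof -
    obtain N where "\<forall>n x. n \<ge> N \<and> x \<in> cball 0 r' \<longrightarrow> norm (f (k n) x - g x) < e"
      using g[OF e] by blast
    then show ?thesis
      by (intro exI[of _ N]) auto
  qed
  show thesis
  proof
    show "strict_mono k" by fact
    show "holomorphic_sv_on g (ball 0 r)"
    proof (rule holomorphic_sv_uniform_limit[OF _ r'(1) r(1) lim])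
      show "holomorphic_sv_on (f (k n)) (ball 0 r')" for n
        by (rule holomorphic_sv_on_subset[OF f]) (use r' in auto)
    qed
    show "\<exists>N. \<forall>n\<ge>N. \<forall>z\<in>ball 0 r. cmod (f (k n) z - g z) < e" if e: "0 < e" for e
    proof -
      obtain N where "\<forall>n\<ge>N. \<forall>z\<in>ball 0 r'. cmod (f (k n) z - g z) < e"
        using lim[OF e] by blast
      then show ?thesis
        using r' by (intro exI[of _ N]) auto
    qed
  qed
qed

section \<open>Sub-mean value property\<close>

text \<open>The Cauchy formula is applied to h^2 rather than to h: |h 0|^2 is then the modulus of a
  mean of h^2, and the norm bound for integrals suffices without Cauchy-Schwarz.\<close>

lemma circle_mean_square_le:
  assumes h: "h holomorphic_on ball 0 R" and R: "1 < R"
  shows "ennreal ((cmod (h 0))\<^sup>2) \<le> (\<integral>\<^sup>+t\<in>{0..1}. ennreal ((cmod (h (exp (2 * of_real pi * \<i> * of_real t))))\<^sup>2) \<partial>lborel)"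
proof -
  define e where "e = (\<lambda>t::real. exp (2 * of_real pi * \<i> * of_real t))"
  have e: "cmod (e t) = 1" for t
    by (simp add: e_def)
  have h2: "(\<lambda>z. (h z)\<^sup>2) holomorphic_on ball 0 R"
    by (intro holomorphic_intros h)
  have "((\<lambda>u. (h u)\<^sup>2 / (u - 0)) has_contour_integral (2 * of_real pi * \<i> * (h 0)\<^sup>2)) (circlepath 0 1)"
  proof (rule Cauchy_integral_circlepath)
    show "continuous_on (cball 0 1) (\<lambda>u. (h u)\<^sup>2)" "(\<lambda>u. (h u)\<^sup>2) holomorphic_on ball 0 1"
      using R by (auto intro!: holomorphic_on_imp_continuous_on holomorphic_on_subset[OF h2])
  qed simp
  then have "((\<lambda>t. (2 * of_real pi * \<i>) * (h (e t))\<^sup>2) has_integral (2 * of_real pi * \<i> * (h 0)\<^sup>2)) {0..1}"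
    unfolding has_contour_integral_def
  proof (rule has_integral_eq[rotated])
    fix t :: real
    assume "t \<in> {0..1}"
    then have "vector_derivative (circlepath 0 1) (at t within {0..1}) = 2 * of_real pi * \<i> * e t"
      by (simp add: vector_derivative_circlepath01 e_def)
    moreover have "circlepath 0 1 t = e t"
      by (simp add: circlepath e_def)
    ultimately show "(h (circlepath 0 1 t))\<^sup>2 / (circlepath 0 1 t - 0) * vector_derivative (circlepath 0 1) (at t within {0..1})
        = (2 * of_real pi * \<i>) * (h (e t))\<^sup>2"
      by (simp add: e_def)
  qed
  note int_c = this
  define c where "c = 2 * complex_of_real pi * \<i>"
  have "((\<lambda>t. inverse c * (c * (h (e t))\<^sup>2)) has_integral inverse c * (c * (h 0)\<^sup>2)) {0..1}"
    using has_integral_mult_right[OF int_c, of "inverse c"] by (simp only: c_def)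
  moreover have "c \<noteq> 0"
    by (simp add: c_def)
  then have "inverse c * (c * x) = x" for x
    by (simp add: mult.assoc[symmetric])
  ultimately have int: "((\<lambda>t. (h (e t))\<^sup>2) has_integral (h 0)\<^sup>2) {0..1}"
    by (simp only:)
  have cont: "continuous_on {0..1} (\<lambda>t. (cmod (h (e t)))\<^sup>2)"
  proof -
    have "continuous_on {0..1} e"
      unfolding e_def by (intro continuous_intros)
    moreover have "continuous_on (e ` {0..1}) h"
      using e R by (intro continuous_on_subset[OF holomorphic_on_imp_continuous_on[OF h]]) auto
    ultimately have "continuous_on {0..1} (h \<circ> e)"
      by (rule continuous_on_compose)
    then show ?thesis
      unfolding o_def by (intro continuous_on_power continuous_on_norm)
  qed
  have int2: "((\<lambda>t. (cmod (h (e t)))\<^sup>2) has_integral integral {0..1} (\<lambda>t. (cmod (h (e t)))\<^sup>2)) {0..1}"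
    using integrable_continuous_real[OF cont] by (rule integrable_integral)
  have "cmod ((h 0)\<^sup>2) \<le> integral {0..1} (\<lambda>t. (cmod (h (e t)))\<^sup>2)"
    using int int2
    by (subst integral_unique[OF int, symmetric], intro integral_norm_bound_integral)
       (auto simp: norm_power has_integral_integrable)
  then have le: "(cmod (h 0))\<^sup>2 \<le> integral {0..1} (\<lambda>t. (cmod (h (e t)))\<^sup>2)"
    by (simp add: norm_power)
  have "ennreal (integral {0..1} (\<lambda>t. (cmod (h (e t)))\<^sup>2)) = (\<integral>\<^sup>+t\<in>{0..1}. ennreal ((cmod (h (e t)))\<^sup>2) \<partial>lborel)"
  proof -
    have "set_integrable lborel {0..1} (\<lambda>t. (cmod (h (e t)))\<^sup>2)"
      by (rule borel_integrable_atLeastAtMost') (rule cont)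
    then have "(\<integral>\<^sup>+t. ennreal (indicator {0..1} t *\<^sub>R (cmod (h (e t)))\<^sup>2) \<partial>lborel)
        = ennreal (LINT t:{0..1}|lborel. (cmod (h (e t)))\<^sup>2)"
      unfolding set_integrable_def set_lebesgue_integral_def
      by (intro nn_integral_eq_integral) auto
    also have "(LINT t:{0..1}|lborel. (cmod (h (e t)))\<^sup>2) = integral {0..1} (\<lambda>t. (cmod (h (e t)))\<^sup>2)"
      by (rule set_borel_integral_eq_integral) fact
    finally show ?thesis
      by (simp add: mult.commute ennreal_mult'' flip: ennreal_indicator)
  qed
  then show ?thesis
    using ennreal_leI[OF le] by (simp add: e_def)
qed

text \<open>Functions are only controlled on the ball, so \<open>\<bar>f\<bar>\<^sup>2\<close> is cut off there to make it measurable.\<close>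

definition ball_square :: "(complex ^ 'n \<Rightarrow> complex) \<Rightarrow> complex ^ 'n \<Rightarrow> ennreal"
  where "ball_square f z = ennreal ((cmod (f z))\<^sup>2) * indicator (ball 0 1) z"

lemma borel_measurable_ball_square:
  assumes "holomorphic_sv_on f (ball 0 1)"
  shows "ball_square f \<in> borel_measurable borel"
proof -
  have "(\<lambda>v. indicator (ball 0 1) v *\<^sub>R f v) \<in> borel_measurable borel"
    by (rule borel_measurable_continuous_on_indicator) (use assms in \<open>auto intro: holomorphic_sv_on_continuous\<close>)
  then have "(\<lambda>v. ennreal ((cmod (indicator (ball 0 1) v *\<^sub>R f v))\<^sup>2)) \<in> borel_measurable borel"
    by measurable
  also have "(\<lambda>v. ennreal ((cmod (indicator (ball 0 1) v *\<^sub>R f v))\<^sup>2)) = ball_square f"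
    by (auto simp: ball_square_def fun_eq_iff indicator_def)
  finally show ?thesis .
qed

text \<open>For each w in D the mean of |f|^2 over the circle z + exp(2 pi i t) w dominates |f z|^2.
  Integrating over D and exchanging the integrals, the rotation preserves both D and Lebesgue
  measure, so the average over t disappears. Assumption \<open>sub\<close> asks for a disc of radius
  R > 1 so that the slice is holomorphic across the closed unit disc.\<close>

lemma square_submean_circular:
  fixes f :: "complex ^ 'n \<Rightarrow> complex"
  assumes f: "holomorphic_sv_on f (ball 0 1)"
    and D: "D \<in> sets borel" and circ: "\<And>w c. w \<in> D \<Longrightarrow> cmod c = 1 \<Longrightarrow> c *s w \<in> D"
    and sub: "\<And>w. w \<in> D \<Longrightarrow> \<exists>R>1. \<forall>c. cmod c < R \<longrightarrow> z + c *s w \<in> ball 0 1"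
  shows "emeasure lborel D * ennreal ((cmod (f z))\<^sup>2)
    \<le> (\<integral>\<^sup>+v. indicator D (v - z) * ball_square f v \<partial>lborel)"
proof -
  define e where "e = (\<lambda>t::real. exp (2 * of_real pi * \<i> * of_real t))"
  have e: "cmod (e t) = 1" for t
    by (simp add: e_def)
  define g where "g = ball_square f"
  have [measurable]: "g \<in> borel_measurable borel"
    unfolding g_def by (rule borel_measurable_ball_square[OF f])
  have [measurable]: "D \<in> sets borel" by fact
  have meas [measurable]: "(\<lambda>(w, t). g (z + e t *s w)) \<in> borel_measurable (borel \<Otimes>\<^sub>M borel)"
  proof -
    have "(\<lambda>p. z + e (snd p) *s fst p) \<in> borel_measurable borel"
      unfolding e_def
      by (intro borel_measurable_continuous_onI continuous_on_add continuous_on_smult) (auto intro!: continuous_intros)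
    then have "(\<lambda>p. g (z + e (snd p) *s fst p)) \<in> borel_measurable (borel :: ((complex ^ 'n) \<times> real) measure)"
      by measurable
    then show ?thesis
      by (simp add: borel_prod case_prod_beta)
  qed
  have "emeasure lborel D * ennreal ((cmod (f z))\<^sup>2) = (\<integral>\<^sup>+w. indicator D w * ennreal ((cmod (f z))\<^sup>2) \<partial>lborel)"
    by (simp add: nn_integral_multc)
  also have "\<dots> \<le> (\<integral>\<^sup>+w. (\<integral>\<^sup>+t. indicator {0..1} t * (indicator D w * g (z + e t *s w)) \<partial>lborel) \<partial>lborel)"
  proof (rule nn_integral_mono)
    fix w
    show "indicator D w * ennreal ((cmod (f z))\<^sup>2) \<le> (\<integral>\<^sup>+t. indicator {0..1} t * (indicator D w * g (z + e t *s w)) \<partial>lborel)"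
    proof (cases "w \<in> D")
      case True
      then obtain R where R: "R > 1" "\<And>c. cmod c < R \<Longrightarrow> z + c *s w \<in> ball 0 1"
        using sub by blast
      have "(\<lambda>c. f (z + c *s w)) holomorphic_on ball 0 R"
        using R by (intro holomorphic_sv_on_slice[OF f]) (auto simp: dist_norm)
      from circle_mean_square_le[OF this R(1)]
      have "ennreal ((cmod (f z))\<^sup>2) \<le> (\<integral>\<^sup>+t\<in>{0..1}. ennreal ((cmod (f (z + e t *s w)))\<^sup>2) \<partial>lborel)"
        by (simp add: e_def)
      also have "\<dots> = (\<integral>\<^sup>+t. indicator {0..1} t * (indicator D w * g (z + e t *s w)) \<partial>lborel)"
        using True R(2)[of "e _"] R(1) by (intro nn_integral_cong) (simp add: g_def ball_square_def e mult.commute)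
      finally show ?thesis
        using True by simp
    qed simp
  qed
  also have "\<dots> = (\<integral>\<^sup>+t. (\<integral>\<^sup>+w. indicator {0..1} t * (indicator D w * g (z + e t *s w)) \<partial>lborel) \<partial>lborel)"
    by (rule lborel_pair.Fubini'[symmetric]) measurable
  also have "\<dots> = (\<integral>\<^sup>+t. indicator {0..1::real} t * (\<integral>\<^sup>+w. indicator D w * g (z + w) \<partial>lborel) \<partial>lborel)"
  proof (rule nn_integral_cong)
    fix t
    have [measurable]: "((*s) (e t)) \<in> borel_measurable (borel :: (complex ^ 'n) measure)"
      by (rule borel_measurable_continuous_onI) (simp add: linear_smult linear_continuous_on linear_conv_bounded_linear[symmetric])
    \<comment> \<open>Both implications come from \<open>circ\<close>, the converse one through the
      inverse rotation.\<close>
    have "indicator D w = (indicator D (e t *s w) :: ennreal)" for w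
      using circ[of w "e t"] circ[of "e t *s w" "inverse (e t)"] e[of t]
      by (auto simp: indicator_def norm_inverse)
         (metis e norm_zero vector_smult_lid vector_smult_assoc left_inverse norm_inverse inverse_1 zero_neq_one)
    then have "(\<integral>\<^sup>+w. indicator D w * g (z + e t *s w) \<partial>lborel) = (\<integral>\<^sup>+w. indicator D (e t *s w) * g (z + e t *s w) \<partial>lborel)"
      by simp
    also have "\<dots> = (\<integral>\<^sup>+w. indicator D w * g (z + w) \<partial>distr lborel borel ((*s) (e t)))"
      by (subst nn_integral_distr) simp_all
    also have "distr lborel borel ((*s) (e t)) = (lborel :: (complex ^ 'n) measure)"
      by (rule lborel_distr_isometry) (simp_all add: linear_smult norm_smult e)
    finally have "(\<integral>\<^sup>+w. indicator D w * g (z + e t *s w) \<partial>lborel) = (\<integral>\<^sup>+w. indicator D w * g (z + w) \<partial>lborel)" .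
    moreover have "(\<lambda>w. indicator D w * g (z + e t *s w)) \<in> borel_measurable lborel"
      by measurable
    ultimately show "(\<integral>\<^sup>+w. indicator {0..1} t * (indicator D w * g (z + e t *s w)) \<partial>lborel)
        = indicator {0..1} t * (\<integral>\<^sup>+w. indicator D w * g (z + w) \<partial>lborel)"
      by (simp add: nn_integral_cmult)
  qed
  also have "\<dots> = (\<integral>\<^sup>+w. indicator D w * g (z + w) \<partial>lborel)"
    by (simp add: nn_integral_multc)
  also have "\<dots> = (\<integral>\<^sup>+v. indicator D (v - z) * g v \<partial>lborel)"
    by (subst (2) lborel_distr_plus[symmetric, of z]) (simp add: nn_integral_distr)
  finally show ?thesis
    by (simp add: g_def)
qed

lemma koranyi_region_submean:
  fixes f :: "complex ^ 'n \<Rightarrow> complex"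
  assumes f: "holomorphic_sv_on f (ball 0 1)" and z: "norm z < 1"
  shows "ennreal ((cmod (f z))\<^sup>2) \<le> ennreal (121 * 16 ^ CARD('n) / (1 - (norm z)\<^sup>2) ^ (CARD('n) + 1))
    * (\<integral>\<^sup>+v. indicator (koranyi_region z) (v - z) * ball_square f v \<partial>ball_measure)"
proof -
  define V where "V = emeasure lborel (ball (0 :: complex ^ 'n) 1)"
  have V: "V \<noteq> 0" "V \<noteq> top"
    unfolding V_def by (rule emeasure_lborel_unit_ball)+
  define c where "c = ennreal (121 * 16 ^ CARD('n) / (1 - (norm z)\<^sup>2) ^ (CARD('n) + 1))"
  define I where "I = (\<integral>\<^sup>+v. indicator (koranyi_region z) (v - z) * ball_square f v \<partial>lborel)"
  have in_ball: "z + w \<in> ball 0 1" if "w \<in> koranyi_region z" for w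
  proof -
    have "0 < 1 - (norm z)\<^sup>2"
      using z by (simp add: power_less_one_iff)
    then have "0 < (1 - (norm z)\<^sup>2) / 2"
      by simp
    also have "\<dots> \<le> 1 - (norm (z + w))\<^sup>2"
      by (rule koranyi_region_defect(1)[OF that z])
    finally have "(norm (z + w))\<^sup>2 < 1"
      by simp
    then show ?thesis
      by (simp add: power_less_one_iff)
  qed
  have "emeasure lborel (koranyi_region z) * ennreal ((cmod (f z))\<^sup>2) \<le> I"
    unfolding I_def
  proof (rule square_submean_circular[OF f borel_koranyi_region])
    show "c *s w \<in> koranyi_region z" if "w \<in> koranyi_region z" "cmod c = 1" for w c
      using that by (simp add: koranyi_region_def hermitian_inner_smult_left norm_mult norm_smult)
    show "\<exists>R>1. \<forall>c. cmod c < R \<longrightarrow> z + c *s w \<in> ball 0 1" if w: "w \<in> koranyi_region z" for w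
    proof -
      \<comment> \<open>The two strict inequalities of the region, merged into one maximum, survive
        a dilation slightly beyond 1; this is the margin that the mean value on the closed disc
        needs.\<close>
      let ?M = "\<lambda>r :: real. max (r * cmod (hermitian_inner w z) - (1 - (norm z)\<^sup>2) / 8) (r\<^sup>2 * (norm w)\<^sup>2 - (1 - (norm z)\<^sup>2) / 4)"
      have "((\<lambda>r. ?M r) \<longlongrightarrow>
          ?M 1) (at_right 1)"
        by (intro tendsto_intros)
      moreover have "?M 1 < 0"
        using w by (simp add: koranyi_region_def)
      ultimately have "\<forall>\<^sub>F r in at_right 1. ?M r < 0"
        by (rule order_tendstoD)
      then have "\<forall>\<^sub>F r in at_right 1. r *\<^sub>R w \<in> koranyi_region z"
        using eventually_at_right_less[of "1 :: real"]
        by eventually_elim (auto simp: koranyi_region_def hermitian_inner_scaleR_left norm_mult power_mult_distrib)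
      then obtain R where R: "R > 1" "\<And>r. 1 < r \<Longrightarrow> r < R \<Longrightarrow> r *\<^sub>R w \<in> koranyi_region z"
        by (auto simp: eventually_at_right_field)
      define r where "r = (1 + R) / 2"
      have r: "1 < r" "r *\<^sub>R w \<in> koranyi_region z"
        using R by (auto simp: r_def intro!: R(2))
      have "c *s w \<in> koranyi_region z" if "cmod c < r" for c
      proof -
        have lt: "r * cmod (hermitian_inner w z) < (1 - (norm z)\<^sup>2) / 8" "(r * norm w)\<^sup>2 < (1 - (norm z)\<^sup>2) / 4"
          using r by (simp_all add: koranyi_region_def hermitian_inner_scaleR_left norm_mult)
        have "cmod c * cmod (hermitian_inner w z) \<le> r * cmod (hermitian_inner w z)"
          using that by (intro mult_right_mono) auto
        moreover have "(cmod c * norm w)\<^sup>2 \<le> (r * norm w)\<^sup>2"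
          using that by (intro power_mono mult_right_mono) auto
        ultimately show ?thesis
          unfolding koranyi_region_def mem_Collect_eq hermitian_inner_smult_left norm_mult norm_smult
          using lt by (intro conjI) (rule order.strict_trans1, assumption, assumption)+
      qed
      then show ?thesis
        using in_ball r by blast
    qed
  qed
  then have "c * (emeasure lborel (koranyi_region z) * ennreal ((cmod (f z))\<^sup>2)) \<le> c * I"
    by (rule mult_left_mono) simp
  moreover have "V * ennreal ((cmod (f z))\<^sup>2) \<le> c * emeasure lborel (koranyi_region z) * ennreal ((cmod (f z))\<^sup>2)"
    unfolding V_def c_def by (intro mult_right_mono koranyi_region_volume z) simp
  ultimately have "V * ennreal ((cmod (f z))\<^sup>2) \<le> c * I"
    by (simp add: mult.assoc)
  then have "V * ennreal ((cmod (f z))\<^sup>2) / V \<le> c * I / V"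
    by (rule divide_right_mono_ennreal)
  then have "ennreal ((cmod (f z))\<^sup>2) \<le> c * (I / V)"
    using V by (simp add: ennreal_mult_divide_eq mult.commute[of V] ennreal_times_divide)
  also have "I / V = (\<integral>\<^sup>+v. indicator (koranyi_region z) (v - z) * ball_square f v \<partial>ball_measure)"
  proof -
    note [measurable] = borel_measurable_ball_square[OF f]
    have "I = (\<integral>\<^sup>+v. (indicator (koranyi_region z) (v - z) * ball_square f v) * indicator (ball 0 1) v \<partial>lborel)"
      unfolding I_def by (intro nn_integral_cong) (simp add: ball_square_def indicator_def)
    then show ?thesis
      unfolding ball_measure_def V_def by (subst nn_integral_uniform_measure) simp_all
  qed
  finally show ?thesis
    by (simp add: c_def)
qed

section \<open>Boundary contact of linear fractional maps\<close>

definition clinear_vec :: "(complex ^ 'n \<Rightarrow> complex ^ 'm) \<Rightarrow> bool"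
  where "clinear_vec L \<longleftrightarrow> linear L \<and> (\<forall>c v. L (c *s v) = c *s L v)"

definition clinear_fun :: "(complex ^ 'n \<Rightarrow> complex) \<Rightarrow> bool"
  where "clinear_fun m \<longleftrightarrow> linear m \<and> (\<forall>c v. m (c *s v) = c * m v)"

lemma clinear_fun_hermitian_inner: "clinear_fun (\<lambda>w. hermitian_inner w C / d)"
proof -
  have "linear (\<lambda>w. hermitian_inner w C / d)"
    by (rule linearI) (simp_all add: hermitian_inner_add_left add_divide_distrib
      hermitian_inner_scaleR_left scaleR_conv_of_real[where x = "hermitian_inner _ _ / d"])
  then show ?thesis
    by (simp add: clinear_fun_def hermitian_inner_smult_left)
qed

text \<open>An exact recentring, not a Taylor expansion: the denominator factors as d0 (1 + m w),
  and subtracting the value \<eta> at \<zeta> leaves the numerator A w - <w,C> \<eta>, linear in w.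
  The value at \<zeta> is written out because \<phi> itself is prescribed only on the open
  ball.\<close>

lemma linear_fractional_expansion:
  fixes \<phi> :: "complex ^ 'n \<Rightarrow> complex ^ 'n"
  assumes den: "\<And>z. z \<in> cball 0 1 \<Longrightarrow> hermitian_inner z C + d \<noteq> 0"
    and \<phi>: "\<And>z. z \<in> ball 0 1 \<Longrightarrow> \<phi> z = inverse (hermitian_inner z C + d) *s (A *v z + B)"
    and \<zeta>: "\<zeta> \<in> cball 0 1"
  obtains L m where "clinear_vec L" "clinear_fun m"
    "\<And>w. \<zeta> + w \<in> cball 0 1 \<Longrightarrow> 1 + m w \<noteq> 0"
    "\<And>w. \<zeta> + w \<in> ball 0 1 \<Longrightarrow>
      \<phi> (\<zeta> + w) = inverse (hermitian_inner \<zeta> C + d) *s (A *v \<zeta> + B) + inverse (1 + m w) *s L w"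
proof -
  define d0 where "d0 = hermitian_inner \<zeta> C + d"
  have d0: "d0 \<noteq> 0"
    using den[OF \<zeta>] by (simp add: d0_def)
  define \<eta> where "\<eta> = inverse d0 *s (A *v \<zeta> + B)"
  define m where "m = (\<lambda>w. hermitian_inner w C / d0)"
  define L where "L = (\<lambda>w. inverse d0 *s (A *v w - hermitian_inner w C *s \<eta>))"
  have "linear L"
    unfolding L_def
    by (rule linearI)
       (simp_all add: hermitian_inner_add_left hermitian_inner_smult_left scaleR_eq_smult
         vec_eq_iff algebra_simps matrix_vector_mult_def sum_distrib_left sum.distrib)
  moreover have "L (c *s v) = c *s L v" for c v
    unfolding L_def
    by (simp_all add: hermitian_inner_smult_left
         vec_eq_iff algebra_simps matrix_vector_mult_def sum_distrib_left)
  ultimately have L: "clinear_vec L"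
    by (simp add: clinear_vec_def)
  have den': "hermitian_inner (\<zeta> + w) C + d = d0 * (1 + m w)" for w
    using d0 by (simp add: hermitian_inner_add_left m_def distrib_left) (simp add: d0_def)
  show thesis
  proof
    show "clinear_vec L" by fact
    show "clinear_fun m"
      unfolding m_def by (rule clinear_fun_hermitian_inner)
    show nz: "1 + m w \<noteq> 0" if "\<zeta> + w \<in> cball 0 1" for w
      using den[OF that] by (simp add: den')
    show "\<phi> (\<zeta> + w) = inverse (hermitian_inner \<zeta> C + d) *s (A *v \<zeta> + B) + inverse (1 + m w) *s L w"
      if w: "\<zeta> + w \<in> ball 0 1" for w
    proof -
      have nz: "1 + m w \<noteq> 0"
        using w nz[of w] by simp
      have B: "A *v \<zeta> + B = d0 *s \<eta>"
        using d0 by (simp add: \<eta>_def)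
      have num: "A *v (\<zeta> + w) + B = d0 *s \<eta> + A *v w"
        by (simp add: matrix_vector_right_distrib flip: B)
      have hip: "hermitian_inner w C = d0 * m w"
        using d0 by (simp add: m_def)
      show ?thesis
        using d0 nz unfolding \<phi>[OF w] den' num L_def \<eta>_def[symmetric] d0_def[symmetric] hip
        by (simp add: vec_eq_iff divide_simps) (simp add: algebra_simps)
    qed
  qed
qed

text \<open>A self-map sends inward directions at \<zeta> to directions that do not leave the ball
  at \<eta>, so the complex-linear functional w |-> <L w, \<eta>> has nonpositive real part on the
  half-space Re <w,\<zeta>> < 0. Such a functional is a real multiple of <w,\<zeta>>. In substance
  this is the boundary behaviour of Julia-Caratheodory type, made elementary by the explicit form of
  the map.\<close>

lemma contact_derivative:
  fixes L :: "complex ^ 'n \<Rightarrow> complex ^ 'n"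
  assumes L: "clinear_vec L" and m: "clinear_fun m"
    and nz: "\<And>w. \<zeta> + w \<in> ball 0 1 \<Longrightarrow> 1 + m w \<noteq> 0"
    and self: "\<And>w. \<zeta> + w \<in> ball 0 1 \<Longrightarrow> norm (\<eta> + inverse (1 + m w) *s L w) < 1"
    and \<zeta>: "norm \<zeta> = 1" and \<eta>: "norm \<eta> = 1"
  obtains \<kappa> :: real where "\<kappa> \<noteq> 0" "\<And>w. hermitian_inner (L w) \<eta> = of_real \<kappa> * hermitian_inner w \<zeta>"
proof -
  define l where "l = (\<lambda>w. hermitian_inner (L w) \<eta>)"
  have lin: "linear L" "linear m"
    and hom: "L (c *s v) = c *s L v" "m (c *s v) = c * m v" for c v
    using L m by (auto simp: clinear_vec_def clinear_fun_def)
  have l_add: "l (x + y) = l x + l y" and l_diff: "l (x - y) = l x - l y"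
    and l_smult: "l (c *s x) = c * l x" for x y c
    by (simp_all add: l_def linear_add[OF lin(1)] linear_diff[OF lin(1)] hom hermitian_inner_add_left hermitian_inner_diff_left
        hermitian_inner_smult_left)
  have neg: "Re (l w) \<le> 0" if w: "Re (hermitian_inner w \<zeta>) < 0" for w
  proof -
    have wnz: "w \<noteq> 0"
      using w by auto
    have in_ball: "\<forall>\<^sub>F t in at_right (0::real). \<zeta> + of_real t *s w \<in> ball 0 1"
    proof -
      \<comment> \<open>The positive time at which 1 + 2 t Re <w,\<zeta>> + t^2 |w|^2 returns to
        1.\<close>
      define t0 where "t0 = - 2 * Re (hermitian_inner w \<zeta>) / (norm w)\<^sup>2"
      have "0 < t0"
        using w wnz by (simp add: t0_def divide_neg_pos)
      have "\<zeta> + of_real t *s w \<in> ball 0 1" if t: "0 < t" "t < t0" for t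
      proof -
        have "t * (norm w)\<^sup>2 < - 2 * Re (hermitian_inner w \<zeta>)"
          using t(2) wnz unfolding t0_def by (subst (asm) pos_less_divide_eq) auto
        then have "t * (2 * Re (hermitian_inner w \<zeta>) + t * (norm w)\<^sup>2) < 0"
          using t by (simp add: mult_pos_neg)
        then have "(norm (\<zeta> + of_real t *s w))\<^sup>2 < 1"
          using t \<zeta> by (simp only: norm_add_square hermitian_inner_smult_left norm_smult power_mult_distrib)
             (simp add: algebra_simps power2_eq_square)
        then show ?thesis
          by (simp add: power_less_one_iff abs_square_less_1)
      qed
      then show ?thesis
        using \<open>0 < t0\<close> by (auto simp: eventually_at_right_field)
    qed
    have "((\<lambda>t. Re (inverse (1 + of_real t * m w) * l w)) \<longlongrightarrow> Re (inverse (1 + of_real 0 * m w) * l w)) (at_right 0)"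
      by (intro tendsto_intros) auto
    moreover have "\<forall>\<^sub>F t in at_right 0. Re (inverse (1 + of_real t * m w) * l w) \<le> 0"
      using in_ball eventually_at_right_less
    proof eventually_elim
      case (elim t)
      define v where "v = inverse (1 + of_real t * m w) *s (of_real t *s L w)"
      have "norm (\<eta> + v) < 1"
        using self[OF elim(1)] by (simp add: hom v_def)
      then have "(norm (\<eta> + v))\<^sup>2 < 1"
        by (simp add: power_less_one_iff)
      then have "2 * Re (hermitian_inner v \<eta>) + (norm v)\<^sup>2 < 0"
        using \<eta> by (simp add: norm_add_square)
      then have "Re (hermitian_inner v \<eta>) < 0"
        by (smt (verit) zero_le_power2)
      also have "hermitian_inner v \<eta> = of_real t * (inverse (1 + of_real t * m w) * l w)"
        by (simp add: v_def hermitian_inner_smult_left l_def)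
      finally show ?case
        using elim(2) by (simp add: mult_less_0_iff flip: right_diff_distrib)
    qed
    ultimately show ?thesis
      by (auto dest: tendsto_upperbound)
  qed
  have hz: "hermitian_inner \<zeta> \<zeta> = 1"
    by (simp add: hermitian_inner_self \<zeta>)
  \<comment> \<open>Tilting w inward by a small multiple of \<zeta> extends the sign to the closed
    half-space. On its boundary w and -w both qualify, and on the complex tangent space
    \<open>\<i> *s w\<close> does too, so the functional vanishes there.\<close>
  have neg': "Re (l w) \<le> 0" if w: "Re (hermitian_inner w \<zeta>) \<le> 0" for w
  proof -
    have "Re (l (w - of_real t *s \<zeta>)) \<le> 0" if "0 < t" for t
      using w that by (intro neg) (simp add: hermitian_inner_diff_left hermitian_inner_smult_left hz)
    then have le: "Re (l w) \<le> t * Re (l \<zeta>)" if "0 < t" for t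
      using that by (simp add: l_diff l_smult)
    have "((\<lambda>t. t * Re (l \<zeta>)) \<longlongrightarrow> 0 * Re (l \<zeta>)) (at_right 0)"
      by (intro tendsto_intros)
    moreover have "\<forall>\<^sub>F t in at_right 0. Re (l w) \<le> t * Re (l \<zeta>)"
      using eventually_at_right_less by eventually_elim (rule le)
    ultimately show ?thesis
      by (auto dest: tendsto_lowerbound)
  qed
  have zero: "Re (l w) = 0" if w: "Re (hermitian_inner w \<zeta>) = 0" for w
    using neg'[of w] neg'[of "- w"] w l_diff[of 0 w] l_diff[of 0 0]
    by (simp add: hermitian_inner_minus_left)
  have perp: "l w = 0" if w: "hermitian_inner w \<zeta> = 0" for w
    using zero[of w] zero[of "\<i> *s w"] w
    by (simp add: complex_eq_iff hermitian_inner_smult_left l_smult)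
  have "Im (l \<zeta>) = 0"
    using zero[of "\<i> *s \<zeta>"] by (simp add: hermitian_inner_smult_left l_smult hz)
  then obtain \<kappa> :: real where \<kappa>: "l \<zeta> = of_real \<kappa>"
    by (metis complex_is_Real_iff Reals_cases)
  have l: "l w = of_real \<kappa> * hermitian_inner w \<zeta>" for w
  proof -
    have "l (w - hermitian_inner w \<zeta> *s \<zeta>) = 0"
      by (rule perp) (simp add: hermitian_inner_diff_left hermitian_inner_smult_left hz)
    then show ?thesis
      by (simp add: l_diff l_smult \<kappa>)
  qed
  \<comment> \<open>If \<kappa> were 0, every displacement from \<eta> would be orthogonal to \<eta>
    and lead out of the ball. The choice w = -\<zeta>, the centre of the ball, gives the
    contradiction.\<close>
  have "\<kappa> \<noteq> 0"
  proof
    assume "\<kappa> = 0"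
    then have l0: "l w = 0" for w
      by (simp add: l)
    define v where "v = inverse (1 + m (- \<zeta>)) *s L (- \<zeta>)"
    have "norm (\<eta> + v) < 1"
      using self[of "- \<zeta>"] by (simp add: v_def)
    then have "(norm (\<eta> + v))\<^sup>2 < 1"
      by (simp add: power_less_one_iff)
    moreover have "hermitian_inner v \<eta> = 0"
      using l0 by (simp add: v_def hermitian_inner_smult_left l_def)
    ultimately show False
      using \<eta> by (simp add: norm_add_square)
  qed
  then show thesis
    using l that by (simp add: l_def)
qed

section \<open>Curves with second-order contact\<close>

lemma tendsto_clinear_vec:
  "clinear_vec L \<Longrightarrow> (f \<longlongrightarrow> a) F \<Longrightarrow> ((\<lambda>x. L (f x)) \<longlongrightarrow> L a) F"
  by (auto simp: clinear_vec_def linear_conv_bounded_linear intro: bounded_linear.tendsto)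

lemma tendsto_clinear_fun:
  "clinear_fun L \<Longrightarrow> (f \<longlongrightarrow> a) F \<Longrightarrow> ((\<lambda>x. L (f x)) \<longlongrightarrow> L a) F"
  by (auto simp: clinear_fun_def linear_conv_bounded_linear intro: bounded_linear.tendsto)

text \<open>
  The curves \<open>t \<mapsto> \<zeta> + t *s contact_direction \<zeta> w t\<close> with \<open>w\<close> real-tangent to the sphere at
  \<open>\<zeta>\<close> touch the sphere at \<open>\<zeta>\<close> to second order: \<open>1 - |z|\<^sup>2\<close> is comparable to \<open>t\<^sup>2\<close> on them.
\<close>

definition contact_direction :: "complex ^ 'n \<Rightarrow> complex ^ 'n \<Rightarrow> real \<Rightarrow> complex ^ 'n"
  where "contact_direction \<zeta> w t = w - of_real (t * ((norm w)\<^sup>2 + 1)) *s \<zeta>"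

lemma tendsto_contact_direction: "(contact_direction \<zeta> w \<longlongrightarrow> w) (at_right 0)"
proof -
  have "(contact_direction \<zeta> w \<longlongrightarrow> w - of_real (0 * ((norm w)\<^sup>2 + 1)) *s \<zeta>) (at_right 0)"
    unfolding contact_direction_def by (intro tendsto_intros)
  then show ?thesis
    by simp
qed

text \<open>With \<beta> = |w|^2 + 1 the inward correction gains 2 t^2 \<beta> and the tangential
  motion costs t^2 (\<beta> - 1). Up to a term of fourth order the defect is t^2 (\<beta> + 1), and
  t \<beta> < 1 keeps at least t^2 of it.\<close>

lemma contact_direction_in_ball:
  assumes \<zeta>: "norm \<zeta> = 1" and w: "Re (hermitian_inner w \<zeta>) = 0"
  shows "\<forall>\<^sub>F t in at_right 0. \<zeta> + of_real t *s contact_direction \<zeta> w t \<in> ball 0 1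
    \<and> t\<^sup>2 \<le> 1 - (norm (\<zeta> + of_real t *s contact_direction \<zeta> w t))\<^sup>2"
proof -
  let ?z = "\<lambda>t. \<zeta> + of_real t *s contact_direction \<zeta> w t"
  define \<beta> where "\<beta> = (norm w)\<^sup>2 + 1"
  have \<beta>: "\<beta> \<ge> 1"
    by (simp add: \<beta>_def)
  have hz: "hermitian_inner \<zeta> \<zeta> = 1"
    by (simp add: hermitian_inner_self \<zeta>)
  have "?z t \<in> ball 0 1
    \<and> t\<^sup>2 \<le> 1 - (norm (?z t))\<^sup>2" if t: "0 < t" "t < 1 / \<beta>" for t
  proof -
    have tb: "t * \<beta> < 1"
      using t \<beta> by (simp add: field_simps)
    have hw: "Re (hermitian_inner (contact_direction \<zeta> w t) \<zeta>) = - t * \<beta>"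
      using w hz by (simp add: contact_direction_def \<beta>_def hermitian_inner_diff_left hermitian_inner_smult_left)
    have "contact_direction \<zeta> w t = w + of_real (- (t * \<beta>)) *s \<zeta>"
      by (simp add: contact_direction_def \<beta>_def vec_eq_iff)
    then have "(norm (contact_direction \<zeta> w t))\<^sup>2 = (norm w)\<^sup>2 + 2 * Re (of_real (- (t * \<beta>)) * hermitian_inner \<zeta> w) + (t * \<beta>)\<^sup>2"
      using \<zeta> by (simp only: norm_add_square hermitian_inner_smult_left norm_smult)
        (simp add: norm_mult power_mult_distrib)
    also have "Re (of_real (- (t * \<beta>)) * hermitian_inner \<zeta> w) = 0"
      using w by (subst hermitian_inner_commute) simp
    finally have nw: "(norm (contact_direction \<zeta> w t))\<^sup>2 = \<beta> - 1 + (t * \<beta>)\<^sup>2"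
      by (simp add: \<beta>_def)
    have "(norm (?z t))\<^sup>2
       = 1 + 2 * Re (of_real t * hermitian_inner (contact_direction \<zeta> w t) \<zeta>) + t\<^sup>2 * (norm (contact_direction \<zeta> w t))\<^sup>2"
      using \<zeta> by (simp only: norm_add_square hermitian_inner_smult_left norm_smult power_mult_distrib) simp
    also have "\<dots> = 1 - t\<^sup>2 * (\<beta> + 1 - (t * \<beta>)\<^sup>2)"
      using hw by (simp add: nw) (simp add: algebra_simps power2_eq_square)
    finally have eq: "1 - (norm (?z t))\<^sup>2 = t\<^sup>2 * (\<beta> + 1 - (t * \<beta>)\<^sup>2)"
      by simp
    have "(t * \<beta>)\<^sup>2 \<le> 1"
      using t \<beta> tb by (simp add: power_le_one)
    then have "t\<^sup>2 * 1 \<le> t\<^sup>2 * (\<beta> + 1 - (t * \<beta>)\<^sup>2)"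
      using \<beta> by (intro mult_left_mono) auto
    with eq have 1: "t\<^sup>2 \<le> 1 - (norm (?z t))\<^sup>2"
      by simp
    moreover have "0 < t\<^sup>2"
      using t by simp
    ultimately have "(norm (?z t))\<^sup>2 < 1"
      by linarith
    then have "norm (?z t) < 1"
      by (simp add: power_less_one_iff)
    with 1 show ?thesis
      by simp
  qed
  moreover have "0 < 1 / \<beta>"
    using \<beta> by simp
  ultimately show ?thesis
    unfolding eventually_at_right_field by blast
qed

text \<open>The difference quotient of the recentred map along the contact curve, with the factor t
  of the displacement already cancelled.\<close>

definition contact_quotient ::
    "complex ^ 'n \<Rightarrow> (complex ^ 'n \<Rightarrow> complex ^ 'n) \<Rightarrow> (complex ^ 'n \<Rightarrow> complex) \<Rightarrow> complex ^ 'n \<Rightarrow> real \<Rightarrow> complex ^ 'n"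
  where "contact_quotient \<zeta> L m w t =
    inverse (1 + of_real t * m (contact_direction \<zeta> w t)) *s L (contact_direction \<zeta> w t)"

lemma tendsto_contact_quotient:
  assumes "clinear_vec L" "clinear_fun m"
  shows "(contact_quotient \<zeta> L m w \<longlongrightarrow> L w) (at_right 0)"
proof -
  have "(contact_quotient \<zeta> L m w \<longlongrightarrow> inverse (1 + of_real 0 * m w) *s L w) (at_right 0)"
    unfolding contact_quotient_def
    by (intro tendsto_intros tendsto_clinear_vec[OF assms(1)] tendsto_clinear_fun[OF assms(2)] tendsto_contact_direction) auto
  then show ?thesis
    by simp
qed

lemma tendsto_along_curve:
  assumes "clinear_vec L" "clinear_fun m"
  shows "((\<lambda>t. \<eta> + of_real t *s contact_quotient \<zeta> L m w t) \<longlongrightarrow> \<eta>) (at_right 0)"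
proof -
  have "((\<lambda>t. \<eta> + of_real t *s contact_quotient \<zeta> L m w t) \<longlongrightarrow> \<eta> + of_real 0 *s L w) (at_right 0)"
    by (intro tendsto_intros tendsto_contact_quotient assms)
  then show ?thesis
    by simp
qed

text \<open>The term of first order in t is governed by Re (\<kappa> <w,\<zeta>>), which vanishes
  because \<kappa> is real and w is real-tangent. What is left is t^2 times a function with a limit
  at 0, hence bounded near 0.\<close>

lemma contact_defect_bound:
  fixes L :: "complex ^ 'n \<Rightarrow> complex ^ 'n"
  assumes L: "clinear_vec L" and m: "clinear_fun m"
    and \<kappa>: "\<And>w. hermitian_inner (L w) \<eta> = of_real \<kappa> * hermitian_inner w \<zeta>"
    and \<zeta>: "norm \<zeta> = 1" and \<eta>: "norm \<eta> = 1" and w: "Re (hermitian_inner w \<zeta>) = 0"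
  obtains K where "K > 0"
    "\<forall>\<^sub>F t in at_right 0. 1 - (norm (\<eta> + of_real t *s contact_quotient \<zeta> L m w t))\<^sup>2 \<le> K * t\<^sup>2"
proof -
  define \<beta> where "\<beta> = (norm w)\<^sup>2 + 1"
  define h where "h = hermitian_inner w \<zeta>"
  define M where "M = (\<lambda>t. m (contact_direction \<zeta> w t))"
  define V where "V = contact_quotient \<zeta> L m w"
  define g where "g = (\<lambda>t. 2 * \<kappa> * Re ((of_real \<beta> + h * M t) * inverse (1 + of_real t * M t)) - (norm (V t))\<^sup>2)"
  have hz: "hermitian_inner \<zeta> \<zeta> = 1"
    by (simp add: hermitian_inner_self \<zeta>)
  have Mlim: "(M \<longlongrightarrow> m w) (at_right 0)"
    unfolding M_def by (intro tendsto_clinear_fun[OF m] tendsto_contact_direction)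
  have Vlim: "(V \<longlongrightarrow> L w) (at_right 0)"
    unfolding V_def by (intro tendsto_contact_quotient L m)
  have "(g \<longlongrightarrow> 2 * \<kappa> * Re ((of_real \<beta> + h * m w) * inverse (1 + of_real 0 * m w)) - (norm (L w))\<^sup>2) (at_right 0)"
    unfolding g_def by (intro tendsto_intros Mlim Vlim) auto
  then obtain g0 where g0: "(g \<longlongrightarrow> g0) (at_right 0)"
    by blast
  have nz: "\<forall>\<^sub>F t in at_right 0. 1 + of_real t * M t \<noteq> 0"
  proof -
    have "((\<lambda>t. 1 + of_real t * M t) \<longlongrightarrow> 1 + of_real 0 * m w) (at_right 0)"
      by (intro tendsto_intros Mlim)
    then show ?thesis
      by (rule tendsto_imp_eventually_ne) simp
  qed
  have eq: "1 - (norm (\<eta> + of_real t *s V t))\<^sup>2 = t\<^sup>2 * g t" if nz: "1 + of_real t * M t \<noteq> 0" for t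
  proof -
    have "hermitian_inner (V t) \<eta> = of_real \<kappa> * ((h - of_real (t * \<beta>)) * inverse (1 + of_real t * M t))"
      by (simp add: V_def contact_quotient_def hermitian_inner_smult_left \<kappa> contact_direction_def
          hermitian_inner_diff_left hz h_def \<beta>_def M_def)
    \<comment> \<open>Splitting off \<open>h * (1 + of_real t * M t)\<close> cancels the denominator
      exactly: the purely imaginary h remains, and everything else carries a further factor
      t.\<close>
    also have "h - of_real (t * \<beta>) = h * (1 + of_real t * M t) - of_real t * (of_real \<beta> + h * M t)"
      by (simp add: algebra_simps)
    also have "(h * (1 + of_real t * M t) - of_real t * (of_real \<beta> + h * M t)) * inverse (1 + of_real t * M t)
        = h - of_real t * ((of_real \<beta> + h * M t) * inverse (1 + of_real t * M t))"
      using nz by (simp add: divide_simps)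
    finally have "Re (hermitian_inner (V t) \<eta>) = Re (of_real \<kappa> * (h - of_real t * ((of_real \<beta> + h * M t) * inverse (1 + of_real t * M t))))"
      by simp
    also have "\<dots> = - \<kappa> * t * Re ((of_real \<beta> + h * M t) * inverse (1 + of_real t * M t))"
    proof -
      have "Re (of_real \<kappa> * (h - of_real t * u)) = - \<kappa> * t * Re u" for u
        using w by (simp add: h_def)
      then show ?thesis .
    qed
    finally have re: "Re (hermitian_inner (V t) \<eta>) = - \<kappa> * t * Re ((of_real \<beta> + h * M t) * inverse (1 + of_real t * M t))" .
    have "(norm (\<eta> + of_real t *s V t))\<^sup>2 = 1 + 2 * (t * Re (hermitian_inner (V t) \<eta>)) + t\<^sup>2 * (norm (V t))\<^sup>2"
      using \<eta> by (simp only: norm_add_square hermitian_inner_smult_left norm_smult power_mult_distrib) simp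
    moreover have "1 - (1 + 2 * (t * (- \<kappa> * t * R)) + t\<^sup>2 * y) = t\<^sup>2 * (2 * \<kappa> * R - y)" for R y
      by (simp add: algebra_simps power2_eq_square)
    ultimately show ?thesis
      unfolding re g_def by metis
  qed
  have "\<forall>\<^sub>F t in at_right 0. g t < \<bar>g0\<bar> + 1"
    by (rule order_tendstoD[OF g0]) simp
  then have "\<forall>\<^sub>F t in at_right 0. 1 - (norm (\<eta> + of_real t *s V t))\<^sup>2 \<le> (\<bar>g0\<bar> + 1) * t\<^sup>2"
    using nz
  proof eventually_elim
    case (elim t)
    then show ?case
      using mult_right_mono[of "g t" "\<bar>g0\<bar> + 1" "t\<^sup>2"] by (simp add: eq mult.commute)
  qed
  then show thesis
    using that[of "\<bar>g0\<bar> + 1"] by (simp add: V_def)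
qed

section \<open>Rigidity from two-sided domination of the defect\<close>

definition defect_dominates ::
    "(complex ^ 'n \<Rightarrow> complex ^ 'n) \<Rightarrow> (complex ^ 'n \<Rightarrow> complex ^ 'n) \<Rightarrow> bool"
  where "defect_dominates \<phi> \<psi> \<longleftrightarrow> (\<forall>M>0. \<forall>e>0. \<exists>\<delta>>0. \<forall>z\<in>ball 0 1.
    1 - (norm (\<phi> z))\<^sup>2 \<le> M * (1 - (norm z)\<^sup>2) \<longrightarrow> 1 - (norm (\<phi> z))\<^sup>2 < \<delta> \<longrightarrow>
    cmod (hermitian_inner (\<phi> z - \<psi> z) (\<phi> z)) \<le> e * (1 - (norm (\<phi> z))\<^sup>2))"

text \<open>On the curve the defect of \<phi> is at most K t^2 and that of z at least t^2, so the
  domination hypothesis applies with M = K and its error is o(t^2).\<close>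

lemma defect_dominates_curve:
  assumes dom: "defect_dominates \<phi> \<psi>" and "0 < K"
    and ball: "\<forall>\<^sub>F t in at_right 0. z t \<in> ball 0 1 \<and> t\<^sup>2 \<le> 1 - (norm (z t))\<^sup>2"
    and a: "\<forall>\<^sub>F t in at_right 0. \<phi> (z t) = a t" and b: "\<forall>\<^sub>F t in at_right 0. \<psi> (z t) = b t"
    and K: "\<forall>\<^sub>F t in at_right 0. 1 - (norm (a t))\<^sup>2 \<le> K * t\<^sup>2"
  shows "((\<lambda>t. hermitian_inner (a t - b t) (a t) / of_real (t\<^sup>2)) \<longlongrightarrow> 0) (at_right (0 :: real))"
proof (rule tendstoI)
  fix e :: real
  assume "0 < e"
  define e' where "e' = e / (2 * K)"
  have "0 < e'"
    using \<open>0 < e\<close> \<open>0 < K\<close> by (simp add: e'_def)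
  then obtain \<delta> where \<delta>: "0 < \<delta>"
    "\<And>z. z \<in> ball 0 1 \<Longrightarrow> 1 - (norm (\<phi> z))\<^sup>2 \<le> K * (1 - (norm z)\<^sup>2) \<Longrightarrow> 1 - (norm (\<phi> z))\<^sup>2 < \<delta> \<Longrightarrow>
      cmod (hermitian_inner (\<phi> z - \<psi> z) (\<phi> z)) \<le> e' * (1 - (norm (\<phi> z))\<^sup>2)"
    using dom \<open>0 < K\<close> unfolding defect_dominates_def by meson
  have "((\<lambda>t. K * t\<^sup>2) \<longlongrightarrow> K * 0\<^sup>2) (at_right (0 :: real))"
    by (intro tendsto_intros)
  then have "\<forall>\<^sub>F t in at_right (0 :: real). K * t\<^sup>2 < \<delta>"
    using \<delta>(1) by (auto dest: order_tendstoD(2))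
  then show "\<forall>\<^sub>F t in at_right 0. dist (hermitian_inner (a t - b t) (a t) / of_real (t\<^sup>2)) 0 < e"
    using ball a b K eventually_at_right_less
  proof eventually_elim
    case (elim t)
    have "K * t\<^sup>2 \<le> K * (1 - (norm (z t))\<^sup>2)"
      using elim \<open>0 < K\<close> by (intro mult_left_mono) auto
    then have "cmod (hermitian_inner (a t - b t) (a t)) \<le> e' * (1 - (norm (a t))\<^sup>2)"
      using \<delta>(2)[of "z t"] elim by auto
    also have "\<dots> \<le> e' * (K * t\<^sup>2)"
      using elim \<open>0 < e'\<close> by (intro mult_left_mono) auto
    also have "\<dots> = e / 2 * t\<^sup>2"
      using \<open>0 < K\<close> by (simp add: e'_def)
    also have "\<dots> < e * t\<^sup>2"
      using \<open>0 < e\<close> elim by simp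
    finally show ?case
      using elim by (simp add: norm_divide norm_power divide_less_eq)
  qed
qed

lemma linear_fractional_rigidity:
  fixes \<phi> \<psi> :: "complex ^ 'n \<Rightarrow> complex ^ 'n"
  assumes "linear_fractional_self_map \<phi>" "linear_fractional_self_map \<psi>"
    and dom: "defect_dominates \<phi> \<psi>" "defect_dominates \<psi> \<phi>"
    and unbounded: "\<And>\<rho>. \<rho> < 1 \<Longrightarrow> \<exists>z\<in>ball 0 1. \<rho> < norm (\<phi> z)"
    and "z \<in> ball 0 1"
  shows "\<phi> z = \<psi> z"
proof -
  obtain A B C d where
    den: "\<And>z. z \<in> cball 0 1 \<Longrightarrow> hermitian_inner z C + d \<noteq> 0"
    and \<phi>: "\<And>z. z \<in> ball 0 1 \<Longrightarrow> \<phi> z = inverse (hermitian_inner z C + d) *s (A *v z + B)"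
    and \<phi>_ball: "\<phi> ` ball 0 1 \<subseteq> ball 0 1"
    using assms(1) unfolding linear_fractional_self_map_def
    by (elim exE conjE) (rule that, blast+)
  obtain A' B' C' d' where
    den': "\<And>z. z \<in> cball 0 1 \<Longrightarrow> hermitian_inner z C' + d' \<noteq> 0"
    and \<psi>: "\<And>z. z \<in> ball 0 1 \<Longrightarrow> \<psi> z = inverse (hermitian_inner z C' + d') *s (A' *v z + B')"
    and \<psi>_ball: "\<psi> ` ball 0 1 \<subseteq> ball 0 1"
    using assms(2) unfolding linear_fractional_self_map_def
    by (elim exE conjE) (rule that, blast+)
  \<comment> \<open>The fractional formulas extend the maps continuously to the closed ball; \<phi>
    and \<psi> themselves are unconstrained on the sphere.\<close>
  define \<Phi> where "\<Phi> = (\<lambda>z. inverse (hermitian_inner z C + d) *s (A *v z + B))"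
  define \<Psi> where "\<Psi> = (\<lambda>z. inverse (hermitian_inner z C' + d') *s (A' *v z + B'))"
  have cont: "continuous_on (cball 0 1) \<Phi>"
    unfolding \<Phi>_def continuous_on_def
    by (intro ballI tendsto_intros den)
       (auto intro!: tendsto_intros bounded_linear.tendsto[OF matrix_vector_mul_bounded_linear])
  have cont': "continuous_on (cball 0 1) \<Psi>"
    unfolding \<Psi>_def continuous_on_def
    by (intro ballI tendsto_intros den')
       (auto intro!: tendsto_intros bounded_linear.tendsto[OF matrix_vector_mul_bounded_linear])
  have le1: "norm (f z) \<le> 1" if "z \<in> cball 0 1" "continuous_on (cball 0 1) f" "f ` ball 0 1 \<subseteq> ball 0 1"
    for z and f :: "complex ^ 'n \<Rightarrow> complex ^ 'n"
  proof (rule continuous_on_closure_norm_le[where s = "ball 0 1" and f = f])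
    show "continuous_on (closure (ball 0 1)) f" "z \<in> closure (ball 0 1)"
      using that by (simp_all add: closure_ball)
    show "\<forall>y\<in>ball 0 1. norm (f y) \<le> 1"
      using that(3) by (force simp: image_subset_iff)
  qed
  have \<Phi>_ball: "\<Phi> ` ball 0 1 \<subseteq> ball 0 1" and \<Psi>_ball: "\<Psi> ` ball 0 1 \<subseteq> ball 0 1"
    using \<phi>_ball \<psi>_ball \<phi> \<psi> unfolding image_subset_iff \<Phi>_def \<Psi>_def by (metis, metis)
  \<comment> \<open>By compactness |\<Phi>| attains its maximum on the closed ball. Unboundedness
    away from 1 forces this maximum to be 1, and the self-map property forces the point onto the
    sphere: a contact point.\<close>
  have "continuous_on (cball 0 1) (\<lambda>z. norm (\<Phi> z))"
    using cont by (rule continuous_on_norm)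
  then obtain \<zeta> where \<zeta>: "\<zeta> \<in> cball 0 1" "\<And>z. z \<in> cball 0 1 \<Longrightarrow> norm (\<Phi> z) \<le> norm (\<Phi> \<zeta>)"
    using continuous_attains_sup[of "cball 0 1 :: (complex ^ 'n) set"] by (metis cball_eq_empty compact_cball less_le_not_le zero_le_one)
  define \<eta> where "\<eta> = \<Phi> \<zeta>"
  have \<eta>: "norm \<eta> = 1"
  proof (rule ccontr)
    assume "norm \<eta> \<noteq> 1"
    then have "norm \<eta> < 1"
      using le1[OF \<zeta>(1) cont \<Phi>_ball] by (simp add: \<eta>_def)
    then obtain z where "z \<in> ball 0 1" "norm \<eta> < norm (\<phi> z)"
      using unbounded by blast
    then show False
      using \<zeta>(2)[of z] \<phi>[of z] by (simp add: \<eta>_def \<Phi>_def)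
  qed
  have "\<zeta> \<notin> ball 0 1"
  proof
    assume "\<zeta> \<in> ball 0 1"
    then have "\<eta> \<in> ball 0 1"
      using \<Phi>_ball unfolding \<eta>_def by blast
    with \<eta> show False
      by simp
  qed
  with \<zeta>(1) have n\<zeta>: "norm \<zeta> = 1"
    by simp
  have hz: "hermitian_inner \<zeta> \<zeta> = 1"
    by (simp add: hermitian_inner_self n\<zeta>)
  obtain L m where L: "clinear_vec L" and m: "clinear_fun m"
    and nz: "\<And>w. \<zeta> + w \<in> cball 0 1 \<Longrightarrow> 1 + m w \<noteq> 0"
    and \<phi>_exp: "\<And>w. \<zeta> + w \<in> ball 0 1 \<Longrightarrow> \<phi> (\<zeta> + w) = \<eta> + inverse (1 + m w) *s L w"
    by (rule linear_fractional_expansion[OF den \<phi> \<zeta>(1)]) (auto simp: \<eta>_def \<Phi>_def)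
  obtain L' m' where L': "clinear_vec L'" and m': "clinear_fun m'"
    and nz': "\<And>w. \<zeta> + w \<in> cball 0 1 \<Longrightarrow> 1 + m' w \<noteq> 0"
    and \<psi>_exp: "\<And>w. \<zeta> + w \<in> ball 0 1 \<Longrightarrow> \<psi> (\<zeta> + w) = \<Psi> \<zeta> + inverse (1 + m' w) *s L' w"
    by (rule linear_fractional_expansion[OF den' \<psi> \<zeta>(1)]) (auto simp: \<Psi>_def)
  have hom: "L (c *s v) = c *s L v" "m (c *s v) = c * m v" "L' (c *s v) = c *s L' v" "m' (c *s v) = c * m' v" for c v
    using L m L' m' by (auto simp: clinear_vec_def clinear_fun_def)
  have dif: "L (x - y) = L x - L y" "m (x - y) = m x - m y" "L' (x - y) = L' x - L' y" "m' (x - y) = m' x - m' y" for x y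
    using L m L' m' by (auto simp: clinear_vec_def clinear_fun_def linear_diff)
  obtain \<kappa> :: real where \<kappa>: "\<kappa> \<noteq> 0" "\<And>w. hermitian_inner (L w) \<eta> = of_real \<kappa> * hermitian_inner w \<zeta>"
  proof (rule contact_derivative[OF L m _ _ n\<zeta> \<eta>])
    show "norm (\<eta> + inverse (1 + m w) *s L w) < 1" if "\<zeta> + w \<in> ball 0 1" for w
      using subsetD[OF \<phi>_ball imageI[OF that]] \<phi>_exp[OF that] by simp
  qed (use nz in auto)
  define a where "a = (\<lambda>w t. \<eta> + of_real t *s contact_quotient \<zeta> L m w t)"
  define b where "b = (\<lambda>w t. \<Psi> \<zeta> + of_real t *s contact_quotient \<zeta> L' m' w t)"
  let ?A = "\<lambda>w t. hermitian_inner (a w t - b w t) (a w t) / of_real (t\<^sup>2)" and ?B = "\<lambda>w t. hermitian_inner (b w t - a w t) (b w t) / of_real (t\<^sup>2)"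
  have a: "\<forall>\<^sub>F t in at_right 0. \<phi> (\<zeta> + of_real t *s contact_direction \<zeta> w t) = a w t"
    and b: "\<forall>\<^sub>F t in at_right 0. \<psi> (\<zeta> + of_real t *s contact_direction \<zeta> w t) = b w t"
    if w: "Re (hermitian_inner w \<zeta>) = 0" for w
    using contact_direction_in_ball[OF n\<zeta> w]
    by (eventually_elim, simp add: \<phi>_exp a_def contact_quotient_def hom vec_eq_iff,
        eventually_elim, simp add: \<psi>_exp b_def contact_quotient_def hom vec_eq_iff)
  have lim_a: "((\<lambda>t. ?A w t) \<longlongrightarrow> 0) (at_right (0 :: real))"
    if w: "Re (hermitian_inner w \<zeta>) = 0" for w
  proof -
    obtain K where K: "K > 0" "\<forall>\<^sub>F t in at_right 0. 1 - (norm (a w t))\<^sup>2 \<le> K * t\<^sup>2"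
      unfolding a_def using contact_defect_bound[OF L m \<kappa>(2) n\<zeta> \<eta> w] by blast
    show ?thesis
      by (rule defect_dominates_curve[OF dom(1) K(1) contact_direction_in_ball[OF n\<zeta> w] a[OF w] b[OF w] K(2)])
  qed
  \<comment> \<open>Only the estimate with defect of \<phi> is usable here. Along the radial curve w
    = 0 it gives <\<eta> - \<Psi> \<zeta>, \<eta>> = 0, and with |\<Psi> \<zeta>| \<le> 1 this is
    the equality case of Cauchy-Schwarz. From here on \<psi> has contact at the same point and its
    own estimate opens up.\<close>
  have "\<Psi> \<zeta> = \<eta>"
  proof -
    have "((\<lambda>t. hermitian_inner (a 0 t - b 0 t) (a 0 t)) \<longlongrightarrow> hermitian_inner (\<eta> - \<Psi> \<zeta>) \<eta>) (at_right 0)"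
      unfolding a_def b_def by (intro tendsto_intros tendsto_along_curve L m L' m')
    moreover have "((\<lambda>t. of_real (t\<^sup>2) * (?A 0 t)) \<longlongrightarrow> 0) (at_right 0)"
      by (rule tendsto_eq_rhs[OF tendsto_mult[OF tendsto_of_real[OF tendsto_power[OF tendsto_ident_at]] lim_a]]) simp_all
    then have "((\<lambda>t. hermitian_inner (a 0 t - b 0 t) (a 0 t)) \<longlongrightarrow> 0) (at_right 0)"
    proof (rule Lim_transform_eventually)
      show "\<forall>\<^sub>F t in at_right 0. of_real (t\<^sup>2) * (?A 0 t)
          = hermitian_inner (a 0 t - b 0 t) (a 0 t)"
        using eventually_at_right_less[of "0 :: real"] by eventually_elim simp
    qed
    ultimately have "hermitian_inner (\<eta> - \<Psi> \<zeta>) \<eta> = 0"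
      using tendsto_unique trivial_limit_at_right_real by blast
    then have 1: "hermitian_inner (\<Psi> \<zeta>) \<eta> = 1"
      by (simp add: hermitian_inner_diff_left hermitian_inner_self \<eta>)
    have "(norm (\<Psi> \<zeta> + (- \<eta>)))\<^sup>2 = (norm (\<Psi> \<zeta>))\<^sup>2 - 1"
      unfolding norm_add_square hermitian_inner_minus_left
      by (subst hermitian_inner_commute) (simp add: 1 \<eta>)
    also have "\<dots> \<le> 0"
      using le1[OF \<zeta>(1) cont' \<Psi>_ball] by (simp add: power_le_one)
    finally show ?thesis
      by simp
  qed
  obtain \<kappa>' :: real where \<kappa>': "\<kappa>' \<noteq> 0" "\<And>w. hermitian_inner (L' w) \<eta> = of_real \<kappa>' * hermitian_inner w \<zeta>"
  proof (rule contact_derivative[OF L' m' _ _ n\<zeta> \<eta>])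
    show "norm (\<eta> + inverse (1 + m' w) *s L' w) < 1" if "\<zeta> + w \<in> ball 0 1" for w
      using subsetD[OF \<psi>_ball imageI[OF that]] \<psi>_exp[OF that] \<open>\<Psi> \<zeta> = \<eta>\<close> by simp
  qed (use nz' in auto)
  have lim_b: "((\<lambda>t. ?B w t) \<longlongrightarrow> 0) (at_right (0 :: real))"
    if w: "Re (hermitian_inner w \<zeta>) = 0" for w
  proof -
    obtain K where K: "K > 0" "\<forall>\<^sub>F t in at_right 0. 1 - (norm (b w t))\<^sup>2 \<le> K * t\<^sup>2"
      unfolding b_def using contact_defect_bound[OF L' m' \<kappa>'(2) n\<zeta> \<eta> w] \<open>\<Psi> \<zeta> = \<eta>\<close> by auto
    show ?thesis
      by (rule defect_dominates_curve[OF dom(2) K(1) contact_direction_in_ball[OF n\<zeta> w] b[OF w] a[OF w] K(2)])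
  qed
  \<comment> \<open>The two pairings add up to |a - b|^2, and division by t^2 turns this into |u|^2,
    where u tends to L w - L' w.\<close>
  have L_eq: "L w = L' w" if w: "Re (hermitian_inner w \<zeta>) = 0" for w
  proof -
    define u where "u = (\<lambda>t. contact_quotient \<zeta> L m w t - contact_quotient \<zeta> L' m' w t)"
    have ab: "a w t - b w t = of_real t *s u t" for t
      by (simp add: a_def b_def u_def \<open>\<Psi> \<zeta> = \<eta>\<close> smult_diff_right)
    have "((\<lambda>t. ?A w t + ?B w t)
        \<longlongrightarrow> 0 + 0) (at_right 0)"
      by (intro tendsto_add lim_a lim_b w)
    moreover have "?A w t + ?B w t
        = hermitian_inner (u t) (u t)" if "0 < t" for t
    proof -
      have "hermitian_inner (a w t - b w t) (a w t) + hermitian_inner (b w t - a w t) (b w t)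
          = hermitian_inner (a w t - b w t) (a w t - b w t)"
        by (simp add: hermitian_inner_diff_left hermitian_inner_diff_right)
      also have "\<dots> = of_real (t\<^sup>2) * hermitian_inner (u t) (u t)"
        by (simp add: ab hermitian_inner_smult_left hermitian_inner_smult_right power2_eq_square)
      finally show ?thesis
        using that by (simp flip: add_divide_distrib)
    qed
    then have "\<forall>\<^sub>F t in at_right 0. ?A w t + ?B w t
        = hermitian_inner (u t) (u t)"
      using eventually_at_right_less[of "0 :: real"] by (rule eventually_mono[rotated])
    ultimately have "((\<lambda>t. hermitian_inner (u t) (u t)) \<longlongrightarrow> 0) (at_right 0)"
      by (simp add: tendsto_cong)
    moreover have "((\<lambda>t. hermitian_inner (u t) (u t)) \<longlongrightarrow> hermitian_inner (L w - L' w) (L w - L' w)) (at_right 0)"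
      unfolding u_def by (intro tendsto_intros tendsto_contact_quotient L m L' m')
    ultimately have "hermitian_inner (L w - L' w) (L w - L' w) = 0"
      using tendsto_unique trivial_limit_at_right_real by blast
    then show ?thesis
      by (simp add: hermitian_inner_self)
  qed
  \<comment> \<open>The component orthogonal to \<zeta> and the vector
    \<open>\<i> *s \<zeta>\<close> are both real-tangent, so agreement on real-tangent vectors
    propagates to all w by complex linearity.\<close>
  have decomp: "w = (w - hermitian_inner w \<zeta> *s \<zeta>) - (- (hermitian_inner w \<zeta> / \<i>)) *s (\<i> *s \<zeta>)" for w
    by (simp add: vec_eq_iff algebra_simps)
  have perp: "hermitian_inner (w - hermitian_inner w \<zeta> *s \<zeta>) \<zeta> = 0" for w
    by (simp add: hermitian_inner_diff_left hermitian_inner_smult_left hz)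
  have LL: "L w = L' w" for w
  proof -
    let ?p = "w - hermitian_inner w \<zeta> *s \<zeta>" and ?c = "- (hermitian_inner w \<zeta> / \<i>)"
    have "L ?p - ?c *s L (\<i> *s \<zeta>) = L' ?p - ?c *s L' (\<i> *s \<zeta>)"
      using L_eq[of ?p] L_eq[of "\<i> *s \<zeta>"] by (simp only: perp hermitian_inner_smult_left hz) simp
    then show ?thesis
      by (simp only: dif(1,3)[of ?p "?c *s (\<i> *s \<zeta>)", symmetric] hom(1,3)[of ?c, symmetric] decomp[symmetric])
  qed
  \<comment> \<open>Once the linear parts agree, a - b is of order t^2 with leading coefficient (m'
    w - m w) L w. Pairing with \<eta> yields (m' w - m w) \<kappa> <w,\<zeta>>, which identifies m
    only where <w,\<zeta>> is nonzero.\<close>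
  have m_eq: "m w = m' w" if w: "Re (hermitian_inner w \<zeta>) = 0" "hermitian_inner w \<zeta> \<noteq> 0" for w
  proof -
    let ?Q = "(m' w - m w) * inverse ((1 + of_real 0 * m w) * (1 + of_real 0 * m' w)) * hermitian_inner (L w) \<eta>"
    define W where "W = contact_direction \<zeta> w"
    define q where "q = (\<lambda>t. (m' (W t) - m (W t)) * inverse ((1 + of_real t * m (W t)) * (1 + of_real t * m' (W t))))"
    have Wlim: "(W \<longlongrightarrow> w) (at_right 0)"
      unfolding W_def by (rule tendsto_contact_direction)
    have mlim: "((\<lambda>t. m (W t)) \<longlongrightarrow> m w) (at_right 0)" "((\<lambda>t. m' (W t)) \<longlongrightarrow> m' w) (at_right 0)"
      by (intro tendsto_clinear_fun[OF m] tendsto_clinear_fun[OF m'] Wlim)+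
    have "((\<lambda>t. q t * hermitian_inner (L (W t)) (a w t)) \<longlongrightarrow>
        ?Q) (at_right 0)"
      unfolding q_def a_def
      by (intro tendsto_intros mlim tendsto_along_curve L m tendsto_clinear_vec[OF L] Wlim) auto
    moreover have ev: "\<forall>\<^sub>F t in at_right 0. ?A w t
        = q t * hermitian_inner (L (W t)) (a w t)"
      using contact_direction_in_ball[OF n\<zeta> w(1)] eventually_at_right_less[of "0 :: real"]
    proof eventually_elim
      case (elim t)
      have nz1: "1 + of_real t * m (W t) \<noteq> 0" "1 + of_real t * m' (W t) \<noteq> 0"
        using elim nz[of "of_real t *s W t"] nz'[of "of_real t *s W t"] by (auto simp: hom W_def)
      have "a w t - b w t = (of_real t * (inverse (1 + of_real t * m (W t)) - inverse (1 + of_real t * m' (W t)))) *s L (W t)"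
        by (simp add: a_def b_def \<open>\<Psi> \<zeta> = \<eta>\<close> contact_quotient_def W_def LL vec_eq_iff algebra_simps)
      also have "of_real t * (inverse (1 + of_real t * m (W t)) - inverse (1 + of_real t * m' (W t))) = of_real (t\<^sup>2) * q t"
        using nz1 by (simp add: q_def divide_simps power2_eq_square) (simp add: algebra_simps)
      finally show ?case
        using elim by (simp add: hermitian_inner_smult_left)
    qed
    ultimately have "((\<lambda>t. ?A w t) \<longlongrightarrow>
        ?Q) (at_right 0)"
      by (subst tendsto_cong[OF ev])
    then have "?Q = 0"
      using tendsto_unique trivial_limit_at_right_real lim_a[OF w(1)] by blast
    then show ?thesis
      using w \<kappa> by simp
  qed
  have mi: "m (\<i> *s \<zeta>) = m' (\<i> *s \<zeta>)"
    by (rule m_eq) (simp_all add: hermitian_inner_smult_left hz)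
  \<comment> \<open>The component ?p is orthogonal to \<zeta>, where \<open>m_eq\<close> says
    nothing. Adding \<open>\<i> *s \<zeta>\<close> keeps it real-tangent and makes the inner product
    nonzero; the added term is then removed by \<open>mi\<close>.\<close>
  have mm: "m w = m' w" for w
  proof -
    let ?p = "w - hermitian_inner w \<zeta> *s \<zeta>" and ?c = "- (hermitian_inner w \<zeta> / \<i>)"
    have "m (?p - (- 1) *s (\<i> *s \<zeta>)) = m' (?p - (- 1) *s (\<i> *s \<zeta>))"
      by (rule m_eq) (simp_all only: hermitian_inner_diff_left[of ?p] perp hermitian_inner_smult_left hz, simp_all)
    then have "m ?p = m' ?p"
      using mi by (simp only: dif(2,4)[of ?p] hom(2,4)[of "- 1"]) simp
    then have "m ?p - ?c * m (\<i> *s \<zeta>) = m' ?p - ?c * m' (\<i> *s \<zeta>)"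
      using mi by simp
    then show ?thesis
      by (simp only: dif(2,4)[of ?p "?c *s (\<i> *s \<zeta>)", symmetric] hom(2,4)[of ?c, symmetric] decomp[symmetric])
  qed
  show ?thesis
    using \<phi>_exp[of "z - \<zeta>"] \<psi>_exp[of "z - \<zeta>"] \<open>z \<in> ball 0 1\<close> by (simp add: LL mm \<open>\<Psi> \<zeta> = \<eta>\<close>)
qed

section \<open>Compact differences\<close>

text \<open>Recentred at z itself the map is \<phi> z + L w / (1 + m w); since L and m vanish at 0,
  the derivative is L.\<close>

lemma linear_fractional_has_derivative:
  fixes \<phi> :: "complex ^ 'n \<Rightarrow> complex ^ 'n"
  assumes "linear_fractional_self_map \<phi>" and z: "z \<in> ball 0 1"
  obtains L where "(\<phi> has_derivative L) (at z)" "clinear_vec L"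
proof -
  obtain A B C d where
    den: "\<And>z. z \<in> cball 0 1 \<Longrightarrow> hermitian_inner z C + d \<noteq> 0"
    and \<phi>: "\<And>z. z \<in> ball 0 1 \<Longrightarrow> \<phi> z = inverse (hermitian_inner z C + d) *s (A *v z + B)"
    using assms(1) unfolding linear_fractional_self_map_def
    by (elim exE conjE) (rule that, blast+)
  obtain L m where L: "clinear_vec L" and m: "clinear_fun m"
    and nz: "\<And>w. z + w \<in> cball 0 1 \<Longrightarrow> 1 + m w \<noteq> 0"
    and exp: "\<And>w. z + w \<in> ball 0 1 \<Longrightarrow> \<phi> (z + w) = inverse (hermitian_inner z C + d) *s (A *v z + B) + inverse (1 + m w) *s L w"
    using linear_fractional_expansion[OF den \<phi>, of z] z by auto
  define \<Phi> where "\<Phi> = (\<lambda>u. \<phi> z + inverse (1 + m (u - z)) *s L (u - z))"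
  have bl: "bounded_linear L" "bounded_linear m"
    using L m by (simp_all add: clinear_vec_def clinear_fun_def linear_conv_bounded_linear)
  have L0: "L 0 = 0" "m 0 = 0"
    using bl by (simp_all add: linear_simps)
  have "((\<lambda>u. u - z) has_derivative (\<lambda>h. h)) (at z)"
    by (auto intro!: derivative_eq_intros)
  then have "((\<lambda>u. m (u - z)) has_derivative m) (at z)" "((\<lambda>u. L (u - z)) has_derivative L) (at z)"
    by (rule bounded_linear.has_derivative[OF bl(2)], rule bounded_linear.has_derivative[OF bl(1)])
  note mL = this
  have "((\<lambda>u. 1 + m (u - z)) has_derivative (\<lambda>h. 0 + m h)) (at z)"
    by (rule has_derivative_add[OF has_derivative_const mL(1)])
  from Deriv.has_derivative_inverse[OF _ this]
  have "((\<lambda>u. inverse (1 + m (u - z))) has_derivative (\<lambda>h. - (inverse (1 + m (z - z)) * (0 + m h) * inverse (1 + m (z - z))))) (at z)"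
    by (simp add: L0)
  from bounded_bilinear.FDERIV[OF bounded_bilinear_smult this mL(2)]
  have "((\<lambda>u. inverse (1 + m (u - z)) *s L (u - z)) has_derivative
      (\<lambda>h. inverse (1 + m (z - z)) *s L h + (- (inverse (1 + m (z - z)) * (0 + m h) * inverse (1 + m (z - z)))) *s L (z - z))) (at z)"
    .
  from has_derivative_add[OF has_derivative_const this]
  have "(\<Phi> has_derivative L) (at z)"
    unfolding \<Phi>_def by (simp add: L0)
  then have "(\<Phi> has_derivative L) (at z within ball 0 1)"
    by (rule has_derivative_at_withinI)
  then have "(\<phi> has_derivative L) (at z within ball 0 1)"
  proof (rule has_derivative_transform[OF z, rotated])
    show "\<phi> u = \<Phi> u" if "u \<in> ball 0 1" for u
      using exp[of "u - z"] exp[of 0] z that by (simp add: \<Phi>_def L0)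
  qed
  then have "(\<phi> has_derivative L) (at z)"
    unfolding at_within_open[OF z open_ball] .
  then show thesis
    using L that by blast
qed

text \<open>The radius \<open>R\<close> is free because Montel limits are holomorphic only on a
  smaller ball that contains the image of \<phi>.\<close>

lemma holomorphic_sv_on_compose_linear_fractional:
  assumes \<phi>: "linear_fractional_self_map \<phi>" and f: "holomorphic_sv_on f (ball 0 R)"
    and im: "\<phi> ` ball 0 1 \<subseteq> ball 0 R"
  shows "holomorphic_sv_on (f \<circ> \<phi>) (ball 0 1)"
  unfolding holomorphic_sv_on_def
proof
  fix z :: "complex ^ 'a"
  assume z: "z \<in> ball 0 1"
  obtain L where L: "(\<phi> has_derivative L) (at z)" "clinear_vec L"
    using linear_fractional_has_derivative[OF \<phi> z] .
  have "\<phi> z \<in> ball 0 R"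
    using im z by blast
  then obtain D where D: "(f has_derivative D) (at (\<phi> z))" "\<forall>c v. D (c *s v) = c * D v"
    using f unfolding holomorphic_sv_on_def by (metis at_within_open open_ball)
  have "((f \<circ> \<phi>) has_derivative (D \<circ> L)) (at z within ball 0 1)"
    using diff_chain_at[OF L(1) D(1)] by (rule has_derivative_at_withinI)
  then show "\<exists>D. ((f \<circ> \<phi>) has_derivative D) (at z within ball 0 1) \<and> (\<forall>c v. D (c *s v) = c * D v)"
    using D(2) L(2) by (intro exI[of _ "D \<circ> L"]) (simp add: clinear_vec_def)
qed

text \<open>
  Large integer powers replace the reproducing kernel, so that only upper bounds for the norms of
  the test functions are needed.
\<close>

definition kernel_power :: "real \<Rightarrow> nat \<Rightarrow> complex ^ 'n \<Rightarrow> complex ^ 'n \<Rightarrow> complex"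
  where "kernel_power \<gamma> q a z =
    of_real ((1 - (norm a)\<^sup>2) powr (real q - \<gamma> / 2)) * inverse ((1 - hermitian_inner z a) ^ q)"

lemma one_minus_hermitian_inner_ge:
  assumes "norm z \<le> 1"
  shows "1 - norm a \<le> cmod (1 - hermitian_inner z a)"
proof -
  have "cmod (hermitian_inner z a) \<le> 1 * norm a"
    using norm_hermitian_inner_le[of z a] mult_right_mono[OF assms norm_ge_zero[of a]] by linarith
  then show ?thesis
    using norm_triangle_ineq2[of 1 "hermitian_inner z a"] by simp
qed

lemma one_minus_hermitian_inner_nz:
  assumes "norm z < 1" "norm a < 1"
  shows "1 - hermitian_inner z a \<noteq> 0"
  using one_minus_hermitian_inner_ge[of z a] assms by auto

lemma holomorphic_kernel_power:
  assumes "norm a < 1"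
  shows "holomorphic_sv_on (kernel_power \<gamma> q a) (ball 0 1)"
proof -
  have lin: "holomorphic_sv_on (\<lambda>z. hermitian_inner z a) (ball 0 1)"
    unfolding holomorphic_sv_on_def
    by (intro ballI exI[of _ "\<lambda>v. hermitian_inner v a"] conjI
        bounded_linear.has_derivative[OF bounded_linear_hermitian_inner_left has_derivative_ident])
       (simp add: hermitian_inner_smult_left)
  define h where "h = (\<lambda>u. of_real ((1 - (norm a)\<^sup>2) powr (real q - \<gamma> / 2)) * inverse ((1 - u) ^ q) :: complex)"
  have h: "h holomorphic_on - {1}"
    unfolding h_def by (intro holomorphic_intros) auto
  have "holomorphic_sv_on (\<lambda>z. h (hermitian_inner z a)) (ball 0 1)"
  proof (rule holomorphic_sv_on_field_compose[OF lin])
    fix z :: "complex ^ 'a"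
    assume "z \<in> ball 0 1"
    then have "hermitian_inner z a \<in> - {1}"
      using one_minus_hermitian_inner_nz[of z a] assms by auto
    then show "(h has_field_derivative deriv h (hermitian_inner z a)) (at (hermitian_inner z a))"
      using h by (intro holomorphic_derivI[of h "- {1}"]) auto
  qed
  then show ?thesis
    by (simp add: h_def kernel_power_def[abs_def])
qed

lemma norm_kernel_power:
  "cmod (kernel_power \<gamma> q a z) =
    (1 - (norm a)\<^sup>2) powr (real q - \<gamma> / 2) * inverse (cmod (1 - hermitian_inner z a) ^ q)"
  by (simp only: kernel_power_def norm_mult norm_inverse norm_power norm_of_real abs_of_nonneg[OF powr_ge_zero])

text \<open>The denominator is bounded through z instead of a, so for fixed z and q > \<gamma>/2 the
  bound tends to 0 as |a| tends to 1. This pointwise decay replaces weak convergence of normalized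
  kernels.\<close>

lemma norm_kernel_power_le:
  assumes "norm a < 1" "norm z < 1"
  shows "cmod (kernel_power \<gamma> q a z) \<le> (1 - (norm a)\<^sup>2) powr (real q - \<gamma> / 2) / (1 - norm z) ^ q"
proof -
  have "1 - norm z \<le> cmod (1 - hermitian_inner a z)"
    using assms by (intro one_minus_hermitian_inner_ge) simp
  also have "1 - hermitian_inner a z = cnj (1 - hermitian_inner z a)"
    by (subst hermitian_inner_commute) simp
  finally have "1 - norm z \<le> cmod (1 - hermitian_inner z a)"
    unfolding complex_mod_cnj .
  then have "inverse (cmod (1 - hermitian_inner z a) ^ q) \<le> inverse ((1 - norm z) ^ q)"
    using assms by (intro le_imp_inverse_le power_mono zero_less_power) auto
  then have "(1 - (norm a)\<^sup>2) powr (real q - \<gamma> / 2) * inverse (cmod (1 - hermitian_inner z a) ^ q)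
      \<le> (1 - (norm a)\<^sup>2) powr (real q - \<gamma> / 2) * inverse ((1 - norm z) ^ q)"
    by (rule mult_left_mono) simp
  then show ?thesis
    by (simp only: norm_kernel_power divide_inverse)
qed

text \<open>
  The properties of the Hardy and Bergman spaces that the argument uses. The exponent \<open>\<gamma>\<close>
  is sharp in both \<open>eval\<close> and \<open>kernel\<close>; this match is what turns compactness into a
  condition on \<open>(1 - |\<phi> z|\<^sup>2) / (1 - |z|\<^sup>2)\<close>.
\<close>

locale kernel_space =
  fixes H :: "(complex ^ 'n \<Rightarrow> complex) set" and nrm :: "(complex ^ 'n \<Rightarrow> complex) \<Rightarrow> real" and \<gamma> :: real
  assumes \<gamma>_nonneg: "0 \<le> \<gamma>"
    and hol: "f \<in> H \<Longrightarrow> holomorphic_sv_on f (ball 0 1)"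
    and diff_mem: "f \<in> H \<Longrightarrow> g \<in> H \<Longrightarrow> (\<lambda>z. f z - g z) \<in> H"
    and nrm_nonneg: "0 \<le> nrm f"
    and nrm_diff: "f \<in> H \<Longrightarrow> g \<in> H \<Longrightarrow> (nrm (\<lambda>z. f z - g z))\<^sup>2 \<le> 2 * (nrm f)\<^sup>2 + 2 * (nrm g)\<^sup>2"
    and eval: "\<exists>C. \<forall>f\<in>H. \<forall>z\<in>ball 0 1. cmod (f z) \<le> C * nrm f * (1 - (norm z)\<^sup>2) powr (- \<gamma> / 2)"
    and bounded: "\<exists>C. \<forall>f B. holomorphic_sv_on f (ball 0 1) \<longrightarrow> (\<forall>z\<in>ball 0 1. cmod (f z) \<le> B) \<longrightarrow> f \<in> H \<and> nrm f \<le> C * B"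
    and kernel: "\<exists>p. \<forall>q\<ge>p. \<exists>C. \<forall>a\<in>ball 0 1. nrm (kernel_power \<gamma> q a) \<le> C"
begin

section \<open>Compactness in an abstract kernel space\<close>

abbreviation composition_diff :: "(complex ^ 'n \<Rightarrow> complex ^ 'n) \<Rightarrow> (complex ^ 'n \<Rightarrow> complex ^ 'n) \<Rightarrow>
    (complex ^ 'n \<Rightarrow> complex) \<Rightarrow> complex ^ 'n \<Rightarrow> complex"
  where "composition_diff \<phi> \<psi> \<equiv> \<lambda>f z. composition_operator \<phi> f z - composition_operator \<psi> f z"

lemma eval_obtain:
  obtains C where "0 \<le> C" "\<And>f z. f \<in> H \<Longrightarrow> z \<in> ball 0 1 \<Longrightarrow> cmod (f z) \<le> C * nrm f * (1 - (norm z)\<^sup>2) powr (- \<gamma> / 2)"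
proof -
  obtain C where C: "\<And>f z. f \<in> H \<Longrightarrow> z \<in> ball 0 1 \<Longrightarrow> cmod (f z) \<le> C * nrm f * (1 - (norm z)\<^sup>2) powr (- \<gamma> / 2)"
    using eval by blast
  have "cmod (f z) \<le> max 0 C * nrm f * (1 - (norm z)\<^sup>2) powr (- \<gamma> / 2)" if "f \<in> H" "z \<in> ball 0 1" for f z
  proof -
    note C[OF that]
    also have "C * nrm f * (1 - (norm z)\<^sup>2) powr (- \<gamma> / 2) \<le> max 0 C * nrm f * (1 - (norm z)\<^sup>2) powr (- \<gamma> / 2)"
      by (intro mult_right_mono nrm_nonneg) auto
    finally show ?thesis .
  qed
  then show thesis
    using that[of "max 0 C"] by simp
qed

lemma bounded_mem:
  assumes "holomorphic_sv_on f (ball 0 1)" "\<And>z. z \<in> ball 0 1 \<Longrightarrow> cmod (f z) \<le> B"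
  shows "f \<in> H"
  using bounded assms by blast

lemma kernel_power_mem: "norm a < 1 \<Longrightarrow> kernel_power \<gamma> q a \<in> H"
proof (rule bounded_mem[OF holomorphic_kernel_power])
  assume a: "norm a < 1"
  fix z :: "complex ^ 'n"
  assume z: "z \<in> ball 0 1"
  have "inverse (cmod (1 - hermitian_inner z a) ^ q) \<le> inverse ((1 - norm a) ^ q)"
    using a z by (intro le_imp_inverse_le power_mono zero_less_power one_minus_hermitian_inner_ge) auto
  then show "cmod (kernel_power \<gamma> q a z) \<le> (1 - (norm a)\<^sup>2) powr (real q - \<gamma> / 2) * inverse ((1 - norm a) ^ q)"
    unfolding norm_kernel_power by (rule mult_left_mono) simp
qed

text \<open>The axiom \<open>bounded\<close> with B = 0. Elements are total functions, so vanishing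
  on the ball is the right notion of being zero.\<close>

lemma nrm_zero_on_ball:
  assumes "\<And>z. z \<in> ball 0 1 \<Longrightarrow> f z = 0"
  shows "f \<in> H" "nrm f = 0"
proof -
  have "holomorphic_sv_on f (ball 0 1)"
    using holomorphic_sv_on_cong[OF holomorphic_sv_on_const[of 0]] assms by metis
  then have "f \<in> H \<and> nrm f \<le> C * 0" if "\<forall>f B. holomorphic_sv_on f (ball 0 1) \<longrightarrow> (\<forall>z\<in>ball 0 1. cmod (f z) \<le> B) \<longrightarrow> f \<in> H \<and> nrm f \<le> C * B" for C
    using that assms by (metis norm_zero order_refl)
  then have "f \<in> H \<and> nrm f \<le> 0"
    using bounded by auto
  then show "f \<in> H" "nrm f = 0"
    using nrm_nonneg[of f] by auto
qed

text \<open>Maps that agree on the ball may differ outside it, so the operator need not vanish as a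
  map of total functions; its images are null for the norm.\<close>

lemma compact_zero_on_ball:
  assumes "\<And>z. z \<in> ball 0 1 \<Longrightarrow> \<phi> z = \<psi> z"
  shows "compact_operator_on H nrm (composition_diff \<phi> \<psi>)"
  unfolding compact_operator_on_def
proof (intro conjI ballI allI impI)
  have zero: "composition_operator \<phi> f z - composition_operator \<psi> f z = 0" if "z \<in> ball 0 1" for f :: "complex ^ 'n \<Rightarrow> complex" and z
    using assms[OF that] by (simp add: composition_operator_def)
  show "(composition_diff \<phi> \<psi>) ` H \<subseteq> H"
    by (auto intro!: nrm_zero_on_ball(1) simp: zero)
  fix F :: "nat \<Rightarrow> complex ^ 'n \<Rightarrow> complex"
  have "nrm (\<lambda>z. composition_operator \<phi> (F n) z - composition_operator \<psi> (F n) z - 0) = 0" for n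
    by (rule nrm_zero_on_ball) (simp add: zero)
  then show "\<exists>r. \<exists>g\<in>H. strict_mono r \<and>
      (\<lambda>n. nrm (\<lambda>z. composition_operator \<phi> (F (r n)) z - composition_operator \<psi> (F (r n)) z - g z)) \<longlonglongrightarrow> 0"
    by (intro exI[of _ id] bexI[of _ "\<lambda>z. 0"]) (auto simp: strict_mono_def nrm_zero_on_ball)
qed (auto simp: composition_operator_def algebra_simps)

text \<open>A subsequence for S is refined to one for T. The quadratic inequality
  \<open>nrm_diff\<close> replaces the triangle inequality, which is enough when both terms tend to
  0.\<close>

lemma compact_diff:
  assumes S: "compact_operator_on H nrm S" and T: "compact_operator_on H nrm T"
  shows "compact_operator_on H nrm (\<lambda>f z. S f z - T f z)"
  unfolding compact_operator_on_def
proof (intro conjI ballI allI impI)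
  have SH: "\<And>f. f \<in> H \<Longrightarrow> S f \<in> H" and TH: "\<And>f. f \<in> H \<Longrightarrow> T f \<in> H"
    using S T unfolding compact_operator_on_def by auto
  show "(\<lambda>f z. S f z - T f z) ` H \<subseteq> H"
    using SH TH diff_mem by auto
  show "(\<lambda>z. S (\<lambda>z. a * f z + b * g z) z - T (\<lambda>z. a * f z + b * g z) z)
      = (\<lambda>z. a * (S f z - T f z) + b * (S g z - T g z))" if "f \<in> H" "g \<in> H" for f g a b
  proof -
    have "S (\<lambda>z. a * f z + b * g z) = (\<lambda>z. a * S f z + b * S g z)"
      "T (\<lambda>z. a * f z + b * g z) = (\<lambda>z. a * T f z + b * T g z)"
      using S T that unfolding compact_operator_on_def by blast+
    then show ?thesis
      by (simp add: fun_eq_iff algebra_simps)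
  qed
  fix F :: "nat \<Rightarrow> complex ^ 'n \<Rightarrow> complex"
  assume F: "(\<forall>n. F n \<in> H) \<and> (\<exists>M. \<forall>n. nrm (F n) \<le> M)"
  then obtain r1 g1 where r1: "strict_mono r1" "g1 \<in> H" "(\<lambda>n. nrm (\<lambda>z. S (F (r1 n)) z - g1 z)) \<longlonglongrightarrow> 0"
    using S unfolding compact_operator_on_def by blast
  have "(\<forall>n. (F \<circ> r1) n \<in> H) \<and> (\<exists>M. \<forall>n. nrm ((F \<circ> r1) n) \<le> M)"
    using F by auto
  then obtain r2 g2 where r2: "strict_mono r2" "g2 \<in> H" "(\<lambda>n. nrm (\<lambda>z. T ((F \<circ> r1) (r2 n)) z - g2 z)) \<longlonglongrightarrow> 0"
    using T unfolding compact_operator_on_def by blast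
  define u where "u = (\<lambda>n z. S (F (r1 (r2 n))) z - g1 z)"
  define v where "v = (\<lambda>n z. T (F (r1 (r2 n))) z - g2 z)"
  have u: "(\<lambda>n. nrm (u n)) \<longlonglongrightarrow> 0"
    using LIMSEQ_subseq_LIMSEQ[OF r1(3) r2(1)] by (simp add: u_def o_def)
  have v: "(\<lambda>n. nrm (v n)) \<longlonglongrightarrow> 0"
    using r2(3) by (simp add: v_def o_def)
  have uv: "u n \<in> H" "v n \<in> H" for n
    using F r1(2) r2(2) SH TH diff_mem unfolding u_def v_def by auto
  have "(\<lambda>n. 2 * (nrm (u n))\<^sup>2 + 2 * (nrm (v n))\<^sup>2) \<longlonglongrightarrow> 2 * 0\<^sup>2 + 2 * 0\<^sup>2"
    by (intro tendsto_intros u v)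
  then have lim: "(\<lambda>n. 2 * (nrm (u n))\<^sup>2 + 2 * (nrm (v n))\<^sup>2) \<longlonglongrightarrow> 0"
    by simp
  have "(\<lambda>n. (nrm (\<lambda>z. u n z - v n z))\<^sup>2) \<longlonglongrightarrow> 0"
    by (rule tendsto_sandwich[OF _ _ tendsto_const lim])
       (intro always_eventually allI zero_le_power2 nrm_diff uv)+
  then have "(\<lambda>n. sqrt ((nrm (\<lambda>z. u n z - v n z))\<^sup>2)) \<longlonglongrightarrow> sqrt 0"
    by (rule tendsto_real_sqrt)
  then have "(\<lambda>n. nrm (\<lambda>z. u n z - v n z)) \<longlonglongrightarrow> 0"
    using nrm_nonneg by simp
  moreover have "(\<lambda>z. u n z - v n z) = (\<lambda>z. S (F ((r1 \<circ> r2) n)) z - T (F ((r1 \<circ> r2) n)) z - (g1 z - g2 z))" for n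
    by (simp add: u_def v_def fun_eq_iff algebra_simps)
  ultimately show "\<exists>r. \<exists>g\<in>H. strict_mono r \<and> (\<lambda>n. nrm (\<lambda>z. S (F (r n)) z - T (F (r n)) z - g z)) \<longlonglongrightarrow> 0"
    using r1 r2 diff_mem
    by (intro exI[of _ "r1 \<circ> r2"] bexI[of _ "\<lambda>z. g1 z - g2 z"]) (auto intro: strict_mono_o)
qed

text \<open>Composition with \<phi> sees f only on a smaller ball. For \<rho> < r < R < 1, point
  evaluation bounds a norm-bounded sequence on radius R, Montel gives uniform convergence on radius
  r, which contains the image, and the compositions then converge uniformly on the unit ball, hence
  in norm by \<open>bounded\<close>.\<close>

lemma compact_composition_bounded_away:
  fixes \<phi> :: "complex ^ 'n \<Rightarrow> complex ^ 'n"
  assumes \<phi>: "linear_fractional_self_map \<phi>" and \<rho>: "\<rho> < 1" "\<And>z. z \<in> ball 0 1 \<Longrightarrow> norm (\<phi> z) \<le> \<rho>"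
  shows "compact_operator_on H nrm (composition_operator \<phi>)"
  unfolding compact_operator_on_def
proof (intro conjI ballI allI impI)
  define r where "r = (1 + \<rho>) / 2"
  define R where "R = (1 + r) / 2"
  have \<rho>0: "0 \<le> \<rho>"
    using \<rho>(2)[of 0] norm_ge_zero[of "\<phi> 0"] by (simp del: norm_ge_zero)
  have r: "\<rho> < r" "r < R" "R < 1" "0 < r"
    using \<rho>(1) \<rho>0 by (auto simp: r_def R_def)
  have im: "\<phi> ` ball 0 1 \<subseteq> ball 0 r"
    using \<rho> r by (force simp: image_subset_iff)
  obtain C where C: "0 \<le> C" "\<And>f z. f \<in> H \<Longrightarrow> z \<in> ball 0 1 \<Longrightarrow> cmod (f z) \<le> C * nrm f * (1 - (norm z)\<^sup>2) powr (- \<gamma> / 2)"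
    using eval_obtain by blast
  define K where "K = C * (1 - R\<^sup>2) powr (- \<gamma> / 2)"
  have R2: "R\<^sup>2 < 1"
    using r by (simp add: power_less_one_iff)
  have bd: "cmod (f z) \<le> K * nrm f" if "f \<in> H" "z \<in> ball 0 R" for f z
  proof -
    have "(norm z)\<^sup>2 \<le> R\<^sup>2"
      using that by (intro power_mono) auto
    then have "(1 - (norm z)\<^sup>2) powr (- \<gamma> / 2) \<le> (1 - R\<^sup>2) powr (- \<gamma> / 2)"
      using R2 \<gamma>_nonneg by (intro powr_mono2') auto
    have "cmod (f z) \<le> C * nrm f * (1 - (norm z)\<^sup>2) powr (- \<gamma> / 2)"
      using that r by (intro C(2)) auto
    also have "\<dots> \<le> C * nrm f * (1 - R\<^sup>2) powr (- \<gamma> / 2)"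
      by (intro mult_left_mono) (use \<open>_ \<le> (1 - R\<^sup>2) powr _\<close> C(1) nrm_nonneg in auto)
    finally show ?thesis
      by (simp add: K_def mult_ac)
  qed
  have comp_hol: "holomorphic_sv_on (f \<circ> \<phi>) (ball 0 1)" if "holomorphic_sv_on f (ball 0 r)" for f
    by (rule holomorphic_sv_on_compose_linear_fractional[OF \<phi> that im])
  show "composition_operator \<phi> ` H \<subseteq> H"
  proof clarsimp
    fix f
    assume f: "f \<in> H"
    show "composition_operator \<phi> f \<in> H"
      unfolding composition_operator_def
    proof (rule bounded_mem[where B = "K * nrm f"])
      show "holomorphic_sv_on (f \<circ> \<phi>) (ball 0 1)"
        by (intro comp_hol holomorphic_sv_on_subset[OF hol[OF f]]) (use r in auto)
      show "cmod ((f \<circ> \<phi>) z) \<le> K * nrm f" if "z \<in> ball 0 1" for z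
        using bd[OF f, of "\<phi> z"] im that r by (force simp: image_subset_iff)
    qed
  qed
  fix F :: "nat \<Rightarrow> complex ^ 'n \<Rightarrow> complex"
  assume "(\<forall>n. F n \<in> H) \<and> (\<exists>M. \<forall>n. nrm (F n) \<le> M)"
  then obtain M where F: "\<And>n. F n \<in> H" and M: "\<And>n. nrm (F n) \<le> M"
    by blast
  have K0: "0 \<le> K"
    using C(1) by (simp add: K_def)
  obtain g k where k: "strict_mono (k :: nat \<Rightarrow> nat)" and g: "holomorphic_sv_on g (ball 0 r)"
    and lim: "\<And>e. 0 < e \<Longrightarrow> \<exists>N. \<forall>n\<ge>N. \<forall>z\<in>ball 0 r. cmod (F (k n) z - g z) < e"
  proof (rule montel_sv[of F R "K * M" r])
    show "holomorphic_sv_on (F n) (ball 0 R)" for n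
      by (rule holomorphic_sv_on_subset[OF hol[OF F]]) (use r in auto)
    show "cmod (F n z) \<le> K * M" if "z \<in> ball 0 R" for n z
      using bd[OF F that, of n] mult_left_mono[OF M[of n] K0] by linarith
  qed (use r in auto)
  have gH: "g \<circ> \<phi> \<in> H"
  proof -
    obtain N where N: "\<forall>n\<ge>N. \<forall>z\<in>ball 0 r. cmod (F (k n) z - g z) < 1"
      using lim[of 1] by auto
    show ?thesis
    proof (rule bounded_mem[OF comp_hol[OF g], where B = "K * M + 1"])
      fix z :: "complex ^ 'n"
      assume "z \<in> ball 0 1"
      then have z: "\<phi> z \<in> ball 0 r"
        using im by blast
      then have "cmod (F (k N) (\<phi> z) - g (\<phi> z)) < 1"
        using N by blast
      moreover have "cmod (F (k N) (\<phi> z)) \<le> K * M"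
        using bd[OF F, of "\<phi> z" "k N"] mult_left_mono[OF M[of "k N"] K0] z r by auto
      ultimately show "cmod ((g \<circ> \<phi>) z) \<le> K * M + 1"
        using norm_triangle_ineq4[of "F (k N) (\<phi> z)" "F (k N) (\<phi> z) - g (\<phi> z)"] by simp
    qed
  qed
  obtain C' where C': "\<And>f B. holomorphic_sv_on f (ball 0 1) \<Longrightarrow> (\<And>z. z \<in> ball 0 1 \<Longrightarrow> cmod (f z) \<le> B) \<Longrightarrow> nrm f \<le> C' * B"
    using bounded by blast
  have "(\<lambda>n. nrm (\<lambda>z. composition_operator \<phi> (F (k n)) z - (g \<circ> \<phi>) z)) \<longlonglongrightarrow> 0"
  proof (rule LIMSEQ_I)
    fix e :: real
    assume "0 < e"
    define e' where "e' = e / (\<bar>C'\<bar> + 1)"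
    have e': "0 < e'"
      using \<open>0 < e\<close> by (simp add: e'_def)
    then obtain N where N: "\<forall>n\<ge>N. \<forall>z\<in>ball 0 r. cmod (F (k n) z - g z) < e'"
      using lim by blast
    have "nrm (\<lambda>z. composition_operator \<phi> (F (k n)) z - (g \<circ> \<phi>) z) < e" if n: "n \<ge> N" for n
    proof -
      have "nrm (\<lambda>z. composition_operator \<phi> (F (k n)) z - (g \<circ> \<phi>) z) \<le> C' * e'"
      proof (rule C')
        show "holomorphic_sv_on (\<lambda>z. composition_operator \<phi> (F (k n)) z - (g \<circ> \<phi>) z) (ball 0 1)"
          unfolding composition_operator_def
          by (intro holomorphic_sv_on_diff comp_hol g holomorphic_sv_on_subset[OF hol[OF F]]) (use r in auto)
        show "cmod (composition_operator \<phi> (F (k n)) z - (g \<circ> \<phi>) z) \<le> e'" if "z \<in> ball 0 1" for z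
        proof -
          have "\<phi> z \<in> ball 0 r"
            using im that by blast
          then show ?thesis
            using N n by (auto simp: composition_operator_def less_imp_le)
        qed
      qed
      also have "\<dots> \<le> \<bar>C'\<bar> * e'"
        using e' by (intro mult_right_mono) auto
      also have "\<dots> < e"
        using \<open>0 < e\<close> by (simp add: e'_def divide_simps)
      finally show ?thesis .
    qed
    then show "\<exists>N. \<forall>n\<ge>N. norm (nrm (\<lambda>z. composition_operator \<phi> (F (k n)) z - (g \<circ> \<phi>) z) - 0) < e"
      using nrm_nonneg by auto
  qed
  then show "\<exists>k. \<exists>g\<in>H. strict_mono k \<and> (\<lambda>n. nrm (\<lambda>z. composition_operator \<phi> (F (k n)) z - g z)) \<longlonglongrightarrow> 0"
    using k gH by blast
qed (auto simp: composition_operator_def)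

text \<open>
  The adjoint estimate of the classical proof in disguise: the normalized kernels at \<open>\<phi> z\<close> tend
  to 0 pointwise, hence so do their images in norm, and the image is evaluated at \<open>z\<close>.
\<close>

lemma kernel_ratio_limit:
  fixes \<phi> \<psi> :: "complex ^ 'n \<Rightarrow> complex ^ 'n"
  assumes compact: "compact_operator_on H nrm (composition_diff \<phi> \<psi>)"
    and \<phi>: "\<phi> ` ball 0 1 \<subseteq> ball 0 1" and \<psi>: "\<psi> ` ball 0 1 \<subseteq> ball 0 1"
    and q: "\<gamma> / 2 < real q" "\<And>a. a \<in> ball 0 1 \<Longrightarrow> nrm (kernel_power \<gamma> q a) \<le> B"
    and z: "\<And>n. z n \<in> ball 0 1" "\<And>n. 1 - (norm (\<phi> (z n)))\<^sup>2 \<le> M * (1 - (norm (z n))\<^sup>2)"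
    and M: "0 < M"
    and lim: "(\<lambda>n. 1 - (norm (\<phi> (z n)))\<^sup>2) \<longlonglongrightarrow> 0"
  obtains r where "strict_mono (r :: nat \<Rightarrow> nat)"
    "(\<lambda>n. ((1 - (norm (\<phi> (z (r n))))\<^sup>2) / (1 - hermitian_inner (\<psi> (z (r n))) (\<phi> (z (r n))))) ^ q) \<longlonglongrightarrow> 1"
proof -
  define T where "T = (\<lambda>f z. composition_operator \<phi> f z - composition_operator \<psi> f z :: complex)"
  have T: "T f z = f (\<phi> z) - f (\<psi> z)" for f z
    by (simp add: T_def composition_operator_def)
  define a where "a = (\<lambda>n. \<phi> (z n))"
  define b where "b = (\<lambda>n. \<psi> (z n))"
  have a: "norm (a n) < 1" and b: "norm (b n) < 1" for n
    using \<phi> \<psi> z(1)[of n] by (auto simp: a_def b_def image_subset_iff)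
  have da: "0 < 1 - (norm (a n))\<^sup>2" for n
    using a[of n] by (simp add: power_less_one_iff)
  define F where "F = (\<lambda>n. kernel_power \<gamma> q (a n))"
  have F: "F n \<in> H" for n
    using a by (simp add: F_def kernel_power_mem)
  have "\<exists>M. \<forall>n. nrm (F n) \<le> M"
    using q(2) a by (auto simp: F_def)
  then obtain r g where r: "strict_mono r" and g: "g \<in> H" "(\<lambda>n. nrm (\<lambda>z. T (F (r n)) z - g z)) \<longlonglongrightarrow> 0"
    using compact F unfolding compact_operator_on_def T_def by blast
  have TH: "T (F n) \<in> H" for n
    using compact F unfolding compact_operator_on_def T_def by blast
  obtain C where C: "0 \<le> C" "\<And>f z. f \<in> H \<Longrightarrow> z \<in> ball 0 1 \<Longrightarrow> cmod (f z) \<le> C * nrm f * (1 - (norm z)\<^sup>2) powr (- \<gamma> / 2)"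
    using eval_obtain by blast
  define \<epsilon> where "\<epsilon> = (\<lambda>n. nrm (\<lambda>z. T (F (r n)) z - g z))"
  have eval_diff: "cmod (T (F (r n)) w - g w) \<le> C * \<epsilon> n * (1 - (norm w)\<^sup>2) powr (- \<gamma> / 2)" if "w \<in> ball 0 1" for n w
    unfolding \<epsilon>_def by (rule C(2)[OF diff_mem[OF TH g(1)] that])
  have lim': "(\<lambda>n. 1 - (norm (a (r n)))\<^sup>2) \<longlonglongrightarrow> 0"
    using LIMSEQ_subseq_LIMSEQ[OF lim r] by (simp add: a_def o_def)
  have F0: "(\<lambda>n. F (r n) w) \<longlonglongrightarrow> 0" if w: "norm w < 1" for w
  proof (rule Lim_null_comparison)
    show "\<forall>\<^sub>F n in sequentially. norm (F (r n) w) \<le> (1 - (norm (a (r n)))\<^sup>2) powr (real q - \<gamma> / 2) / (1 - norm w) ^ q"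
      unfolding F_def by (intro always_eventually allI norm_kernel_power_le a w)
    have "(\<lambda>n. (1 - (norm (a (r n)))\<^sup>2) powr (real q - \<gamma> / 2)) \<longlonglongrightarrow> 0"
      using tendsto_powr'[OF lim' tendsto_const[of "real q - \<gamma> / 2"]] q(1) da by (auto simp: less_imp_le)
    then show "(\<lambda>n. (1 - (norm (a (r n)))\<^sup>2) powr (real q - \<gamma> / 2) / (1 - norm w) ^ q) \<longlonglongrightarrow> 0"
      by (rule tendsto_divide_zero)
  qed
  \<comment> \<open>Compactness supplies some norm limit g. Point evaluation makes g the pointwise
    limit of the images as well, and that limit is 0.\<close>
  have g0: "g w = 0" if w: "w \<in> ball 0 1" for w
  proof (rule LIMSEQ_unique)
    have "(\<lambda>n. T (F (r n)) w) \<longlonglongrightarrow> 0 - 0"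
      unfolding T using w \<phi> \<psi> by (intro tendsto_diff F0) (auto simp: image_subset_iff)
    then show "(\<lambda>n. T (F (r n)) w) \<longlonglongrightarrow> 0"
      by simp
    have "(\<lambda>n. T (F (r n)) w - g w) \<longlonglongrightarrow> 0"
    proof (rule Lim_null_comparison)
      show "\<forall>\<^sub>F n in sequentially. norm (T (F (r n)) w - g w) \<le> C * \<epsilon> n * (1 - (norm w)\<^sup>2) powr (- \<gamma> / 2)"
        using eval_diff[OF w] by (intro always_eventually allI)
      have "(\<lambda>n. C * \<epsilon> n * (1 - (norm w)\<^sup>2) powr (- \<gamma> / 2)) \<longlonglongrightarrow> C * 0 * (1 - (norm w)\<^sup>2) powr (- \<gamma> / 2)"
        using g(2) unfolding \<epsilon>_def by (intro tendsto_intros)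
      then show "(\<lambda>n. C * \<epsilon> n * (1 - (norm w)\<^sup>2) powr (- \<gamma> / 2)) \<longlonglongrightarrow> 0"
        by simp
    qed
    then show "(\<lambda>n. T (F (r n)) w) \<longlonglongrightarrow> g w"
      by (simp add: LIM_zero_iff)
  qed
  define s where "s = (\<lambda>n. of_real (1 - (norm (a n))\<^sup>2) / (1 - hermitian_inner (b n) (a n)))"
  \<comment> \<open>At z the image equals d^(-\<gamma>/2) (1 - s^q), while point evaluation allows C
    \<epsilon> x^(-\<gamma>/2). The hypothesis d \<le> M x makes the two powers comparable, so only
    \<epsilon> survives up to a constant.\<close>
  have bound: "cmod (1 - s (r n) ^ q) \<le> C * M powr (\<gamma> / 2) * \<epsilon> n" for n
  proof -
    define d where "d = 1 - (norm (a (r n)))\<^sup>2"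
    define x where "x = 1 - (norm (z (r n)))\<^sup>2"
    have d: "0 < d"
      using da by (simp add: d_def)
    have x: "0 < x" "d \<le> M * x"
      using z[of "r n"] by (auto simp: x_def d_def a_def power_less_one_iff)
    have dq: "d powr (real q - \<gamma> / 2) = d powr (- \<gamma> / 2) * d ^ q"
      using d by (simp add: powr_add[symmetric] powr_realpow[symmetric])
    have "T (F (r n)) (z (r n)) = of_real (d powr (real q - \<gamma> / 2)) * (inverse (of_real d ^ q) - inverse ((1 - hermitian_inner (b (r n)) (a (r n))) ^ q))"
      unfolding T by (simp add: F_def kernel_power_def hermitian_inner_self d_def a_def b_def algebra_simps)
    also have "\<dots> = of_real (d powr (- \<gamma> / 2)) * (of_real d ^ q * inverse (of_real d ^ q) - of_real d ^ q * inverse ((1 - hermitian_inner (b (r n)) (a (r n))) ^ q))"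
      by (simp only: dq of_real_mult of_real_power right_diff_distrib mult.assoc)
    also have "complex_of_real d ^ q * inverse (of_real d ^ q) = 1"
      using d by simp
    also have "complex_of_real d ^ q * inverse ((1 - hermitian_inner (b (r n)) (a (r n))) ^ q) = s (r n) ^ q"
      unfolding s_def d_def[symmetric] power_divide by (simp only: divide_inverse)
    finally have "T (F (r n)) (z (r n)) = of_real (d powr (- \<gamma> / 2)) * (1 - s (r n) ^ q)" .
    then have "d powr (- \<gamma> / 2) * cmod (1 - s (r n) ^ q) = cmod (T (F (r n)) (z (r n)) - g (z (r n)))"
      by (simp add: g0[OF z(1)] norm_mult)
    also have "\<dots> \<le> C * \<epsilon> n * x powr (- \<gamma> / 2)"
      unfolding x_def by (rule eval_diff[OF z(1)])
    also have "\<dots> \<le> C * \<epsilon> n * (d / M) powr (- \<gamma> / 2)"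
    proof (intro mult_left_mono powr_mono2')
      show "d / M \<le> x"
        using x M by (simp add: pos_divide_le_eq mult.commute)
    qed (use d M \<gamma>_nonneg C(1) nrm_nonneg in \<open>auto simp: \<epsilon>_def\<close>)
    also have "\<dots> = d powr (- \<gamma> / 2) * (C * M powr (\<gamma> / 2) * \<epsilon> n)"
      using d M by (simp add: powr_divide powr_minus_divide)
    finally show ?thesis
      using d by simp
  qed
  have "(\<lambda>n. 1 - s (r n) ^ q) \<longlonglongrightarrow> 0"
  proof (rule Lim_null_comparison)
    show "\<forall>\<^sub>F n in sequentially. norm (1 - s (r n) ^ q) \<le> C * M powr (\<gamma> / 2) * \<epsilon> n"
      using bound by (intro always_eventually allI)
    have "(\<lambda>n. C * M powr (\<gamma> / 2) * \<epsilon> n) \<longlonglongrightarrow> C * M powr (\<gamma> / 2) * 0"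
      using g(2) unfolding \<epsilon>_def by (intro tendsto_intros)
    then show "(\<lambda>n. C * M powr (\<gamma> / 2) * \<epsilon> n) \<longlonglongrightarrow> 0"
      by simp
  qed
  from tendsto_diff[OF tendsto_const[of 1] this]
  have "(\<lambda>n. s (r n) ^ q) \<longlonglongrightarrow> 1"
    by simp
  then show thesis
    using that[OF r] by (simp add: s_def a_def b_def)
qed

text \<open>A single exponent gives s^q -> 1 only, which leaves the root of unity open. Using q and
  q + 1 on nested subsequences, the quotient of the two limits gives 1/s -> 1, and 1/s - 1 is
  exactly <\<phi> z - \<psi> z, \<phi> z> / (1 - |\<phi> z|^2).\<close>

lemma compact_imp_defect_dominates:
  fixes \<phi> \<psi> :: "complex ^ 'n \<Rightarrow> complex ^ 'n"
  assumes compact: "compact_operator_on H nrm (composition_diff \<phi> \<psi>)"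
    and \<phi>: "\<phi> ` ball 0 1 \<subseteq> ball 0 1" and \<psi>: "\<psi> ` ball 0 1 \<subseteq> ball 0 1"
  shows "defect_dominates \<phi> \<psi>"
  unfolding defect_dominates_def
proof (intro allI impI, rule ccontr)
  fix M e :: real
  assume M: "0 < M" and e: "0 < e"
  assume "\<not> (\<exists>\<delta>>0. \<forall>z\<in>ball 0 1. 1 - (norm (\<phi> z))\<^sup>2 \<le> M * (1 - (norm z)\<^sup>2) \<longrightarrow>
    1 - (norm (\<phi> z))\<^sup>2 < \<delta> \<longrightarrow> cmod (hermitian_inner (\<phi> z - \<psi> z) (\<phi> z)) \<le> e * (1 - (norm (\<phi> z))\<^sup>2))"
  then have "\<exists>z\<in>ball 0 1. 1 - (norm (\<phi> z))\<^sup>2 \<le> M * (1 - (norm z)\<^sup>2) \<and> 1 - (norm (\<phi> z))\<^sup>2 < \<delta> \<and>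
      e * (1 - (norm (\<phi> z))\<^sup>2) < cmod (hermitian_inner (\<phi> z - \<psi> z) (\<phi> z))" if "0 < \<delta>" for \<delta>
    using that by (meson not_le)
  then have "\<exists>z\<in>ball 0 1. 1 - (norm (\<phi> z))\<^sup>2 \<le> M * (1 - (norm z)\<^sup>2) \<and> 1 - (norm (\<phi> z))\<^sup>2 < inverse (real (Suc n)) \<and>
      e * (1 - (norm (\<phi> z))\<^sup>2) < cmod (hermitian_inner (\<phi> z - \<psi> z) (\<phi> z))" for n
    by simp
  then obtain z where z: "\<And>n. z n \<in> ball 0 1" "\<And>n. 1 - (norm (\<phi> (z n)))\<^sup>2 \<le> M * (1 - (norm (z n))\<^sup>2)"
    "\<And>n. 1 - (norm (\<phi> (z n)))\<^sup>2 < inverse (real (Suc n))"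
    "\<And>n. e * (1 - (norm (\<phi> (z n)))\<^sup>2) < cmod (hermitian_inner (\<phi> (z n) - \<psi> (z n)) (\<phi> (z n)))"
    by metis
  have d: "0 < 1 - (norm (\<phi> (z n)))\<^sup>2" for n
    using \<phi> z(1)[of n] by (auto simp: image_subset_iff power_less_one_iff)
  have lim: "(\<lambda>n. 1 - (norm (\<phi> (z n)))\<^sup>2) \<longlonglongrightarrow> 0"
    by (rule tendsto_sandwich[OF _ _ tendsto_const LIMSEQ_inverse_real_of_nat])
       (use d z(3) in \<open>auto simp: less_imp_le\<close>)
  obtain p where p: "\<And>q. q \<ge> p \<Longrightarrow> \<exists>C. \<forall>a\<in>ball 0 1. nrm (kernel_power \<gamma> q a) \<le> C"
    using kernel by blast
  \<comment> \<open>\<open>p\<close> secures bounded kernel norms for both q and q + 1; the other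
    entry makes both exceed \<gamma>/2, as the pointwise decay requires.\<close>
  define q where "q = max p (nat \<lceil>\<gamma>\<rceil> + 1)"
  have q: "\<gamma> / 2 < real q" "\<gamma> / 2 < real (Suc q)" "p \<le> q" "p \<le> Suc q"
    using \<gamma>_nonneg unfolding q_def by (auto simp: max_def) linarith+
  obtain B1 where B1: "\<And>a. a \<in> ball 0 1 \<Longrightarrow> nrm (kernel_power \<gamma> q a) \<le> B1"
    using p[OF q(3)] by blast
  obtain B2 where B2: "\<And>a. a \<in> ball 0 1 \<Longrightarrow> nrm (kernel_power \<gamma> (Suc q) a) \<le> B2"
    using p[OF q(4)] by blast
  define s where "s = (\<lambda>n. of_real (1 - (norm (\<phi> (z n)))\<^sup>2) / (1 - hermitian_inner (\<psi> (z n)) (\<phi> (z n))))"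
  obtain r1 where r1: "strict_mono (r1 :: nat \<Rightarrow> nat)" "(\<lambda>n. s (r1 n) ^ q) \<longlonglongrightarrow> 1"
    unfolding s_def by (rule kernel_ratio_limit[OF compact \<phi> \<psi> q(1) B1 z(1,2) M lim]) auto
  obtain r2 where r2: "strict_mono (r2 :: nat \<Rightarrow> nat)" "(\<lambda>n. s (r1 (r2 n)) ^ Suc q) \<longlonglongrightarrow> 1"
    unfolding s_def
    by (rule kernel_ratio_limit[OF compact \<phi> \<psi> q(2) B2 z(1)[of "r1 _"] z(2)[of "r1 _"] M LIMSEQ_subseq_LIMSEQ[OF lim r1(1), unfolded o_def]]) auto
  define t where "t = (\<lambda>n. s (r1 (r2 n)))"
  have tq: "(\<lambda>n. t n ^ q) \<longlonglongrightarrow> 1" "(\<lambda>n. t n ^ Suc q) \<longlonglongrightarrow> 1"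
    using LIMSEQ_subseq_LIMSEQ[OF r1(2) r2(1)] r2(2) by (simp_all add: t_def o_def)
  have snz: "s n \<noteq> 0" for n
  proof -
    have "1 - hermitian_inner (\<psi> (z n)) (\<phi> (z n)) \<noteq> 0"
      using z(1)[of n] \<phi> \<psi> by (intro one_minus_hermitian_inner_nz) (auto simp: image_subset_iff)
    moreover have "complex_of_real (1 - (norm (\<phi> (z n)))\<^sup>2) \<noteq> 0"
      using d[of n] by (simp only: of_real_eq_0_iff)
    ultimately show ?thesis
      unfolding s_def divide_eq_0_iff by blast
  qed
  have "(\<lambda>n. t n ^ q / t n ^ Suc q) \<longlonglongrightarrow> 1 / 1"
    by (intro tendsto_divide tq) simp
  moreover have "t n ^ q / t n ^ Suc q = inverse (t n)" for n
    using snz by (simp add: t_def divide_simps)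
  ultimately have "(\<lambda>n. inverse (t n) - 1) \<longlonglongrightarrow> 0"
    by (simp add: LIM_zero_iff)
  then obtain n where "cmod (inverse (t n) - 1) < e"
    using e LIMSEQ_D[of "\<lambda>n. inverse (t n) - 1" 0 e] by auto
  moreover define k where "k = r1 (r2 n)"
  ultimately have "cmod (inverse (s k) - 1) < e"
    by (simp add: t_def)
  moreover have "inverse (s k) - 1 = hermitian_inner (\<phi> (z k) - \<psi> (z k)) (\<phi> (z k)) / of_real (1 - (norm (\<phi> (z k)))\<^sup>2)"
    using d[of k] by (simp add: s_def hermitian_inner_diff_left hermitian_inner_self divide_simps del: of_real_diff of_real_power)
      (simp add: algebra_simps)
  ultimately have "cmod (hermitian_inner (\<phi> (z k) - \<psi> (z k)) (\<phi> (z k))) / (1 - (norm (\<phi> (z k)))\<^sup>2) < e"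
    using d[of k] by (simp add: norm_divide del: of_real_diff of_real_power)
  then show False
    using z(4)[of k] d[of k] by (simp add: pos_divide_less_eq)
qed

theorem compact_difference_iff:
  fixes \<phi> \<psi> :: "complex ^ 'n \<Rightarrow> complex ^ 'n"
  assumes \<phi>: "linear_fractional_self_map \<phi>" and \<psi>: "linear_fractional_self_map \<psi>"
  shows "compact_operator_on H nrm (composition_diff \<phi> \<psi>) \<longleftrightarrow>
    (compact_operator_on H nrm (composition_operator \<phi>) \<and> compact_operator_on H nrm (composition_operator \<psi>)) \<or>
    (\<forall>z\<in>ball 0 1. \<phi> z = \<psi> z)"
proof
  assume compact: "compact_operator_on H nrm (composition_diff \<phi> \<psi>)"
  \<comment> \<open>Subtracting from the zero operator, compact as the difference of a map with
    itself, exchanges \<phi> and \<psi>.\<close>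
  have zero: "compact_operator_on H nrm (\<lambda>f z. 0)"
    using compact_zero_on_ball[of id id] by simp
  from compact_diff[OF zero compact]
  have compact': "compact_operator_on H nrm (composition_diff \<psi> \<phi>)"
    by simp
  have im: "\<phi> ` ball 0 1 \<subseteq> ball 0 1" "\<psi> ` ball 0 1 \<subseteq> ball 0 1"
    using \<phi> \<psi> unfolding linear_fractional_self_map_def by blast+
  have dom: "defect_dominates \<phi> \<psi>" "defect_dominates \<psi> \<phi>"
    using compact_imp_defect_dominates compact compact' im by blast+
  show "(compact_operator_on H nrm (composition_operator \<phi>) \<and> compact_operator_on H nrm (composition_operator \<psi>)) \<or>
    (\<forall>z\<in>ball 0 1. \<phi> z = \<psi> z)"
  \<comment> \<open>The dichotomy is on the suprema of |\<phi>| and |\<psi>|, not on compactness: if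
    both are below 1, both operators are compact, and if one of them reaches 1, rigidity started
    from that map gives equality.\<close>
  proof (cases "(\<exists>\<rho><1. \<forall>z\<in>ball 0 1. norm (\<phi> z) \<le> \<rho>) \<and> (\<exists>\<rho><1. \<forall>z\<in>ball 0 1. norm (\<psi> z) \<le> \<rho>)")
    case True
    then show ?thesis
      using compact_composition_bounded_away \<phi> \<psi> by blast
  next
    case False
    then consider "\<And>\<rho>. \<rho> < 1 \<Longrightarrow> \<exists>z\<in>ball 0 1. \<rho> < norm (\<phi> z)" | "\<And>\<rho>. \<rho> < 1 \<Longrightarrow> \<exists>z\<in>ball 0 1. \<rho> < norm (\<psi> z)"
      by (meson not_le)
    then show ?thesis
    proof cases
      case 1
      then show ?thesis
        using linear_fractional_rigidity[OF \<phi> \<psi> dom] by blast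
    next
      case 2
      then show ?thesis
        using linear_fractional_rigidity[OF \<psi> \<phi> dom(2,1)] by metis
    qed
  qed
qed (use compact_diff compact_zero_on_ball in blast)

end

section \<open>Hardy and Bergman spaces\<close>

lemma borel_sphere [measurable]: "sphere (a :: complex ^ 'n) r \<in> sets borel"
  by (rule borel_closed) (rule closed_sphere)

abbreviation slice_square :: "(complex ^ 'n \<Rightarrow> complex) \<Rightarrow> real \<Rightarrow> ennreal"
  where "slice_square f r \<equiv> \<integral>\<^sup>+\<zeta>\<in>sphere 0 1. ball_square f (r *\<^sub>R \<zeta>) \<partial>sphere_measure"

lemma hardy_sqnorm_eq:
  "hardy_sqnorm f = (SUP r\<in>{0<..<1}. slice_square f r)"
  unfolding hardy_sqnorm_def
  by (intro SUP_cong nn_integral_cong refl) (auto simp: ball_square_def indicator_def)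

lemma hardy_slice_le:
  assumes "0 < r" "r < 1"
  shows "slice_square f r \<le> hardy_sqnorm f"
  unfolding hardy_sqnorm_eq using assms by (intro SUP_upper) auto

definition weight_const :: "'n itself \<Rightarrow> real \<Rightarrow> real"
  where "weight_const _ s = Gamma (real CARD('n) + s + 1) / (Gamma (real CARD('n) + 1) * Gamma (s + 1))"

lemma weight_const_pos: "s > -1 \<Longrightarrow> weight_const TYPE('n) s > 0"
  unfolding weight_const_def by (intro divide_pos_pos mult_pos_pos Gamma_real_pos) auto

lemma bergman_weight_eq: "bergman_weight s (z :: complex ^ 'n) = weight_const TYPE('n) s * (1 - (norm z)\<^sup>2) powr s"
  by (simp add: bergman_weight_def weight_const_def)

lemma bergman_sqnorm_eq:
  fixes f :: "complex ^ 'n \<Rightarrow> complex"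
  assumes "s > -1"
  shows "bergman_sqnorm s f = (\<integral>\<^sup>+z. ball_square f z * ennreal (bergman_weight s z) \<partial>ball_measure)"
  unfolding bergman_sqnorm_def
proof (rule nn_integral_cong)
  fix z :: "complex ^ 'n"
  have "0 \<le> bergman_weight s z"
    using weight_const_pos[OF assms, where ?'n = 'n] by (simp add: bergman_weight_eq)
  then show "ennreal ((cmod (f z))\<^sup>2 * bergman_weight s z) * indicator (ball 0 1) z = ball_square f z * ennreal (bergman_weight s z)"
    by (simp add: ball_square_def ennreal_mult mult_ac)
qed

lemma borel_measurable_bergman_weight [measurable]: "bergman_weight s \<in> borel_measurable borel"
  unfolding bergman_weight_def by measurable

text \<open>A pointwise inequality that integrates directly, so Minkowski's inequality is avoided;
  this is why \<open>nrm_diff\<close> has squared form.\<close>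

lemma ball_square_diff: "ball_square (\<lambda>z. f z - g z) z \<le> 2 * ball_square f z + 2 * ball_square g z"
proof -
  have "(cmod (f z - g z))\<^sup>2 \<le> (cmod (f z) + cmod (g z))\<^sup>2"
    by (intro power_mono norm_triangle_ineq4) simp
  also have "\<dots> \<le> 2 * (cmod (f z))\<^sup>2 + 2 * (cmod (g z))\<^sup>2"
    using zero_le_power2[of "cmod (f z) - cmod (g z)"] by (simp add: power2_eq_square algebra_simps)
  finally have "ennreal ((cmod (f z - g z))\<^sup>2) \<le> ennreal (2 * (cmod (f z))\<^sup>2 + 2 * (cmod (g z))\<^sup>2)"
    by (rule ennreal_leI)
  also have "\<dots> = 2 * ennreal ((cmod (f z))\<^sup>2) + 2 * ennreal ((cmod (g z))\<^sup>2)"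
    by (simp add: ennreal_plus ennreal_mult')
  finally show ?thesis
    by (simp add: ball_square_def indicator_def)
qed

lemma borel_measurable_ball_square_scaleR:
  fixes f :: "complex ^ 'n \<Rightarrow> complex"
  assumes "holomorphic_sv_on f (ball 0 1)"
  shows "(\<lambda>\<zeta>. ball_square f (r *\<^sub>R \<zeta>)) \<in> borel_measurable borel"
  using borel_measurable_ball_square[OF assms] by measurable

lemma hardy_sqnorm_diff:
  fixes f g :: "complex ^ 'n \<Rightarrow> complex"
  assumes f: "holomorphic_sv_on f (ball 0 1)" and g: "holomorphic_sv_on g (ball 0 1)"
  shows "hardy_sqnorm (\<lambda>z. f z - g z) \<le> 2 * hardy_sqnorm f + 2 * hardy_sqnorm g"
  unfolding hardy_sqnorm_eq[of "\<lambda>z. f z - g z"]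
proof (rule SUP_least)
  note [measurable] = borel_measurable_ball_square_scaleR[OF f] borel_measurable_ball_square_scaleR[OF g]
  fix r :: real
  assume r: "r \<in> {0<..<1}"
  have "slice_square (\<lambda>z. f z - g z) r
      \<le> (\<integral>\<^sup>+\<zeta>. 2 * (ball_square f (r *\<^sub>R \<zeta>) * indicator (sphere 0 1) \<zeta>) + 2 * (ball_square g (r *\<^sub>R \<zeta>) * indicator (sphere 0 1) \<zeta>) \<partial>sphere_measure)"
    by (intro nn_integral_mono) (auto simp: indicator_def ball_square_diff)
  also have "\<dots> = 2 * slice_square f r
      + 2 * slice_square g r"
    by (subst nn_integral_add) (simp_all add: nn_integral_cmult)
  also have "\<dots> \<le> 2 * hardy_sqnorm f + 2 * hardy_sqnorm g"
    using r by (intro add_mono mult_left_mono hardy_slice_le) auto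
  finally show "slice_square (\<lambda>z. f z - g z) r
      \<le> 2 * hardy_sqnorm f + 2 * hardy_sqnorm g" .
qed

lemma bergman_sqnorm_diff:
  fixes f g :: "complex ^ 'n \<Rightarrow> complex"
  assumes f: "holomorphic_sv_on f (ball 0 1)" and g: "holomorphic_sv_on g (ball 0 1)" and s: "s > -1"
  shows "bergman_sqnorm s (\<lambda>z. f z - g z) \<le> 2 * bergman_sqnorm s f + 2 * bergman_sqnorm s g"
proof -
  note [measurable] = borel_measurable_ball_square[OF f] borel_measurable_ball_square[OF g]
  have "bergman_sqnorm s (\<lambda>z. f z - g z) \<le> (\<integral>\<^sup>+z. 2 * (ball_square f z * ennreal (bergman_weight s z)) + 2 * (ball_square g z * ennreal (bergman_weight s z)) \<partial>ball_measure)"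
    unfolding bergman_sqnorm_eq[OF s]
  proof (rule nn_integral_mono)
    fix z :: "complex ^ 'n"
    have "ball_square (\<lambda>z. f z - g z) z * ennreal (bergman_weight s z) \<le> (2 * ball_square f z + 2 * ball_square g z) * ennreal (bergman_weight s z)"
      by (intro mult_right_mono ball_square_diff) simp
    then show "ball_square (\<lambda>z. f z - g z) z * ennreal (bergman_weight s z) \<le> 2 * (ball_square f z * ennreal (bergman_weight s z)) + 2 * (ball_square g z * ennreal (bergman_weight s z))"
      by (simp add: distrib_right mult.assoc)
  qed
  also have "\<dots> = 2 * bergman_sqnorm s f + 2 * bergman_sqnorm s g"
    unfolding bergman_sqnorm_eq[OF s] by (subst nn_integral_add) (simp_all add: nn_integral_cmult)
  finally show ?thesis .
qed

text \<open>\<open>enn2real\<close> sends infinity to 0, so finiteness of the right-hand terms must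
  be settled before passing to reals.\<close>

lemma sqrt_enn2real_diff:
  assumes "x \<le> 2 * y + 2 * z" "y < \<infinity>" "z < \<infinity>"
  shows "x < \<infinity>" "(sqrt (enn2real x))\<^sup>2 \<le> 2 * (sqrt (enn2real y))\<^sup>2 + 2 * (sqrt (enn2real z))\<^sup>2"
proof -
  obtain b c where b: "y = ennreal b" "0 \<le> b" and c: "z = ennreal c" "0 \<le> c"
    using assms(2,3) by (cases y; cases z) auto
  have "2 * y + 2 * z = ennreal (2 * b + 2 * c)"
    using b c by (simp add: ennreal_plus ennreal_mult')
  with assms(1) have x: "x \<le> ennreal (2 * b + 2 * c)"
    by simp
  then show "x < \<infinity>"
    by (rule order.strict_trans1) simp
  have "enn2real x \<le> 2 * b + 2 * c"
    using x b c by (intro enn2real_leI) auto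
  then show "(sqrt (enn2real x))\<^sup>2 \<le> 2 * (sqrt (enn2real y))\<^sup>2 + 2 * (sqrt (enn2real z))\<^sup>2"
    using b c by simp
qed

section \<open>Sharp growth of point evaluations\<close>

lemma point_evaluation_from_square:
  assumes "ennreal (x\<^sup>2) \<le> ennreal (K * \<delta> powr (- \<gamma>)) * y" "y < \<infinity>" "0 \<le> K" "0 < \<delta>"
  shows "x \<le> sqrt K * sqrt (enn2real y) * \<delta> powr (- \<gamma> / 2)"
proof (rule power2_le_imp_le)
  obtain b where b: "y = ennreal b" "0 \<le> b"
    using assms(2) by (cases y) auto
  have "ennreal (x\<^sup>2) \<le> ennreal (K * \<delta> powr (- \<gamma>) * b)"
    using assms(1,3) b by (simp add: ennreal_mult)
  then have "x\<^sup>2 \<le> K * \<delta> powr (- \<gamma>) * b"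
    using assms(3) b by (simp add: ennreal_le_iff)
  also have "\<delta> powr (- \<gamma>) = (\<delta> powr (- \<gamma> / 2))\<^sup>2"
    by (simp add: power2_eq_square flip: powr_add)
  finally show "x\<^sup>2 \<le> (sqrt K * sqrt (enn2real y) * \<delta> powr (- \<gamma> / 2))\<^sup>2"
    using assms(3) b by (simp add: power_mult_distrib mult_ac)
qed (use assms in simp)

lemma powr_minus_nat_mult:
  assumes "0 < (\<delta> :: real)"
  shows "x / \<delta> ^ k * (y / \<delta> powr s) = x * y * \<delta> powr (- (real k + s))"
proof -
  have "\<delta> powr (- (real k + s)) = inverse (\<delta> ^ k) * inverse (\<delta> powr s)"
    using assms by (subst powr_minus) (simp add: powr_add powr_realpow)
  then show ?thesis
    by (simp only: divide_inverse mult_ac)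
qed

text \<open>Averaging over the region costs \<delta>^(-N-1). The region lies in a shell of thickness
  at most (5/4) \<delta>, on which every spherical slice is bounded by
  \<open>hardy_sqnorm f\<close>; this wins back one power of \<delta> and contributes 2 N (5/4) to
  the constant.\<close>

lemma hardy_point_evaluation:
  fixes f :: "complex ^ 'n \<Rightarrow> complex"
  assumes f: "holomorphic_sv_on f (ball 0 1)" and z: "norm z < 1"
  shows "ennreal ((cmod (f z))\<^sup>2) \<le> ennreal (121 * 16 ^ CARD('n) * (5 / 2 * CARD('n)) * (1 - (norm z)\<^sup>2) powr (- real CARD('n))) * hardy_sqnorm f"
proof -
  note [measurable] = borel_measurable_ball_square[OF f]
  define N where "N = CARD('n)"
  define \<delta> where "\<delta> = 1 - (norm z)\<^sup>2"
  let ?J = "\<lambda>r. \<integral>\<^sup>+\<zeta>\<in>sphere 0 1. indicator {v. 1 - (norm v)\<^sup>2 \<le> 5 / 4 * \<delta>} (r *\<^sub>R \<zeta>) * ball_square f (r *\<^sub>R \<zeta>) \<partial>sphere_measure"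
  have \<delta>: "0 < \<delta>"
    using z by (simp add: \<delta>_def power_less_one_iff)
  have "(\<integral>\<^sup>+v. indicator (koranyi_region z) (v - z) * ball_square f v \<partial>ball_measure)
      \<le> (\<integral>\<^sup>+v. indicator {v. 1 - (norm v)\<^sup>2 \<le> 5 / 4 * \<delta>} v * ball_square f v \<partial>ball_measure)"
    using koranyi_region_defect(2)[of _ z] z
    by (intro nn_integral_mono mult_right_mono) (force simp: indicator_def \<delta>_def)+
  also have "\<dots> = (\<integral>\<^sup>+r\<in>{0<..<1}. ennreal (2 * real CARD('n) * r ^ (2 * CARD('n) - 1)) *
      ?J r \<partial>lborel)"
    by (rule nn_integral_ball_measure_polar) measurable
  also have "\<dots> \<le> (\<integral>\<^sup>+r. ennreal (2 * real N) * hardy_sqnorm f * indicator {1 - 5 / 4 * \<delta>..1} r \<partial>lborel)"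
  proof (rule nn_integral_mono)
    fix r :: real
    show "ennreal (2 * real CARD('n) * r ^ (2 * CARD('n) - 1)) *
        ?J r * indicator {0<..<1} r
        \<le> ennreal (2 * real N) * hardy_sqnorm f * indicator {1 - 5 / 4 * \<delta>..1} r"
    proof (cases "0 < r \<and> r < 1")
      case True
      then have r: "0 < r" "r < 1"
        by auto
      have "?J r
          \<le> hardy_sqnorm f * indicator {1 - 5 / 4 * \<delta>..1} r"
      proof (cases "1 - 5 / 4 * \<delta> \<le> r")
        case True
        have "?J r
            \<le> slice_square f r"
          by (intro nn_integral_mono) (auto simp: indicator_def)
        also have "\<dots> \<le> hardy_sqnorm f"
          using r by (rule hardy_slice_le)
        finally show ?thesis
          using True r by simp
      next
        case False
        \<comment> \<open>As r^2 \<le> r, the shell condition on 1 - r^2 puts r above 1 - (5/4)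
          \<delta>; below that value the slice vanishes.\<close>
        have "r * r \<le> r * 1"
          using r by (intro mult_left_mono) auto
        then have "\<not> 1 - r\<^sup>2 \<le> 5 / 4 * \<delta>"
          using False by (simp add: power2_eq_square)
        then have "indicator {v. 1 - (norm v)\<^sup>2 \<le> 5 / 4 * \<delta>} (r *\<^sub>R \<zeta>) * ball_square f (r *\<^sub>R \<zeta>) * indicator (sphere 0 1) \<zeta> = 0" for \<zeta>
          using r by (auto simp: indicator_def)
        then show ?thesis
          by (simp only: nn_integral_const mult_zero_left zero_le)
      qed
      moreover have "ennreal (2 * real CARD('n) * r ^ (2 * CARD('n) - 1)) \<le> ennreal (2 * real N)"
        using r by (intro ennreal_leI) (simp add: N_def mult_left_le power_le_one)
      ultimately have "ennreal (2 * real CARD('n) * r ^ (2 * CARD('n) - 1)) *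
          ?J r
          \<le> ennreal (2 * real N) * (hardy_sqnorm f * indicator {1 - 5 / 4 * \<delta>..1} r)"
        by (intro mult_mono) auto
      then show ?thesis
        using r by (simp add: mult.assoc)
    qed auto
  qed
  also have "\<dots> = ennreal (2 * real N) * hardy_sqnorm f * ennreal (5 / 4 * \<delta>)"
    using \<delta> by (simp add: nn_integral_cmult_indicator)
  finally have I: "(\<integral>\<^sup>+v. indicator (koranyi_region z) (v - z) * ball_square f v \<partial>ball_measure)
      \<le> ennreal (2 * real N) * hardy_sqnorm f * ennreal (5 / 4 * \<delta>)" .
  have "ennreal ((cmod (f z))\<^sup>2) \<le> ennreal (121 * 16 ^ N / \<delta> ^ (N + 1)) * (ennreal (2 * real N) * hardy_sqnorm f * ennreal (5 / 4 * \<delta>))"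
    by (rule order_trans[OF koranyi_region_submean[OF f z]]) (unfold N_def[symmetric] \<delta>_def[symmetric], intro mult_left_mono I, simp)
  also have "\<dots> = ennreal (121 * 16 ^ N / \<delta> ^ (N + 1)) * ennreal (2 * real N) * ennreal (5 / 4 * \<delta>) * hardy_sqnorm f"
    by (simp only: mult_ac)
  also have "ennreal (121 * 16 ^ N / \<delta> ^ (N + 1)) * ennreal (2 * real N) * ennreal (5 / 4 * \<delta>)
      = ennreal (121 * 16 ^ N / \<delta> ^ (N + 1) * (2 * real N) * (5 / 4 * \<delta>))"
  proof -
    have *: "ennreal x * ennreal y * ennreal t = ennreal (x * y * t)" if "0 \<le> x" "0 \<le> y" "0 \<le> t" for x y t
      using that by (simp add: ennreal_mult)
    show ?thesis
      by (rule *) (use \<delta> in auto)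
  qed
  also have "121 * 16 ^ N / \<delta> ^ (N + 1) * (2 * real N) * (5 / 4 * \<delta>) = 121 * 16 ^ N * (5 / 2 * N) * \<delta> powr (- real N)"
  proof -
    have "\<delta> powr (- real N) = 1 / \<delta> ^ N"
      using \<delta> by (simp add: powr_minus_divide powr_realpow)
    then show ?thesis
      using \<delta> by (simp only:) simp
  qed
  finally show ?thesis
    by (simp only: N_def \<delta>_def)
qed

text \<open>The least value of x^s is at the left end for s \<ge> 0 and at the right end for s < 0;
  the \<open>min\<close> covers both signs.\<close>

lemma powr_ge_on_interval:
  fixes x \<delta> :: real
  assumes "0 < \<delta>" "\<delta> / 2 \<le> x" "x \<le> 5 / 4 * \<delta>"
  shows "min ((1 / 2) powr s) ((5 / 4) powr s) * \<delta> powr s \<le> x powr s"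
proof (cases "0 \<le> s")
  case True
  have "min ((1 / 2) powr s) ((5 / 4) powr s) * \<delta> powr s \<le> (1 / 2) powr s * \<delta> powr s"
    by (intro mult_right_mono) auto
  also have "\<dots> = (\<delta> / 2) powr s"
    using assms by (simp flip: powr_mult)
  also have "\<dots> \<le> x powr s"
    using assms True by (intro powr_mono2) auto
  finally show ?thesis .
next
  case False
  have "min ((1 / 2) powr s) ((5 / 4) powr s) * \<delta> powr s \<le> (5 / 4) powr s * \<delta> powr s"
    by (intro mult_right_mono) auto
  also have "\<dots> = (5 / 4 * \<delta>) powr s"
    using assms by (simp flip: powr_mult)
  also have "\<dots> \<le> x powr s"
    using assms False by (intro powr_mono2') auto
  finally show ?thesis .
qed

text \<open>On the region the weight is at least a constant times \<delta>^s, so inserting it costs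
  \<delta>^(-s) and the factor \<delta>^(-N-1) of the average becomes \<delta>^(-N-1-s).\<close>

lemma bergman_point_evaluation:
  fixes s :: real
  assumes s: "s > -1"
  obtains K where "0 \<le> K" "\<And>(f :: complex ^ 'n \<Rightarrow> complex) z. holomorphic_sv_on f (ball 0 1) \<Longrightarrow> norm z < 1 \<Longrightarrow>
    ennreal ((cmod (f z))\<^sup>2) \<le> ennreal (K * (1 - (norm z)\<^sup>2) powr (- (real CARD('n) + s + 1))) * bergman_sqnorm s f"
proof -
  define N where "N = CARD('n)"
  define \<kappa> where "\<kappa> = min ((1 / 2) powr s) ((5 / 4) powr s)"
  define W where "W = weight_const TYPE('n) s"
  have W: "W > 0"
    unfolding W_def by (rule weight_const_pos[OF s])
  have \<kappa>: "\<kappa> > 0"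
    by (simp add: \<kappa>_def)
  show thesis
  proof (rule that[of "121 * 16 ^ N * (1 / (W * \<kappa>))"])
    show "0 \<le> 121 * 16 ^ N * (1 / (W * \<kappa>))"
      using W \<kappa> by simp
    fix f :: "complex ^ 'n \<Rightarrow> complex" and z :: "complex ^ 'n"
    assume f: "holomorphic_sv_on f (ball 0 1)" and z: "norm z < 1"
    note [measurable] = borel_measurable_ball_square[OF f]
    define \<delta> where "\<delta> = 1 - (norm z)\<^sup>2"
    have \<delta>: "0 < \<delta>"
      using z by (simp add: \<delta>_def power_less_one_iff)
    define c where "c = 1 / (W * \<kappa>) / \<delta> powr s"
    have c: "0 \<le> c"
      using W \<kappa> by (simp add: c_def)
    have "(\<integral>\<^sup>+v. indicator (koranyi_region z) (v - z) * ball_square f v \<partial>ball_measure)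
        \<le> (\<integral>\<^sup>+v. ennreal c * (ball_square f v * ennreal (bergman_weight s v)) \<partial>ball_measure)"
    proof (rule nn_integral_mono)
      fix v :: "complex ^ 'n"
      show "indicator (koranyi_region z) (v - z) * ball_square f v \<le> ennreal c * (ball_square f v * ennreal (bergman_weight s v))"
      proof (cases "v - z \<in> koranyi_region z")
        case True
        have "\<delta> / 2 \<le> 1 - (norm v)\<^sup>2" "1 - (norm v)\<^sup>2 \<le> 5 / 4 * \<delta>"
          using koranyi_region_defect[OF True z] by (simp_all add: \<delta>_def)
        from powr_ge_on_interval[OF \<delta> this, of s]
        have "\<kappa> * \<delta> powr s \<le> (1 - (norm v)\<^sup>2) powr s"
          by (simp add: \<kappa>_def)
        then have "c * (W * (\<kappa> * \<delta> powr s)) \<le> c * bergman_weight s v"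
          unfolding bergman_weight_eq W_def[symmetric] using c W by (intro mult_left_mono) auto
        then have "1 \<le> c * bergman_weight s v"
          using W \<kappa> \<delta> by (simp add: c_def)
        then have "ennreal 1 \<le> ennreal (c * bergman_weight s v)"
          by (rule ennreal_leI)
        then have "1 * ball_square f v \<le> ennreal (c * bergman_weight s v) * ball_square f v"
          by (intro mult_right_mono) auto
        also have "ennreal (c * bergman_weight s v) = ennreal c * ennreal (bergman_weight s v)"
          using c by (simp add: ennreal_mult')
        finally show ?thesis
          using True by (simp add: mult_ac)
      qed simp
    qed
    also have "\<dots> = ennreal c * bergman_sqnorm s f"
      unfolding bergman_sqnorm_eq[OF s] by (rule nn_integral_cmult) measurable
    finally have I: "(\<integral>\<^sup>+v. indicator (koranyi_region z) (v - z) * ball_square f v \<partial>ball_measure) \<le> ennreal c * bergman_sqnorm s f" .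
    have "ennreal ((cmod (f z))\<^sup>2) \<le> ennreal (121 * 16 ^ N / \<delta> ^ (N + 1)) * (ennreal c * bergman_sqnorm s f)"
      by (rule order_trans[OF koranyi_region_submean[OF f z]]) (unfold N_def[symmetric] \<delta>_def[symmetric], intro mult_left_mono I, simp)
    also have "\<dots> = ennreal (121 * 16 ^ N / \<delta> ^ (N + 1) * c) * bergman_sqnorm s f"
      using \<delta> c by (subst ennreal_mult) (simp_all add: mult.assoc)
    also have "121 * 16 ^ N / \<delta> ^ (N + 1) * c = 121 * 16 ^ N * (1 / (W * \<kappa>)) * \<delta> powr (- (real (N + 1) + s))"
      unfolding c_def by (rule powr_minus_nat_mult[OF \<delta>])
    also have "real (N + 1) + s = real CARD('n) + s + 1"
      by (simp add: N_def)
    finally show "ennreal ((cmod (f z))\<^sup>2) \<le> ennreal (121 * 16 ^ N * (1 / (W * \<kappa>)) * (1 - (norm z)\<^sup>2) powr (- (real CARD('n) + s + 1))) * bergman_sqnorm s f"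
      by (simp only: \<delta>_def)
  qed
qed

section \<open>Norms of the kernel powers\<close>

lemma kernel_power_slice_le:
  fixes a :: "complex ^ 'n"
  assumes a: "norm a < 1" and r: "0 < r" "r < 1" and q: "CARD('n) < 2 * q"
  shows "slice_square (kernel_power \<gamma> q a) r
    \<le> ennreal ((1 - (norm a)\<^sup>2) powr (2 * real q - \<gamma>) * (16 * 676 ^ CARD('n) / (1 - r * norm a) ^ (2 * q - CARD('n))))"
proof -
  define P where "P = (1 - (norm a)\<^sup>2) powr (2 * real q - \<gamma>)"
  have P: "((1 - (norm a)\<^sup>2) powr (real q - \<gamma> / 2))\<^sup>2 = P"
    by (simp add: P_def power2_eq_square flip: powr_add)
  have ra: "norm (r *\<^sub>R a) < 1"
    using a r mult_strict_mono[of r 1 "norm a" 1] by simp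
  have "slice_square (kernel_power \<gamma> q a) r
      \<le> (\<integral>\<^sup>+\<zeta>. ennreal P * (ennreal (1 / cmod (1 - hermitian_inner \<zeta> (r *\<^sub>R a)) ^ (2 * q)) * indicator (sphere 0 1) \<zeta>) \<partial>sphere_measure)"
  proof (rule nn_integral_mono)
    fix \<zeta> :: "complex ^ 'n"
    \<comment> \<open>The radius moves from the variable to the pole, <r \<zeta>, a> = <\<zeta>, r
      a>, so each slice is a kernel integral over the unit sphere with b = r a and exponent 2
      q.\<close>
    have "(cmod (kernel_power \<gamma> q a (r *\<^sub>R \<zeta>)))\<^sup>2 = P * (1 / cmod (1 - hermitian_inner \<zeta> (r *\<^sub>R a)) ^ (2 * q))"
      unfolding norm_kernel_power power_mult_distrib P
      by (simp add: hermitian_inner_scaleR_left hermitian_inner_scaleR_right power_mult[symmetric] power_inverse divide_inverse mult.commute[of _ 2])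
    then have "ennreal ((cmod (kernel_power \<gamma> q a (r *\<^sub>R \<zeta>)))\<^sup>2) = ennreal P * ennreal (1 / cmod (1 - hermitian_inner \<zeta> (r *\<^sub>R a)) ^ (2 * q))"
      by (simp only: ennreal_mult' P_def powr_ge_zero)
    then show "ball_square (kernel_power \<gamma> q a) (r *\<^sub>R \<zeta>) * indicator (sphere 0 1) \<zeta>
        \<le> ennreal P * (ennreal (1 / cmod (1 - hermitian_inner \<zeta> (r *\<^sub>R a)) ^ (2 * q)) * indicator (sphere 0 1) \<zeta>)"
      unfolding ball_square_def by (simp only:) (simp add: indicator_def)
  qed
  also have "\<dots> = ennreal P * (\<integral>\<^sup>+\<zeta>\<in>sphere 0 1. ennreal (1 / cmod (1 - hermitian_inner \<zeta> (r *\<^sub>R a)) ^ (2 * q)) \<partial>sphere_measure)"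
    by (rule nn_integral_cmult) measurable
  also have "\<dots> \<le> ennreal P * ennreal (16 * 676 ^ CARD('n) / (1 - norm (r *\<^sub>R a)) ^ (2 * q - CARD('n)))"
    by (intro mult_left_mono nn_integral_sphere_kernel_le ra q) simp
  also have "\<dots> = ennreal (P * (16 * 676 ^ CARD('n) / (1 - r * norm a) ^ (2 * q - CARD('n))))"
  proof -
    have "norm (r *\<^sub>R a) = r * norm a"
      using r by simp
    then show ?thesis
      using ra by (simp only:) (rule ennreal_mult[symmetric], auto simp: P_def)
  qed
  finally show ?thesis
    by (simp add: P_def)
qed

lemma one_minus_square_le:
  assumes "norm a < 1"
  shows "0 < 1 - norm a" "0 < 1 - (norm a)\<^sup>2" "1 - (norm a)\<^sup>2 \<le> 2 * (1 - norm a)"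
proof -
  show "0 < 1 - norm a" "0 < 1 - (norm a)\<^sup>2"
    using assms by (auto simp: power_less_one_iff)
  have "1 - (norm a)\<^sup>2 = (1 + norm a) * (1 - norm a)"
    by (simp add: power2_eq_square algebra_simps)
  also have "\<dots> \<le> 2 * (1 - norm a)"
    using assms by (intro mult_right_mono) auto
  finally show "1 - (norm a)\<^sup>2 \<le> 2 * (1 - norm a)" .
qed

text \<open>With \<gamma> = N the normalizing factor has the exponent 2 q - N of the slice integral.
  Since 1 - |a|^2 \<le> 2 (1 - r |a|), the quotient is bounded uniformly in r and a.\<close>

lemma hardy_sqnorm_kernel_le:
  fixes a :: "complex ^ 'n"
  assumes a: "norm a < 1" and q: "CARD('n) < 2 * q"
  shows "hardy_sqnorm (kernel_power (real CARD('n)) q a) \<le> ennreal (2 ^ (2 * q - CARD('n)) * (16 * 676 ^ CARD('n)))"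
  unfolding hardy_sqnorm_eq
proof (rule SUP_least)
  fix r :: real
  assume "r \<in> {0<..<1}"
  then have r: "0 < r" "r < 1"
    by auto
  define m where "m = 2 * q - CARD('n)"
  note a' = one_minus_square_le[OF a]
  have "r * norm a \<le> 1 * norm a"
    using r by (intro mult_right_mono) auto
  then have ra: "1 - norm a \<le> 1 - r * norm a"
    by simp
  have "slice_square (kernel_power (real CARD('n)) q a) r
      \<le> ennreal ((1 - (norm a)\<^sup>2) powr (2 * real q - real CARD('n)) * (16 * 676 ^ CARD('n) / (1 - r * norm a) ^ m))"
    unfolding m_def by (rule kernel_power_slice_le[OF a r q])
  also have "\<dots> \<le> ennreal (2 ^ m * (16 * 676 ^ CARD('n)))"
  proof (rule ennreal_leI)
    have "2 * real q - real CARD('n) = real m"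
      using q by (simp add: m_def)
    then have "(1 - (norm a)\<^sup>2) powr (2 * real q - real CARD('n)) = (1 - (norm a)\<^sup>2) ^ m"
      using a' by (simp add: powr_realpow)
    also have "\<dots> \<le> (2 * (1 - r * norm a)) ^ m"
      using a' ra by (intro power_mono) auto
    finally have "(1 - (norm a)\<^sup>2) powr (2 * real q - real CARD('n)) * (16 * 676 ^ CARD('n) / (1 - r * norm a) ^ m)
        \<le> (2 * (1 - r * norm a)) ^ m * (16 * 676 ^ CARD('n) / (1 - r * norm a) ^ m)"
      using a' ra by (intro mult_right_mono) auto
    also have "\<dots> = 2 ^ m * (16 * 676 ^ CARD('n))"
    proof -
      have *: "(2 * y) ^ m * (K / y ^ m) = 2 ^ m * K" if "0 < y" for y K :: real
        using that by (simp add: power_mult_distrib)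
      show ?thesis
        by (rule *) (use a' ra in linarith)
    qed
    finally show "(1 - (norm a)\<^sup>2) powr (2 * real q - real CARD('n)) * (16 * 676 ^ CARD('n) / (1 - r * norm a) ^ m)
        \<le> 2 ^ m * (16 * 676 ^ CARD('n))" .
  qed
  finally show "slice_square (kernel_power (real CARD('n)) q a) r
      \<le> ennreal (2 ^ (2 * q - CARD('n)) * (16 * 676 ^ CARD('n)))"
    by (simp add: m_def)
qed

text \<open>With t = 1 - r the denominator base t + \<delta> - t \<delta> is at least max t
  \<delta>. Splitting at t = \<delta>, the inner part converges at 0 because s > -1, and the outer
  part, extended to infinity, because m > s + 1.\<close>

lemma nn_integral_radial_kernel_le:
  fixes s \<delta> :: real
  assumes s: "s > -1" and m: "s + 1 < real m" and \<delta>: "0 < \<delta>" "\<delta> \<le> 1"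
  shows "(\<integral>\<^sup>+r\<in>{0<..<1}. ennreal ((1 - r) powr s / (1 - r * (1 - \<delta>)) ^ m) \<partial>lborel)
    \<le> ennreal ((1 / (s + 1) + 1 / (real m - s - 1)) * \<delta> powr (s + 1 - real m))"
proof -
  have "(\<integral>\<^sup>+r\<in>{0<..<1}. ennreal ((1 - r) powr s / (1 - r * (1 - \<delta>)) ^ m) \<partial>lborel)
      = ennreal \<bar>-1\<bar> * (\<integral>\<^sup>+t. ennreal ((1 - (1 + -1 * t)) powr s / (1 - (1 + -1 * t) * (1 - \<delta>)) ^ m) * indicator {0<..<1} (1 + -1 * t) \<partial>lborel)"
    by (rule nn_integral_real_affine) simp_all
  also have "\<dots> \<le> (\<integral>\<^sup>+t. ennreal (1 / \<delta> ^ m) * (ennreal (t powr s) * indicator {0..\<delta>} t) + ennreal (t powr (s - real m)) * indicator {\<delta>..} t \<partial>lborel)"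
    unfolding abs_minus_cancel abs_one ennreal_1 mult_1
  proof (rule nn_integral_mono)
    fix t :: real
    show "ennreal ((1 - (1 + -1 * t)) powr s / (1 - (1 + -1 * t) * (1 - \<delta>)) ^ m) * indicator {0<..<1} (1 + -1 * t)
      \<le> ennreal (1 / \<delta> ^ m) * (ennreal (t powr s) * indicator {0..\<delta>} t) + ennreal (t powr (s - real m)) * indicator {\<delta>..} t"
    proof (cases "0 < t \<and> t < 1")
      case True
      then have t: "0 < t" "t < 1"
        by auto
      define u where "u = 1 - (1 - t) * (1 - \<delta>)"
      have "(1 - t) * (1 - \<delta>) \<le> 1 - \<delta>"
        by (rule order_trans[OF mult_right_mono[of "1 - t" 1 "1 - \<delta>"]]) (use t \<delta> in auto)
      moreover have "(1 - t) * (1 - \<delta>) \<le> 1 - t"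
        by (rule order_trans[OF mult_left_mono[of "1 - \<delta>" 1 "1 - t"]]) (use t \<delta> in auto)
      moreover have "u + (1 - t) * (1 - \<delta>) = 1"
        by (simp add: u_def)
      ultimately have u: "\<delta> \<le> u" "t \<le> u"
        by linarith+
      show ?thesis
      proof (cases "t \<le> \<delta>")
        case True
        have "t powr s / u ^ m \<le> t powr s / \<delta> ^ m"
          using u \<delta> t by (intro divide_left_mono power_mono mult_pos_pos zero_less_power) auto
        then have "ennreal (t powr s / u ^ m) \<le> ennreal (1 / \<delta> ^ m) * ennreal (t powr s)"
          using \<delta> by (subst ennreal_mult[symmetric]) (auto intro: ennreal_leI)
        then show ?thesis
          using t True by (simp add: u_def add_increasing2)
      next
        case False
        have "t powr s / u ^ m \<le> t powr s / t ^ m"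
          using u \<delta> t by (intro divide_left_mono power_mono mult_pos_pos zero_less_power) auto
        also have "\<dots> = t powr (s - real m)"
          using t by (simp add: powr_diff powr_realpow)
        finally have "ennreal (t powr s / u ^ m) \<le> ennreal (t powr (s - real m))"
          by (rule ennreal_leI)
        then show ?thesis
          using t False by (simp add: u_def)
      qed
    qed (auto simp: indicator_def)
  qed
  also have "\<dots> = ennreal (1 / \<delta> ^ m) * (\<integral>\<^sup>+t. ennreal (t powr s) * indicator {0..\<delta>} t \<partial>lborel)
      + (\<integral>\<^sup>+t. ennreal (t powr (s - real m)) * indicator {\<delta>..} t \<partial>lborel)"
    by (subst nn_integral_add) (simp_all add: nn_integral_cmult)
  also have "(\<integral>\<^sup>+t. ennreal (t powr s) * indicator {0..\<delta>} t \<partial>lborel) = ennreal (\<delta> powr (s + 1) / (s + 1))"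
    using \<delta> by (intro nn_integral_has_integral_lebesgue' has_integral_powr_from_0 s) auto
  also have "(\<integral>\<^sup>+t. ennreal (t powr (s - real m)) * indicator {\<delta>..} t \<partial>lborel) = ennreal (- (\<delta> powr (s - real m + 1)) / (s - real m + 1))"
    using \<delta> m by (intro nn_integral_has_integral_lebesgue' has_integral_powr_to_inf) auto
  also have "ennreal (1 / \<delta> ^ m) * ennreal (\<delta> powr (s + 1) / (s + 1)) + ennreal (- (\<delta> powr (s - real m + 1)) / (s - real m + 1))
      = ennreal (1 / \<delta> ^ m * (\<delta> powr (s + 1) / (s + 1)) + - (\<delta> powr (s - real m + 1)) / (s - real m + 1))"
  proof -
    have *: "ennreal x * ennreal y + ennreal z = ennreal (x * y + z)" if "0 \<le> x" "0 \<le> y" "0 \<le> z" for x y z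
      using that by (simp add: ennreal_mult ennreal_plus)
    show ?thesis
      by (rule *) (use \<delta> s m in \<open>auto simp: divide_nonneg_neg\<close>)
  qed
  also have "1 / \<delta> ^ m * (\<delta> powr (s + 1) / (s + 1)) + - (\<delta> powr (s - real m + 1)) / (s - real m + 1)
      = (1 / (s + 1) + 1 / (real m - s - 1)) * \<delta> powr (s + 1 - real m)"
  proof -
    have "1 / \<delta> ^ m * (\<delta> powr (s + 1) / (s + 1)) = \<delta> powr (s + 1 - real m) / (s + 1)"
      using \<delta> by (simp add: powr_diff powr_realpow)
    moreover have "- (\<delta> powr (s - real m + 1)) / (s - real m + 1) = \<delta> powr (s + 1 - real m) / (real m - s - 1)"
    proof -
      have "s - real m + 1 = - (real m - s - 1)" "s + 1 - real m = - (real m - s - 1)"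
        by simp_all
      then show ?thesis
        by (simp only: minus_divide_divide)
    qed
    ultimately show ?thesis
      by (simp add: distrib_right)
  qed
  finally show ?thesis .
qed

text \<open>In polar coordinates the slice bound is integrated against (1 - r^2)^s. The radial
  integral grows like (1 - |a|)^(s+1-m) with m = 2 q - N, which the normalizing factor with exponent
  m - s - 1 cancels.\<close>

lemma bergman_sqnorm_kernel_le:
  fixes s :: real
  assumes s: "s > -1" and q: "real CARD('n) + s + 1 < 2 * real q" "CARD('n) < 2 * q"
  obtains C where "0 \<le> C" "\<And>a :: complex ^ 'n. norm a < 1 \<Longrightarrow>
    bergman_sqnorm s (kernel_power (real CARD('n) + s + 1) q a) \<le> ennreal C"
proof -
  define m where "m = 2 * q - CARD('n)"
  have m: "s + 1 < real m" "real m = 2 * real q - real CARD('n)"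
    using q by (simp_all add: m_def)
  define W where "W = weight_const TYPE('n) s"
  have W: "W > 0"
    unfolding W_def by (rule weight_const_pos[OF s])
  \<comment> \<open>The factor 2 powr |s| bounds (1 + r)^s for either sign of s, which replaces (1 -
    r^2)^s by (1 - r)^s.\<close>
  define A where "A = 2 * real CARD('n) * (16 * 676 ^ CARD('n)) * W * 2 powr \<bar>s\<bar>"
  define E where "E = 1 / (s + 1) + 1 / (real m - s - 1)"
  have A: "0 \<le> A" and E: "0 \<le> E"
    using W s m by (simp_all add: A_def E_def)
  show thesis
  proof (rule that[of "A * E * 2 powr (real m - s - 1)"])
    show "0 \<le> A * E * 2 powr (real m - s - 1)"
      using A E by simp
    fix a :: "complex ^ 'n"
    assume a: "norm a < 1"
    note a' = one_minus_square_le[OF a]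
    define G where "G = kernel_power (real CARD('n) + s + 1) q a"
    define P where "P = (1 - (norm a)\<^sup>2) powr (2 * real q - (real CARD('n) + s + 1))"
    have P: "0 \<le> P"
      by (simp add: P_def)
    have G: "holomorphic_sv_on G (ball 0 1)"
      unfolding G_def by (rule holomorphic_kernel_power[OF a])
    note [measurable] = borel_measurable_ball_square[OF G]
    let ?J = "\<lambda>r. \<integral>\<^sup>+\<zeta>\<in>sphere 0 1. ball_square G (r *\<^sub>R \<zeta>) * ennreal (bergman_weight s (r *\<^sub>R \<zeta>)) \<partial>sphere_measure"
    have "bergman_sqnorm s G = (\<integral>\<^sup>+r\<in>{0<..<1}. ennreal (2 * real CARD('n) * r ^ (2 * CARD('n) - 1)) *
      ?J r \<partial>lborel)"
      unfolding bergman_sqnorm_eq[OF s] by (rule nn_integral_ball_measure_polar) measurable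
    also have "\<dots> \<le> (\<integral>\<^sup>+r. ennreal (A * P) * (ennreal ((1 - r) powr s / (1 - r * (1 - (1 - norm a))) ^ m) * indicator {0<..<1} r) \<partial>lborel)"
    proof (rule nn_integral_mono)
      fix r :: real
      show "ennreal (2 * real CARD('n) * r ^ (2 * CARD('n) - 1)) *
          ?J r * indicator {0<..<1} r
        \<le> ennreal (A * P) * (ennreal ((1 - r) powr s / (1 - r * (1 - (1 - norm a))) ^ m) * indicator {0<..<1} r)"
      proof (cases "0 < r \<and> r < 1")
        case True
        then have r: "0 < r" "r < 1"
          by auto
        define w where "w = W * (1 - r\<^sup>2) powr s"
        have w0: "0 \<le> w"
          using W by (simp add: w_def)
        have ra: "r * norm a < 1"
          using a r mult_strict_mono[of r 1 "norm a" 1] by simp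
        define k where "k = P * (16 * 676 ^ CARD('n) / (1 - r * norm a) ^ m)"
        have k0: "0 \<le> k"
          using P ra by (simp add: k_def)
        have w: "w \<le> W * (2 powr \<bar>s\<bar> * (1 - r) powr s)"
        proof -
          have "1 - r\<^sup>2 = (1 + r) * (1 - r)"
            by (simp add: power2_eq_square algebra_simps)
          then have "(1 - r\<^sup>2) powr s = (1 + r) powr s * (1 - r) powr s"
            using r by (simp add: powr_mult)
          also have "\<dots> \<le> 2 powr \<bar>s\<bar> * (1 - r) powr s"
          proof (rule mult_right_mono)
            have "(1 + r) powr s \<le> (1 + r) powr \<bar>s\<bar>"
              using r by (intro powr_mono) auto
            also have "\<dots> \<le> 2 powr \<bar>s\<bar>"
              using r by (intro powr_mono2) auto
            finally show "(1 + r) powr s \<le> 2 powr \<bar>s\<bar>" .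
          qed simp
          finally show ?thesis
            unfolding w_def using W by (intro mult_left_mono) auto
        qed
        have "?J r
            = (\<integral>\<^sup>+\<zeta>. ennreal w * (ball_square G (r *\<^sub>R \<zeta>) * indicator (sphere 0 1) \<zeta>) \<partial>sphere_measure)"
          using r by (intro nn_integral_cong) (simp add: bergman_weight_eq w_def W_def indicator_def mult.commute)
        also have "\<dots> = ennreal w * slice_square G r"
          by (rule nn_integral_cmult) measurable
        also have "\<dots> \<le> ennreal w * ennreal k"
          unfolding G_def k_def P_def m_def by (intro mult_left_mono kernel_power_slice_le a r q) simp
        finally have I: "?J r
            \<le> ennreal (w * k)"
          using w0 k0 by (simp add: ennreal_mult)
        have "2 * real CARD('n) * r ^ (2 * CARD('n) - 1) \<le> 2 * real CARD('n)"
          using r by (simp add: mult_left_le power_le_one)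
        then have "ennreal (2 * real CARD('n) * r ^ (2 * CARD('n) - 1)) *
            ?J r
            \<le> ennreal (2 * real CARD('n)) * ennreal (w * k)"
          by (intro mult_mono[OF ennreal_leI I]) auto
        also have "\<dots> = ennreal (2 * real CARD('n) * (w * k))"
          using w0 k0 by (simp add: ennreal_mult)
        also have "\<dots> \<le> ennreal (A * P * ((1 - r) powr s / (1 - r * norm a) ^ m))"
        proof (rule ennreal_leI)
          have "2 * real CARD('n) * (w * k) \<le> 2 * real CARD('n) * ((W * (2 powr \<bar>s\<bar> * (1 - r) powr s)) * k)"
            using w k0 by (intro mult_left_mono mult_right_mono) auto
          also have "\<dots> = A * P * ((1 - r) powr s / (1 - r * norm a) ^ m)"
            by (simp add: A_def k_def)
          finally show "2 * real CARD('n) * (w * k) \<le> A * P * ((1 - r) powr s / (1 - r * norm a) ^ m)" .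
        qed
        also have "\<dots> = ennreal (A * P) * (ennreal ((1 - r) powr s / (1 - r * norm a) ^ m) * 1)"
          unfolding mult_1_right using ra A P by (intro ennreal_mult) auto
        also have "1 = (indicator {0<..<1} r :: ennreal)"
          using r by simp
        also have "norm a = 1 - (1 - norm a)"
          by simp
        finally show ?thesis
          using r by simp
      qed simp
    qed
    also have "\<dots> = ennreal (A * P) * (\<integral>\<^sup>+r\<in>{0<..<1}. ennreal ((1 - r) powr s / (1 - r * (1 - (1 - norm a))) ^ m) \<partial>lborel)"
      by (rule nn_integral_cmult) measurable
    also have "\<dots> \<le> ennreal (A * P) * ennreal (E * (1 - norm a) powr (s + 1 - real m))"
      unfolding E_def using a' by (intro mult_left_mono nn_integral_radial_kernel_le s m) auto
    also have "\<dots> = ennreal (A * P * (E * (1 - norm a) powr (s + 1 - real m)))"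
      using A P E by (simp add: ennreal_mult)
    also have "\<dots> \<le> ennreal (A * E * 2 powr (real m - s - 1))"
    proof (rule ennreal_leI)
      have ex: "2 * real q - (real CARD('n) + s + 1) = real m - s - 1"
        using m by simp
      have "P \<le> (2 * (1 - norm a)) powr (real m - s - 1)"
        unfolding P_def ex by (rule powr_mono2) (use a' m(1) in auto)
      also have "\<dots> = 2 powr (real m - s - 1) * (1 - norm a) powr (real m - s - 1)"
        by (rule powr_mult)
      finally have "A * P * (E * (1 - norm a) powr (s + 1 - real m))
          \<le> A * (2 powr (real m - s - 1) * (1 - norm a) powr (real m - s - 1)) * (E * (1 - norm a) powr (s + 1 - real m))"
        using A E by (intro mult_right_mono mult_left_mono) auto
      also have "\<dots> = A * E * 2 powr (real m - s - 1) * ((1 - norm a) powr (real m - s - 1) * (1 - norm a) powr (s + 1 - real m))"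
        by (simp only: mult_ac)
      also have "(1 - norm a) powr (real m - s - 1) * (1 - norm a) powr (s + 1 - real m) = 1"
        using a' by (simp flip: powr_add)
      finally show "A * P * (E * (1 - norm a) powr (s + 1 - real m)) \<le> A * E * 2 powr (real m - s - 1)"
        by simp
    qed
    finally show "bergman_sqnorm s (kernel_power (real CARD('n) + s + 1) q a) \<le> ennreal (A * E * 2 powr (real m - s - 1))"
      by (simp add: G_def)
  qed
qed

section \<open>Hardy and Bergman spaces as kernel spaces\<close>

lemma kernel_space_hardy:
  "kernel_space (hardy_space :: (complex ^ 'n \<Rightarrow> complex) set) hardy_norm (real CARD('n))"
proof
  fix f g :: "complex ^ 'n \<Rightarrow> complex"
  show "f \<in> hardy_space \<Longrightarrow> holomorphic_sv_on f (ball 0 1)"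
    by (simp add: hardy_space_def)
  show "0 \<le> hardy_norm f"
    by (simp add: hardy_norm_def)
  assume "f \<in> hardy_space" "g \<in> hardy_space"
  then have fg: "holomorphic_sv_on f (ball 0 1)" "holomorphic_sv_on g (ball 0 1)" "hardy_sqnorm f < \<infinity>" "hardy_sqnorm g < \<infinity>"
    by (auto simp: hardy_space_def)
  note d = sqrt_enn2real_diff[OF hardy_sqnorm_diff[OF fg(1,2)] fg(3,4)]
  show "(\<lambda>z. f z - g z) \<in> hardy_space"
    unfolding hardy_space_def using d(1) holomorphic_sv_on_diff[OF fg(1,2)] by simp
  show "(hardy_norm (\<lambda>z. f z - g z))\<^sup>2 \<le> 2 * (hardy_norm f)\<^sup>2 + 2 * (hardy_norm g)\<^sup>2"
    unfolding hardy_norm_def by (rule d(2))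
next
  have "cmod (f z) \<le> sqrt (121 * 16 ^ CARD('n) * (5 / 2 * CARD('n))) * hardy_norm f * (1 - (norm z)\<^sup>2) powr (- real CARD('n) / 2)"
    if "f \<in> hardy_space" "z \<in> ball 0 1" for f :: "complex ^ 'n \<Rightarrow> complex" and z
    unfolding hardy_norm_def
    using that
    by (intro point_evaluation_from_square hardy_point_evaluation) (auto simp: hardy_space_def power_less_one_iff)
  then show "\<exists>C. \<forall>f\<in>hardy_space. \<forall>z\<in>ball (0 :: complex ^ 'n) 1. cmod (f z) \<le> C * hardy_norm f * (1 - (norm z)\<^sup>2) powr (- real CARD('n) / 2)"
    by blast
next
  have "f \<in> hardy_space \<and> hardy_norm f \<le> 1 * B"
    if f: "holomorphic_sv_on f (ball 0 1)" and B: "\<forall>z\<in>ball 0 1. cmod (f z) \<le> B" for f :: "complex ^ 'n \<Rightarrow> complex" and B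
  proof -
    have "0 \<le> B"
      using B norm_ge_zero[of "f 0"] by (meson centre_in_ball order_trans zero_less_one)
    have "hardy_sqnorm f \<le> ennreal (B\<^sup>2)"
      unfolding hardy_sqnorm_eq
    proof (rule SUP_least)
      fix r :: real
      assume "r \<in> {0<..<1}"
      have "slice_square f r \<le> (\<integral>\<^sup>+\<zeta>. ennreal (B\<^sup>2) \<partial>(sphere_measure :: (complex ^ 'n) measure))"
        using B by (intro nn_integral_mono) (auto simp: ball_square_def indicator_def intro!: ennreal_leI power_mono)
      then show "slice_square f r \<le> ennreal (B\<^sup>2)"
        by (simp add: emeasure_sphere_measure_UNIV)
    qed
    moreover from this have "enn2real (hardy_sqnorm f) \<le> B\<^sup>2"
      by (intro enn2real_leI) auto
    then have "sqrt (enn2real (hardy_sqnorm f)) \<le> sqrt (B\<^sup>2)"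
      by (rule real_sqrt_le_mono)
    then have "sqrt (enn2real (hardy_sqnorm f)) \<le> B"
      using \<open>0 \<le> B\<close> by simp
    ultimately show ?thesis
      using f by (auto simp: hardy_space_def hardy_norm_def intro: order.strict_trans1)
  qed
  then show "\<exists>C. \<forall>f B. holomorphic_sv_on f (ball (0 :: complex ^ 'n) 1) \<longrightarrow> (\<forall>z\<in>ball 0 1. cmod (f z) \<le> B) \<longrightarrow> f \<in> hardy_space \<and> hardy_norm f \<le> C * B"
    by blast
next
  have "hardy_norm (kernel_power (real CARD('n)) q a) \<le> sqrt (2 ^ (2 * q - CARD('n)) * (16 * 676 ^ CARD('n)))"
    if q: "q \<ge> CARD('n)" and a: "a \<in> ball 0 1" for q and a :: "complex ^ 'n"
  proof -
    have "CARD('n) < 2 * q"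
      using q zero_less_card_finite[where ?'a = 'n] by linarith
    then show ?thesis
      unfolding hardy_norm_def using a
      by (intro real_sqrt_le_mono enn2real_leI hardy_sqnorm_kernel_le) auto
  qed
  then show "\<exists>p. \<forall>q\<ge>p. \<exists>C. \<forall>a\<in>ball (0 :: complex ^ 'n) 1. hardy_norm (kernel_power (real CARD('n)) q a) \<le> C"
    by blast
qed simp

lemma kernel_space_bergman:
  assumes s: "s > -1"
  shows "kernel_space (bergman_space s :: (complex ^ 'n \<Rightarrow> complex) set) (bergman_norm s) (real CARD('n) + s + 1)"
proof
  fix f g :: "complex ^ 'n \<Rightarrow> complex"
  show "0 \<le> real CARD('n) + s + 1"
    using s by simp
  show "f \<in> bergman_space s \<Longrightarrow> holomorphic_sv_on f (ball 0 1)"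
    by (simp add: bergman_space_def)
  show "0 \<le> bergman_norm s f"
    by (simp add: bergman_norm_def)
  assume "f \<in> bergman_space s" "g \<in> bergman_space s"
  then have fg: "holomorphic_sv_on f (ball 0 1)" "holomorphic_sv_on g (ball 0 1)" "bergman_sqnorm s f < \<infinity>" "bergman_sqnorm s g < \<infinity>"
    by (auto simp: bergman_space_def)
  note d = sqrt_enn2real_diff[OF bergman_sqnorm_diff[OF fg(1,2) s] fg(3,4)]
  show "(\<lambda>z. f z - g z) \<in> bergman_space s"
    unfolding bergman_space_def using d(1) holomorphic_sv_on_diff[OF fg(1,2)] by simp
  show "(bergman_norm s (\<lambda>z. f z - g z))\<^sup>2 \<le> 2 * (bergman_norm s f)\<^sup>2 + 2 * (bergman_norm s g)\<^sup>2"
    unfolding bergman_norm_def by (rule d(2))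
next
  obtain K where K: "0 \<le> K" "\<And>(f :: complex ^ 'n \<Rightarrow> complex) z. holomorphic_sv_on f (ball 0 1) \<Longrightarrow> norm z < 1 \<Longrightarrow>
    ennreal ((cmod (f z))\<^sup>2) \<le> ennreal (K * (1 - (norm z)\<^sup>2) powr (- (real CARD('n) + s + 1))) * bergman_sqnorm s f"
    using bergman_point_evaluation[OF s] by blast
  have "cmod (f z) \<le> sqrt K * bergman_norm s f * (1 - (norm z)\<^sup>2) powr (- (real CARD('n) + s + 1) / 2)"
    if "f \<in> bergman_space s" "z \<in> ball 0 1" for f :: "complex ^ 'n \<Rightarrow> complex" and z
    unfolding bergman_norm_def
    using that K(1)
    by (intro point_evaluation_from_square K(2)) (auto simp: bergman_space_def power_less_one_iff)
  then show "\<exists>C. \<forall>f\<in>bergman_space s. \<forall>z\<in>ball (0 :: complex ^ 'n) 1. cmod (f z) \<le> C * bergman_norm s f * (1 - (norm z)\<^sup>2) powr (- (real CARD('n) + s + 1) / 2)"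
    by blast
next
  obtain q :: nat where q: "real CARD('n) + s + 1 < real q"
    using reals_Archimedean2 by blast
  have q1: "real CARD('n) + s + 1 < 2 * real q" "real CARD('n) < real (2 * q)"
    using q s unfolding of_nat_mult of_nat_numeral by linarith+
  obtain C where C: "0 \<le> C" "\<And>a :: complex ^ 'n. norm a < 1 \<Longrightarrow> bergman_sqnorm s (kernel_power (real CARD('n) + s + 1) q a) \<le> ennreal C"
    using bergman_sqnorm_kernel_le[where ?'n = 'n, OF s q1(1) q1(2)[unfolded of_nat_less_iff]] by blast
  \<comment> \<open>The kernel power at a = 0 is the constant 1 on the ball, so its norm bound
    already says that the weight has finite mass; no Beta integral is evaluated.\<close>
  have mass: "(\<integral>\<^sup>+z. indicator (ball 0 1) z * ennreal (bergman_weight s z) \<partial>(ball_measure :: (complex ^ 'n) measure)) \<le> ennreal C"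
    using C(2)[of 0] by (simp add: bergman_sqnorm_eq[OF s] ball_square_def kernel_power_def)
  have "f \<in> bergman_space s \<and> bergman_norm s f \<le> sqrt C * B"
    if f: "holomorphic_sv_on f (ball 0 1)" and B: "\<forall>z\<in>ball 0 1. cmod (f z) \<le> B" for f :: "complex ^ 'n \<Rightarrow> complex" and B
  proof -
    have "0 \<le> B"
      using B norm_ge_zero[of "f 0"] by (meson centre_in_ball order_trans zero_less_one)
    have [measurable]: "ball (0 :: complex ^ 'n) 1 \<in> sets borel"
      by simp
    have "bergman_sqnorm s f \<le> (\<integral>\<^sup>+z. ennreal (B\<^sup>2) * (indicator (ball 0 1) z * ennreal (bergman_weight s z)) \<partial>(ball_measure :: (complex ^ 'n) measure))"
      unfolding bergman_sqnorm_eq[OF s] using B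
      by (intro nn_integral_mono) (auto simp: ball_square_def indicator_def intro!: ennreal_leI power_mono mult_right_mono)
    also have "\<dots> = ennreal (B\<^sup>2) * (\<integral>\<^sup>+z. indicator (ball 0 1) z * ennreal (bergman_weight s z) \<partial>(ball_measure :: (complex ^ 'n) measure))"
      by (rule nn_integral_cmult) measurable
    also have "\<dots> \<le> ennreal (B\<^sup>2) * ennreal C"
      by (intro mult_left_mono mass) simp
    also have "\<dots> = ennreal (C * B\<^sup>2)"
      using C(1) by (simp add: ennreal_mult mult.commute)
    finally have le: "bergman_sqnorm s f \<le> ennreal (C * B\<^sup>2)" .
    then have "enn2real (bergman_sqnorm s f) \<le> C * B\<^sup>2"
      using C(1) by (intro enn2real_leI) auto
    then have "sqrt (enn2real (bergman_sqnorm s f)) \<le> sqrt (C * B\<^sup>2)"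
      by (rule real_sqrt_le_mono)
    also have "\<dots> = sqrt C * B"
      using \<open>0 \<le> B\<close> by (simp add: real_sqrt_mult)
    finally show ?thesis
      using f le by (auto simp: bergman_space_def bergman_norm_def intro: order.strict_trans1)
  qed
  then show "\<exists>C. \<forall>f B. holomorphic_sv_on f (ball (0 :: complex ^ 'n) 1) \<longrightarrow> (\<forall>z\<in>ball 0 1. cmod (f z) \<le> B) \<longrightarrow> f \<in> bergman_space s \<and> bergman_norm s f \<le> C * B"
    by blast
next
  obtain p :: nat where p: "real CARD('n) + s + 1 < real p"
    using reals_Archimedean2 by blast
  have "\<exists>C. \<forall>a\<in>ball (0 :: complex ^ 'n) 1. bergman_norm s (kernel_power (real CARD('n) + s + 1) q a) \<le> C" if "q \<ge> p" for q
  proof -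
    have "real p \<le> real q"
      using that by simp
    then have q1: "real CARD('n) + s + 1 < 2 * real q" "real CARD('n) < real (2 * q)"
      using p s unfolding of_nat_mult of_nat_numeral by linarith+
    obtain C where C: "0 \<le> C" "\<And>a :: complex ^ 'n. norm a < 1 \<Longrightarrow> bergman_sqnorm s (kernel_power (real CARD('n) + s + 1) q a) \<le> ennreal C"
      using bergman_sqnorm_kernel_le[where ?'n = 'n, OF s q1(1) q1(2)[unfolded of_nat_less_iff]] by blast
    have "bergman_norm s (kernel_power (real CARD('n) + s + 1) q a) \<le> sqrt C" if "a \<in> ball 0 1" for a :: "complex ^ 'n"
      unfolding bergman_norm_def using that C
      by (intro real_sqrt_le_mono enn2real_leI) auto
    then show ?thesis
      by blast
  qed
  then show "\<exists>p. \<forall>q\<ge>p. \<exists>C. \<forall>a\<in>ball (0 :: complex ^ 'n) 1. bergman_norm s (kernel_power (real CARD('n) + s + 1) q a) \<le> C"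
    by blast
qed

theorem theorem3p1:
  fixes \<phi> \<psi> :: "complex ^ 'n \<Rightarrow> complex ^ 'n"
    and H :: "(complex ^ 'n \<Rightarrow> complex) set"
    and nrm :: "(complex ^ 'n \<Rightarrow> complex) \<Rightarrow> real"
  assumes "(H = hardy_space \<and> nrm = hardy_norm) \<or>
      (\<exists>s > -1. H = bergman_space s \<and> nrm = bergman_norm s)"
    and "linear_fractional_self_map \<phi>"
    and "linear_fractional_self_map \<psi>"
  shows "compact_operator_on H nrm
        (\<lambda>f z. composition_operator \<phi> f z - composition_operator \<psi> f z) \<longleftrightarrow>
      (compact_operator_on H nrm (composition_operator \<phi>) \<and>
       compact_operator_on H nrm (composition_operator \<psi>)) \<or>
      (\<forall>z\<in>ball 0 1. \<phi> z = \<psi> z)"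
proof -
  have "\<exists>\<gamma>. kernel_space H nrm \<gamma>"
    using assms(1) kernel_space_hardy kernel_space_bergman by blast
  then obtain \<gamma> where "kernel_space H nrm \<gamma>"
    by blast
  then show ?thesis
    using assms(2,3) by (rule kernel_space.compact_difference_iff)
qed

end
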